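(* If the value functional $\rho: G\to\mathbb{R}$ is $ci$-smooth of the order $\alpha$, then it satisfies the Hamilton--Jacobi--Bellman equation $$\partial_t^\alpha \rho(t,w(\cdot)) + \mathcal{H}\big(t, w(t), \nabla^\alpha \rho(t,w(\cdot))\big) = 0 \quad\text{for all } (t,w(\cdot))\in G^0,$$ where $\mathcal{H}(\tau,x,s)=\min_{u\in P}\big(\langle s, f(\tau,x,u)\rangle+\chi(\tau,x,u)\big)$ for $\tau\in[0,T]$, $x,s\in\mathbb{R}^n$.
   Context: Fix $T>0$, $n \in \mathbb{N}$, $\alpha \in (0,1)$. $\|\cdot\|$ and $\langle\cdot,\cdot\rangle$ are the Euclidean norm and inner product in $\mathbb{R}^n$. Function spaces. For $t\in[0,T]$, $L^\infty([0,t],\mathbb{R}^n)$ is the set of measurable essentially bounded $\psi:[0,t]\to\mathbb{R}^n$. For $\beta\in(0,1)$, $(I^\beta\psi)(\tau)=\frac{1}{\Gamma(\beta)}\int_0^\tau \frac{\psi(\xi)}{(\tau-\xi)^{1-\beta}}d\xi$. $AC^\alpha([0,t],\mathbb{R}^n)$ is the set of functions $x:[0,t]\to\mathbb{R}^n$ of the form $x(\tau)=x(0)+(I^\alpha\psi)(\tau)$, $\tau\in[0,t]$, for some $\psi(\cdot)\in L^\infty([0,t],\mathbb{R}^n)$ (for $t=0$ it is identified with $\mathbb{R}^n$). For such $x(\cdot)$ the Caputo derivative $({}^CD^\alpha x)(\tau)=\frac{d}{d\tau}\big(I^{1-\alpha}(x(\cdot)-x(0))\big)(\tau)$ exists for a.e.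 $\tau\in[0,t]$ and equals $\psi(\tau)$ a.e. Positions. $G$ is the set of pairs $(t,w(\cdot))$ with $t\in[0,T]$ and $w(\cdot)\in AC^\alpha([0,t],\mathbb{R}^n)$; $G^0=\{(t,w(\cdot))\in G: t<T\}$. $G$ (and its subset $G^0$) carries the metric $\operatorname{dist}((t,w),(t',w'))=\max\{\operatorname{dist}^*((t,w),(t',w')),\operatorname{dist}^*((t',w'),(t,w))\}$, where $\operatorname{dist}^*((t,w),(t',w'))=\max_{\tau\in[0,t]}\min_{\tau'\in[0,t']}(|\tau-\tau'|^2+\|w(\tau)-w'(\tau')\|^2)^{1/2}$ (Hausdorff distance between graphs). Data. $P\subset\mathbb{R}^{n_u}$ is a nonempty compact set. $f:[0,T]\times\mathbb{R}^n\times P\to\mathbb{R}^n$ is continuous; for every $R>0$ there is $\lambda_f>0$ with $\|f(\tau,x,u)-f(\tau,x',u)\|\le\lambda_f\|x-x'\|$ for all $\tau\in[0,T]$, $\|x\|,\|x'\|\le R$, $u\in P$; and there is $c_f>0$ with $\|f(\tau,x,u)\|\le(1+\|x\|)c_f$ for all $(\tau,x,u)$. $\sigma:\mathbb{R}^n\to\mathbb{R}$ and $\chi:[0,T]\times\mathbb{R}^n\times P\to\mathbb{R}$ are continuous. Motions. For $0\le t\le\theta\le T$, $\mathcal{U}(t,\theta)$ is the set of measurable functions $u:[t,\theta]\to P$. For $(t,w(\cdot))\in G$, $\theta\in[t,T]$, $u(\cdot)\in\mathcal{U}(t,\theta)$, the motion $x(\cdot\mid t,w(\cdot),\theta,u(\cdot))$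 is the unique $x(\cdot)\in AC^\alpha([0,\theta],\mathbb{R}^n)$ with $x(\tau)=w(\tau)$ for $\tau\in[0,t]$ and $({}^CD^\alpha x)(\tau)=f(\tau,x(\tau),u(\tau))$ for a.e. $\tau\in[t,\theta]$ (it exists and is unique because $f$ is continuous and, in its second argument, locally Lipschitz continuous and of sublinear growth). Value functional. $J(t,w(\cdot),u(\cdot))=\sigma(x(T))+\int_t^T\chi(\tau,x(\tau),u(\tau))\,d\tau$ with $x(\cdot)=x(\cdot\mid t,w(\cdot),T,u(\cdot))$, and $\rho(t,w(\cdot))=\inf_{u(\cdot)\in\mathcal{U}(t,T)}J(t,w(\cdot),u(\cdot))$ for $(t,w(\cdot))\in G$. Coinvariant derivatives. For a function $x(\cdot)$ on $[0,T]$, $x_\tau(\cdot)$ denotes its restriction to $[0,\tau]$. For $(t,w(\cdot))\in G^0$, $X(t,w(\cdot))=\{x(\cdot)\in AC^\alpha([0,T],\mathbb{R}^n): x(\tau)=w(\tau),\ \tau\in[0,t]\}$. A functional $\varphi:G\to\mathbb{R}$ is $ci$-differentiable of the order $\alpha$ at $(t,w(\cdot))\in G^0$ if there exist $\partial_t^\alpha\varphi(t,w(\cdot))\in\mathbb{R}$ and $\nabla^\alpha\varphi(t,w(\cdot))\in\mathbb{R}^n$ such that for every $x(\cdot)\in X(t,w(\cdot))$ and $\tau\in(t,T)$ $$\varphi(\tau,x_\tau(\cdot))-\varphi(t,w(\cdot))=\partial_t^\alpha\varphi(t,w(\cdot))(\tau-t)+\Big\langle\nabla^\alpha\varphi(t,w(\cdot)),\big(I^{1-\alpha}(x(\cdot)-x(0))\big)(\tau)-\big(I^{1-\alpha}(w(\cdot)-w(0))\big)(t)\Big\rangle+o(\tau-t),$$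 where $o(\tau-t)$ may depend on $x(\cdot)$ and $o(\tau-t)/(\tau-t)\to0$ as $\tau\downarrow t$ (equivalently, the second entry of the inner product is $\int_t^\tau({}^CD^\alpha x)(\xi)d\xi$). These quantities are then unique. $\varphi$ is $ci$-smooth of the order $\alpha$ if $\varphi$ is continuous on $G$, is $ci$-differentiable of the order $\alpha$ at every point of $G^0$, and $\partial_t^\alpha\varphi:G^0\to\mathbb{R}$, $\nabla^\alpha\varphi:G^0\to\mathbb{R}^n$ are continuous (all with respect to $\operatorname{dist}$). *)

theory Defs
  imports "HOL-Analysis.Analysis"
begin

text \<open>
  A function on an interval \<open>{a..b}\<close> is represented by a total function that is
  \<^const>\<open>extensional\<close> there, so that functions agreeing on the interval are equal.
  Measurability and ``almost everywhere'' refer to Lebesgue measure.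
\<close>

definition Linf :: "real \<Rightarrow> (real \<Rightarrow> 'a::euclidean_space) set" where
  "Linf t = {\<psi> \<in> extensional {0..t}. \<psi> \<in> borel_measurable (lebesgue_on {0..t}) \<and>
     (\<exists>C. AE \<tau> in lebesgue_on {0..t}. norm (\<psi> \<tau>) \<le> C)}"

text \<open>At the endpoint \<open>\<xi> = \<tau>\<close> the kernel is \<open>1 / 0 = 0\<close>, which does not affect the integral.\<close>

definition frac_int :: "real \<Rightarrow> (real \<Rightarrow> 'a::euclidean_space) \<Rightarrow> real \<Rightarrow> 'a" where
  "frac_int \<beta> \<psi> \<tau> =
     (1 / Gamma \<beta>) *\<^sub>R (LINT \<xi>:{0..\<tau>}|lebesgue. (1 / (\<tau> - \<xi>) powr (1 - \<beta>)) *\<^sub>R \<psi> \<xi>)"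

definition AC :: "real \<Rightarrow> real \<Rightarrow> (real \<Rightarrow> 'a::euclidean_space) set" where
  "AC \<alpha> t = {x \<in> extensional {0..t}.
     \<exists>\<psi>\<in>Linf t. \<forall>\<tau>\<in>{0..t}. x \<tau> = x 0 + frac_int \<alpha> \<psi> \<tau>}"

definition has_caputo_derivative ::
    "real \<Rightarrow> (real \<Rightarrow> 'a::euclidean_space) \<Rightarrow> 'a \<Rightarrow> real \<Rightarrow> bool" where
  "has_caputo_derivative \<alpha> x d \<tau> \<longleftrightarrow>
     (frac_int (1 - \<alpha>) (\<lambda>\<xi>. x \<xi> - x 0) has_vector_derivative d) (at \<tau>)"

type_synonym 'a position = "real \<times> (real \<Rightarrow> 'a)"

definition positions :: "real \<Rightarrow> real \<Rightarrow> 'a::euclidean_space position set" where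
  "positions \<alpha> T = {(t, w). t \<in> {0..T} \<and> w \<in> AC \<alpha> t}"

definition positions0 :: "real \<Rightarrow> real \<Rightarrow> 'a::euclidean_space position set" where
  "positions0 \<alpha> T = {(t, w) \<in> positions \<alpha> T. t < T}"

text \<open>
  Hausdorff distance between graphs. On positions the supremum and the infimum are
  attained, since functions in \<^const>\<open>AC\<close> are continuous.
\<close>

definition pos_dist_star :: "'a::euclidean_space position \<Rightarrow> 'a position \<Rightarrow> real" where
  "pos_dist_star = (\<lambda>(t, w) (t', w').
     SUP \<tau>\<in>{0..t}. INF \<tau>'\<in>{0..t'}. sqrt (\<bar>\<tau> - \<tau>'\<bar>\<^sup>2 + (norm (w \<tau> - w' \<tau>'))\<^sup>2))"

definition pos_dist :: "'a::euclidean_space position \<Rightarrow> 'a position \<Rightarrow> real" where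
  "pos_dist p q = max (pos_dist_star p q) (pos_dist_star q p)"

definition pos_continuous_on ::
    "'a::euclidean_space position set \<Rightarrow> ('a position \<Rightarrow> 'b::metric_space) \<Rightarrow> bool" where
  "pos_continuous_on S \<phi> \<longleftrightarrow>
     (\<forall>p\<in>S. \<forall>\<epsilon>>0. \<exists>\<delta>>0. \<forall>q\<in>S. pos_dist q p < \<delta> \<longrightarrow> dist (\<phi> q) (\<phi> p) < \<epsilon>)"

definition controls :: "'c::euclidean_space set \<Rightarrow> real \<Rightarrow> real \<Rightarrow> (real \<Rightarrow> 'c) set" where
  "controls P t \<theta> = {u \<in> {t..\<theta>} \<rightarrow>\<^sub>E P. u \<in> borel_measurable (lebesgue_on {t..\<theta>})}"

definition motion ::
    "real \<Rightarrow> (real \<Rightarrow> 'a::euclidean_space \<Rightarrow> 'c::euclidean_space \<Rightarrow> 'a) \<Rightarrow>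
     real \<Rightarrow> (real \<Rightarrow> 'a) \<Rightarrow> real \<Rightarrow> (real \<Rightarrow> 'c) \<Rightarrow> real \<Rightarrow> 'a" where
  "motion \<alpha> f t w \<theta> u = (THE x. x \<in> AC \<alpha> \<theta> \<and> (\<forall>\<tau>\<in>{0..t}. x \<tau> = w \<tau>) \<and>
     (AE \<tau> in lebesgue_on {t..\<theta>}. has_caputo_derivative \<alpha> x (f \<tau> (x \<tau>) (u \<tau>)) \<tau>))"

definition cost ::
    "real \<Rightarrow> real \<Rightarrow> (real \<Rightarrow> 'a::euclidean_space \<Rightarrow> 'c::euclidean_space \<Rightarrow> 'a) \<Rightarrow>
     ('a \<Rightarrow> real) \<Rightarrow> (real \<Rightarrow> 'a \<Rightarrow> 'c \<Rightarrow> real) \<Rightarrow>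
     real \<Rightarrow> (real \<Rightarrow> 'a) \<Rightarrow> (real \<Rightarrow> 'c) \<Rightarrow> real" where
  "cost \<alpha> T f \<sigma> chi t w u = (let x = motion \<alpha> f t w T u in
     \<sigma> (x T) + (LINT \<tau>:{t..T}|lebesgue. chi \<tau> (x \<tau>) (u \<tau>)))"

definition value_functional ::
    "real \<Rightarrow> real \<Rightarrow> 'c::euclidean_space set \<Rightarrow>
     (real \<Rightarrow> 'a::euclidean_space \<Rightarrow> 'c \<Rightarrow> 'a) \<Rightarrow>
     ('a \<Rightarrow> real) \<Rightarrow> (real \<Rightarrow> 'a \<Rightarrow> 'c \<Rightarrow> real) \<Rightarrow> 'a position \<Rightarrow> real" where
  "value_functional \<alpha> T P f \<sigma> chi = (\<lambda>(t, w).
     INF u\<in>controls P t T. cost \<alpha> T f \<sigma> chi t w u)"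

definition extensions ::
    "real \<Rightarrow> real \<Rightarrow> 'a::euclidean_space position \<Rightarrow> (real \<Rightarrow> 'a) set" where
  "extensions \<alpha> T = (\<lambda>(t, w). {x \<in> AC \<alpha> T. \<forall>\<tau>\<in>{0..t}. x \<tau> = w \<tau>})"

definition has_ci_derivative ::
    "real \<Rightarrow> real \<Rightarrow> ('a::euclidean_space position \<Rightarrow> real) \<Rightarrow> real \<Rightarrow> 'a \<Rightarrow> 'a position \<Rightarrow> bool" where
  "has_ci_derivative \<alpha> T \<phi> a s = (\<lambda>(t, w). \<forall>x\<in>extensions \<alpha> T (t, w).
     ((\<lambda>\<tau>. (\<phi> (\<tau>, restrict x {0..\<tau>}) - \<phi> (t, w) - a * (\<tau> - t)
            - s \<bullet> (frac_int (1 - \<alpha>) (\<lambda>\<xi>. x \<xi> - x 0) \<tau> - frac_int (1 - \<alpha>) (\<lambda>\<xi>. w \<xi> - w 0) t))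
           / (\<tau> - t)) \<longlongrightarrow> 0) (at_right t))"

definition ci_differentiable ::
    "real \<Rightarrow> real \<Rightarrow> ('a::euclidean_space position \<Rightarrow> real) \<Rightarrow> 'a position \<Rightarrow> bool" where
  "ci_differentiable \<alpha> T \<phi> p \<longleftrightarrow> (\<exists>a s. has_ci_derivative \<alpha> T \<phi> a s p)"

definition ci_dt ::
    "real \<Rightarrow> real \<Rightarrow> ('a::euclidean_space position \<Rightarrow> real) \<Rightarrow> 'a position \<Rightarrow> real" where
  "ci_dt \<alpha> T \<phi> p = (THE a. \<exists>s. has_ci_derivative \<alpha> T \<phi> a s p)"

definition ci_grad ::
    "real \<Rightarrow> real \<Rightarrow> ('a::euclidean_space position \<Rightarrow> real) \<Rightarrow> 'a position \<Rightarrow> 'a" where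
  "ci_grad \<alpha> T \<phi> p = (THE s. \<exists>a. has_ci_derivative \<alpha> T \<phi> a s p)"

definition ci_smooth ::
    "real \<Rightarrow> real \<Rightarrow> ('a::euclidean_space position \<Rightarrow> real) \<Rightarrow> bool" where
  "ci_smooth \<alpha> T \<phi> \<longleftrightarrow>
     pos_continuous_on (positions \<alpha> T) \<phi> \<and>
     (\<forall>p\<in>positions0 \<alpha> T. ci_differentiable \<alpha> T \<phi> p) \<and>
     pos_continuous_on (positions0 \<alpha> T) (ci_dt \<alpha> T \<phi>) \<and>
     pos_continuous_on (positions0 \<alpha> T) (ci_grad \<alpha> T \<phi>)"

text \<open>For compact nonempty \<open>P\<close> and continuous \<open>f\<close>, \<open>chi\<close> the infimum is a minimum.\<close>

definition hamiltonian ::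
    "'c::euclidean_space set \<Rightarrow> (real \<Rightarrow> 'a::euclidean_space \<Rightarrow> 'c \<Rightarrow> 'a) \<Rightarrow>
     (real \<Rightarrow> 'a \<Rightarrow> 'c \<Rightarrow> real) \<Rightarrow> real \<Rightarrow> 'a \<Rightarrow> 'a \<Rightarrow> real" where
  "hamiltonian P f chi \<tau> x s = (INF u\<in>P. s \<bullet> f \<tau> x u + chi \<tau> x u)"

end

theory Submission
  imports Defs
begin

text \<open>
  A motion solves the integral equation \<open>x = w 0 + I\<^sup>\<alpha> \<psi>\<close> whose density is that of \<open>w\<close> before
  \<open>t\<close> and the field along \<open>x\<close> after it; the passage back to the Caputo derivative rests on
  \<open>I\<^bsup>1-\<alpha>\<^esup> I\<^sup>\<alpha> = I\<^sup>1\<close> (Fubini and the Beta integral) and on Lebesgue differentiation. A Gronwall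
  inequality for \<open>I\<^sup>\<alpha>\<close> gives uniqueness, and bounds and equicontinuity of the motions which are uniform
  in the control, hence the dynamic programming principle. A constant control inserted in it yields
  \<open>\<ge>\<close> in the equation. For \<open>\<le>\<close>, a positive left-hand side would, by continuity of the
  coinvariant derivatives, keep the lower right derivative of the value plus the accumulated cost
  above one positive constant along every motion, so all costs would exceed the value.
\<close>

section \<open>Fractional integrals of bounded functions\<close>

text \<open>The infimum in the value need not be attained, and the remainder of a coinvariant
  expansion depends on the motion. A negative left-hand side is refuted by one control, but a
  positive one only by a gain on a time step common to all controls. Hence the Hoelder bounds free
  of the control: during that step they keep every motion where the coinvariant derivatives have
  barely changed. One expansion at the initial position says nothing about a step of prescribed
  length, so the expansion is repeated at every later position of the motion, and a supremum
  argument adds up the one-sided estimates. The singular kernel is tamed by the weight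
  \<open>exp (l * s)\<close>: for large \<open>l\<close> the fractional integral is small relative
  to it, which serves existence and the Gronwall inequality alike. As the equation fixes the Caputo
  derivative only almost everywhere, while values depend on the entire past, motions are compared
  through their densities on all of \<open>{0..\<theta>}\<close>.\<close>

definition bounded_measurable :: "real \<Rightarrow> (real \<Rightarrow> 'a::euclidean_space) \<Rightarrow> bool" where
  "bounded_measurable t \<psi> \<longleftrightarrow> \<psi> \<in> borel_measurable (lebesgue_on {0..t}) \<and> bounded (\<psi> ` {0..t})"

lemma bounded_measurableI:
  assumes "\<psi> \<in> borel_measurable (lebesgue_on {0..t})" "\<And>s. s \<in> {0..t} \<Longrightarrow> norm (\<psi> s) \<le> C"
  shows "bounded_measurable t \<psi>"
  using assms unfolding bounded_measurable_def bounded_iff by blast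

lemma bounded_measurable_bound: "bounded_measurable t \<psi> \<Longrightarrow> \<exists>C>0. \<forall>s\<in>{0..t}. norm (\<psi> s) \<le> C"
  unfolding bounded_measurable_def bounded_pos by auto

lemma bounded_measurable_measurable: "bounded_measurable t \<psi> \<Longrightarrow> \<psi> \<in> borel_measurable (lebesgue_on {0..t})"
  by (simp add: bounded_measurable_def)

lemma bounded_measurable_subset: "bounded_measurable t \<psi> \<Longrightarrow> \<tau> \<le> t \<Longrightarrow> bounded_measurable \<tau> \<psi>"
  unfolding bounded_measurable_def
  by (meson atLeastatMost_subset_iff bounded_subset image_mono measurable_restrict_mono order_refl)

lemma bounded_measurable_cong: "bounded_measurable t \<psi> \<Longrightarrow> (\<And>s. s \<in> {0..t} \<Longrightarrow> \<phi> s = \<psi> s) \<Longrightarrow> bounded_measurable t \<phi>"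
  unfolding bounded_measurable_def
  by (metis (no_types, lifting) image_cong inf_top.right_neutral measurable_cong space_lebesgue_on)

lemma bounded_measurable_diff: "bounded_measurable t \<psi> \<Longrightarrow> bounded_measurable t \<phi> \<Longrightarrow> bounded_measurable t (\<lambda>s. \<psi> s - \<phi> s)"
proof -
  assume a: "bounded_measurable t \<psi>" "bounded_measurable t \<phi>"
  obtain C D where "\<And>s. s \<in> {0..t} \<Longrightarrow> norm (\<psi> s) \<le> C" "\<And>s. s \<in> {0..t} \<Longrightarrow> norm (\<phi> s) \<le> D"
    using bounded_measurable_bound[OF a(1)] bounded_measurable_bound[OF a(2)] by blast
  then show ?thesis
    using a by (intro bounded_measurableI[where C="C + D"]) (auto simp: bounded_measurable_def intro!: norm_triangle_le_diff add_mono)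
qed

lemma bounded_measurable_add: "bounded_measurable t \<psi> \<Longrightarrow> bounded_measurable t \<phi> \<Longrightarrow> bounded_measurable t (\<lambda>s. \<psi> s + \<phi> s)"
proof -
  assume a: "bounded_measurable t \<psi>" "bounded_measurable t \<phi>"
  obtain C D where "\<And>s. s \<in> {0..t} \<Longrightarrow> norm (\<psi> s) \<le> C" "\<And>s. s \<in> {0..t} \<Longrightarrow> norm (\<phi> s) \<le> D"
    using bounded_measurable_bound[OF a(1)] bounded_measurable_bound[OF a(2)] by blast
  then show ?thesis
    using a by (intro bounded_measurableI[where C="C + D"]) (auto simp: bounded_measurable_def intro!: norm_triangle_le add_mono)
qed

lemma bounded_measurable_norm: "bounded_measurable t \<psi> \<Longrightarrow> bounded_measurable t (\<lambda>s. norm (\<psi> s))"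
  unfolding bounded_measurable_def by (auto simp: bounded_iff)

lemma bounded_measurable_scaleR: "bounded_measurable t \<psi> \<Longrightarrow> bounded_measurable t (\<lambda>s. c *\<^sub>R \<psi> s)"
proof -
  assume a: "bounded_measurable t \<psi>"
  obtain C where "\<And>s. s \<in> {0..t} \<Longrightarrow> norm (\<psi> s) \<le> C" using bounded_measurable_bound[OF a] by blast
  then show ?thesis using a
    by (intro bounded_measurableI[where C="\<bar>c\<bar> * C"]) (auto simp: bounded_measurable_def intro!: mult_left_mono)
qed

lemma bounded_measurable_mult: "bounded_measurable t \<psi> \<Longrightarrow> bounded_measurable t (\<lambda>s. c * \<psi> s)" for \<psi> :: "real \<Rightarrow> real"
  using bounded_measurable_scaleR[of t \<psi> c] by simp

lemma bounded_measurable_continuous: "continuous_on {0..t} \<psi> \<Longrightarrow> bounded_measurable t \<psi>"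
  unfolding bounded_measurable_def
  by (simp add: compact_continuous_image compact_imp_bounded continuous_imp_measurable_on_sets_lebesgue)

lemma bounded_measurable_const: "bounded_measurable t (\<lambda>s. c)"
  by (intro bounded_measurable_continuous continuous_intros)

text \<open>Densities of motions are pasted from a known past and a field known only from
  \<open>t\<close> on. Both pieces are extended by zero to the whole line and added.\<close>

lemma bounded_measurable_glue:
  assumes "bounded_measurable t \<psi>" "\<phi> \<in> borel_measurable (lebesgue_on {t..\<theta>})" "bounded (\<phi> ` {t..\<theta>})"
  shows "bounded_measurable \<theta> (\<lambda>s. if s < t then \<psi> s else \<phi> s)"
proof (rule bounded_measurable_cong)
  have "\<psi> \<in> borel_measurable (lebesgue_on {0..<t})"
    by (rule measurable_restrict_mono[OF bounded_measurable_measurable[OF assms(1)]]) auto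
  then have 1: "(\<lambda>s. if s \<in> {0..<t} then \<psi> s else 0) \<in> borel_measurable lebesgue"
    by (rule borel_measurable_if_I) simp
  have 2: "(\<lambda>s. if s \<in> {t..\<theta>} then \<phi> s else 0) \<in> borel_measurable lebesgue"
    using assms(2) by (rule borel_measurable_if_I) simp
  let ?g = "\<lambda>s. (if s \<in> {0..<t} then \<psi> s else 0) + (if s \<in> {t..\<theta>} then \<phi> s else 0)"
  have m: "?g \<in> borel_measurable (lebesgue_on {0..\<theta>})"
    by (rule measurable_restrict_space1[OF borel_measurable_add[OF 1 2]])
  obtain C where "\<And>s. s \<in> {0..t} \<Longrightarrow> norm (\<psi> s) \<le> C" "C > 0" using bounded_measurable_bound[OF assms(1)] by blast
  moreover obtain D where "\<And>s. s \<in> {t..\<theta>} \<Longrightarrow> norm (\<phi> s) \<le> D" "D > 0"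
    using assms(3) unfolding bounded_pos by blast
  ultimately show "bounded_measurable \<theta> ?g"
    by (intro bounded_measurableI[OF m, of "C + D"]) (auto intro: add_increasing add_increasing2)
qed auto

lemma bounded_measurable_integrable:
  assumes "bounded_measurable t \<psi>" "0 \<le> a" "b \<le> t"
  shows "set_integrable lebesgue {a..b} \<psi>"
proof -
  obtain C where C: "\<And>s. s \<in> {0..t} \<Longrightarrow> norm (\<psi> s) \<le> C" "C > 0" using bounded_measurable_bound[OF assms(1)] by blast
  have "(\<lambda>s. indicator {a..b} s *\<^sub>R \<psi> s) \<in> borel_measurable lebesgue"
    using measurable_restrict_mono[OF bounded_measurable_measurable[OF assms(1)], of "{a..b}"] assms
    by (subst borel_measurable_restrict_space_iff[symmetric]) auto
  moreover have "AE x in lebesgue. norm (indicator {a..b} x *\<^sub>R \<psi> x) \<le> norm (indicator {a..b} x * C)"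
    using C assms by (auto simp: indicator_def)
  moreover have "integrable lebesgue (\<lambda>x. indicator {a..b} x * C)"
    by (intro integrable_mult_left integrable_real_indicator) (auto simp: emeasure_lborel_Icc_eq)
  ultimately show ?thesis unfolding set_integrable_def
    using Bochner_Integration.integrable_bound by blast
qed

text \<open>Fubini's theorem is applied on the product of two copies of \<open>lborel\<close>, where
  a merely Lebesgue measurable density need not give a measurable integrand. The Borel
  representative is assembled coordinate by coordinate.\<close>

lemma bounded_measurable_borel_version:
  assumes "bounded_measurable t \<psi>"
  obtains \<phi> C where "\<phi> \<in> borel_measurable borel" "\<And>s. norm (\<phi> s) \<le> C"
    "AE s in lebesgue. s \<in> {0..t} \<longrightarrow> \<phi> s = \<psi> s"
proof -
  define g where "g = (\<lambda>s. indicator {0..t} s *\<^sub>R \<psi> s)"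
  have g: "g \<in> borel_measurable lebesgue"
    unfolding g_def using bounded_measurable_measurable[OF assms]
    by (subst borel_measurable_restrict_space_iff[symmetric]) auto
  have "\<exists>h. h \<in> borel_measurable lborel \<and> (AE s in lborel. g s \<bullet> i = h s)" for i
    using completion_ex_borel_measurable_real[of "\<lambda>s. g s \<bullet> i" lborel] g by auto
  then obtain h where h: "\<And>i. h i \<in> borel_measurable lborel" "\<And>i. AE s in lborel. g s \<bullet> i = h i s"
    by metis
  define \<phi>0 where "\<phi>0 = (\<lambda>s. \<Sum>i\<in>Basis. h i s *\<^sub>R i)"
  obtain C where C: "\<And>s. s \<in> {0..t} \<Longrightarrow> norm (\<psi> s) \<le> C" "C > 0" using bounded_measurable_bound[OF assms(1)] by blast
  \<comment> \<open>The coordinates \<open>h i\<close> are controlled only off a null set;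
    truncation restores the bound everywhere and changes nothing where \<open>\<phi>0\<close> equals
    \<open>g\<close>.\<close>
  define \<phi> where "\<phi> = (\<lambda>s. if norm (\<phi>0 s) \<le> C then \<phi>0 s else 0)"
  have [measurable]: "\<phi>0 \<in> borel_measurable borel"
    unfolding \<phi>0_def using h(1) by simp
  have "AE s in lborel. \<forall>i\<in>Basis. g s \<bullet> i = h i s"
    using h(2) by (intro AE_finite_allI) auto
  then have "AE s in lborel. g s = \<phi>0 s"
    by eventually_elim (metis (no_types, lifting) \<phi>0_def euclidean_representation sum.cong)
  then have "AE s in lebesgue. g s = \<phi>0 s" by (rule AE_completion)
  then have "AE s in lebesgue. s \<in> {0..t} \<longrightarrow> \<phi> s = \<psi> s"
  proof eventually_elim
    case (elim s)
    then show ?case using C(1)[of s] by (auto simp: \<phi>_def g_def)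
  qed
  moreover have "\<phi> \<in> borel_measurable borel" unfolding \<phi>_def by measurable
  moreover have "norm (\<phi> s) \<le> C" for s using C by (auto simp: \<phi>_def)
  ultimately show thesis using that by blast
qed

text \<open>At \<open>s = \<tau>\<close> the kernel has the junk value \<open>1 / 0 = 0\<close>, so \<open>frac_int \<beta> \<psi> \<tau>\<close> depends on \<open>\<psi>\<close>
  only on the half-open interval \<open>{0..<\<tau>}\<close>.\<close>

definition abel_kernel :: "real \<Rightarrow> real \<Rightarrow> real \<Rightarrow> real" where
  "abel_kernel \<beta> \<tau> s = (if 0 \<le> s \<and> s \<le> \<tau> then 1 / (\<tau> - s) powr (1 - \<beta>) else 0)"

section \<open>The Abel kernel and its integral\<close>

lemma abel_kernel_nonneg [simp]: "0 \<le> abel_kernel \<beta> \<tau> s"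
  by (auto simp: abel_kernel_def)

lemma abel_kernel_measurable [measurable]: "abel_kernel \<beta> \<tau> \<in> borel_measurable borel"
  unfolding abel_kernel_def by measurable

text \<open>The antiderivative is continuous up to \<open>\<tau>\<close> although the integrand
  blows up there for \<open>\<beta> < 1\<close>, so the derivative is matched only in the interior
  and the gauge integral absorbs the singularity.\<close>

lemma has_integral_abel:
  fixes a \<tau> \<beta> :: real
  assumes "0 < \<beta>" "a \<le> \<tau>"
  shows "((\<lambda>s. 1 / (\<tau> - s) powr (1 - \<beta>)) has_integral ((\<tau> - a) powr \<beta> / \<beta>)) {a..\<tau>}"
proof -
  let ?F = "\<lambda>s. - ((\<tau> - s) powr \<beta> / \<beta>)"
  have "((\<lambda>s. 1 / (\<tau> - s) powr (1 - \<beta>)) has_integral (?F \<tau> - ?F a)) {a..\<tau>}"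
  proof (rule fundamental_theorem_of_calculus_interior[OF assms(2)])
    show "continuous_on {a..\<tau>} ?F"
      using assms by (intro continuous_intros continuous_on_powr') auto
    fix s assume "s \<in> {a<..<\<tau>}"
    then have "(?F has_real_derivative 1 / (\<tau> - s) powr (1 - \<beta>)) (at s)"
      using assms by (auto intro!: derivative_eq_intros simp: powr_diff divide_simps powr_minus)
    then show "(?F has_vector_derivative 1 / (\<tau> - s) powr (1 - \<beta>)) (at s)"
      by (simp add: has_real_derivative_iff_has_vector_derivative)
  qed
  then show ?thesis by simp
qed

lemma set_integrable_abel:
  fixes a \<tau> \<beta> :: real
  assumes "0 < \<beta>" "a \<le> \<tau>"
  shows "set_integrable lebesgue {a..\<tau>} (\<lambda>s. 1 / (\<tau> - s) powr (1 - \<beta>))"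
    "(LINT s:{a..\<tau>}|lebesgue. 1 / (\<tau> - s) powr (1 - \<beta>)) = (\<tau> - a) powr \<beta> / \<beta>"
proof -
  show 1: "set_integrable lebesgue {a..\<tau>} (\<lambda>s. 1 / (\<tau> - s) powr (1 - \<beta>))"
    using has_integral_abel[OF assms]
    by (intro nonnegative_absolutely_integrable_1) (auto simp: integrable_on_def)
  show "(LINT s:{a..\<tau>}|lebesgue. 1 / (\<tau> - s) powr (1 - \<beta>)) = (\<tau> - a) powr \<beta> / \<beta>"
    using set_lebesgue_integral_eq_integral(2)[OF 1] has_integral_abel[OF assms] by (simp add: integral_unique)
qed

lemma abel_kernel_eq: "abel_kernel \<beta> \<tau> s = indicator {0..\<tau>} s *\<^sub>R (1 / (\<tau> - s) powr (1 - \<beta>))"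
  by (auto simp: abel_kernel_def)

lemma abel_kernel_integral:
  assumes "0 < \<beta>" "0 \<le> \<tau>"
  shows "integrable lebesgue (abel_kernel \<beta> \<tau>)"
    "integral\<^sup>L lebesgue (abel_kernel \<beta> \<tau>) = \<tau> powr \<beta> / \<beta>"
  using set_integrable_abel[OF assms] unfolding set_integrable_def set_lebesgue_integral_def
  by (simp_all add: abel_kernel_eq[abs_def])

section \<open>Linearity, dependence on the past, and monotonicity of the fractional
  integral\<close>

lemma frac_int_eq:
  "frac_int \<beta> \<psi> \<tau> = (1 / Gamma \<beta>) *\<^sub>R (\<integral>s. abel_kernel \<beta> \<tau> s *\<^sub>R \<psi> s \<partial>lebesgue)"
  unfolding frac_int_def set_lebesgue_integral_def abel_kernel_eq by simp

lemma abel_kernel_scaleR_measurable: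
  fixes \<psi> :: "real \<Rightarrow> 'a::euclidean_space"
  assumes "\<psi> \<in> borel_measurable (lebesgue_on {0..t})" "\<tau> \<le> t"
  shows "(\<lambda>s. abel_kernel \<beta> \<tau> s *\<^sub>R \<psi> s) \<in> borel_measurable lebesgue"
proof -
  have "(\<lambda>s. indicator {0..t} s *\<^sub>R \<psi> s) \<in> borel_measurable lebesgue"
    using assms(1) by (subst borel_measurable_restrict_space_iff[symmetric]) auto
  moreover have "abel_kernel \<beta> \<tau> \<in> borel_measurable lebesgue"
    by (intro measurable_completion) simp
  ultimately have "(\<lambda>s. abel_kernel \<beta> \<tau> s *\<^sub>R (indicator {0..t} s *\<^sub>R \<psi> s)) \<in> borel_measurable lebesgue"
    by (rule borel_measurable_scaleR[rotated])
  also have "(\<lambda>s. abel_kernel \<beta> \<tau> s *\<^sub>R (indicator {0..t} s *\<^sub>R \<psi> s)) = (\<lambda>s. abel_kernel \<beta> \<tau> s *\<^sub>R \<psi> s)"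
    using assms by (auto simp: abel_kernel_def indicator_def)
  finally show ?thesis .
qed

lemma abel_kernel_integrable:
  assumes "bounded_measurable t \<psi>" "0 < \<beta>" "\<tau> \<le> t"
  shows "integrable lebesgue (\<lambda>s. abel_kernel \<beta> \<tau> s *\<^sub>R \<psi> s)"
proof (cases "0 \<le> \<tau>")
  case True
  obtain C where C: "\<And>s. s \<in> {0..t} \<Longrightarrow> norm (\<psi> s) \<le> C" "C > 0" using bounded_measurable_bound[OF assms(1)] by blast
  note m = abel_kernel_scaleR_measurable[OF bounded_measurable_measurable[OF assms(1)] assms(3)]
  show ?thesis
    by (rule Bochner_Integration.integrable_bound[OF integrable_mult_left[OF abel_kernel_integral(1)[OF assms(2) True], of C] m])
       (use assms C in \<open>auto intro!: AE_I2 mult_mono' divide_right_mono simp: abel_kernel_def\<close>)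
next
  case False
  then have "(\<lambda>s. abel_kernel \<beta> \<tau> s *\<^sub>R \<psi> s) = (\<lambda>s. 0)" by (auto simp: abel_kernel_def)
  then show ?thesis by simp
qed

lemma frac_int_diff:
  assumes "bounded_measurable t \<psi>" "bounded_measurable t \<phi>" "0 < \<beta>" "\<tau> \<le> t"
  shows "frac_int \<beta> (\<lambda>s. \<psi> s - \<phi> s) \<tau> = frac_int \<beta> \<psi> \<tau> - frac_int \<beta> \<phi> \<tau>"
  using abel_kernel_integrable[OF assms(1,3,4)] abel_kernel_integrable[OF assms(2,3,4)]
  by (simp add: frac_int_eq scaleR_diff_right)

lemma frac_int_add:
  assumes "bounded_measurable t \<psi>" "bounded_measurable t \<phi>" "0 < \<beta>" "\<tau> \<le> t"
  shows "frac_int \<beta> (\<lambda>s. \<psi> s + \<phi> s) \<tau> = frac_int \<beta> \<psi> \<tau> + frac_int \<beta> \<phi> \<tau>"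
  using abel_kernel_integrable[OF assms(1,3,4)] abel_kernel_integrable[OF assms(2,3,4)]
  by (simp add: frac_int_eq scaleR_add_right)

lemma frac_int_mult: "frac_int \<beta> (\<lambda>s. c * \<psi> s) \<tau> = c * frac_int \<beta> \<psi> \<tau>" for \<psi> :: "real \<Rightarrow> real"
  by (simp add: frac_int_eq mult.left_commute)

lemma frac_int_const:
  assumes "0 < \<beta>" "0 \<le> \<tau>"
  shows "frac_int \<beta> (\<lambda>_. c::real) \<tau> = c * (\<tau> powr \<beta> / (\<beta> * Gamma \<beta>))"
  using abel_kernel_integral[OF assms] by (simp add: frac_int_eq mult_ac)

lemma frac_int_cong:
  assumes "\<And>s. s \<in> {0..<\<tau>} \<Longrightarrow> \<psi> s = \<phi> s"
  shows "frac_int \<beta> \<psi> \<tau> = frac_int \<beta> \<phi> \<tau>"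
proof -
  have "(\<lambda>s. abel_kernel \<beta> \<tau> s *\<^sub>R \<psi> s) = (\<lambda>s. abel_kernel \<beta> \<tau> s *\<^sub>R \<phi> s)"
  proof
    fix s show "abel_kernel \<beta> \<tau> s *\<^sub>R \<psi> s = abel_kernel \<beta> \<tau> s *\<^sub>R \<phi> s"
      using assms[of s] by (cases "s = \<tau>") (auto simp: abel_kernel_def)
  qed
  then show ?thesis by (simp add: frac_int_eq)
qed

lemma frac_int_cong_AE:
  assumes "\<psi> \<in> borel_measurable (lebesgue_on {0..t})" "\<phi> \<in> borel_measurable (lebesgue_on {0..t})" "\<tau> \<le> t"
    and "AE s in lebesgue. s \<in> {0..\<tau>} \<longrightarrow> \<psi> s = \<phi> s"
  shows "frac_int \<beta> \<psi> \<tau> = frac_int \<beta> \<phi> \<tau>"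
proof -
  have "AE s in lebesgue. abel_kernel \<beta> \<tau> s *\<^sub>R \<psi> s = abel_kernel \<beta> \<tau> s *\<^sub>R \<phi> s"
    using assms(4) by eventually_elim (auto simp: abel_kernel_def)
  then show ?thesis
    unfolding frac_int_eq
    using integral_cong_AE[OF abel_kernel_scaleR_measurable[OF assms(1,3)] abel_kernel_scaleR_measurable[OF assms(2,3)]]
    by simp
qed

lemma frac_int_mono:
  fixes \<psi> \<phi> :: "real \<Rightarrow> real"
  assumes "bounded_measurable t \<psi>" "bounded_measurable t \<phi>" "0 < \<beta>" "\<tau> \<le> t"
    and "AE s in lebesgue. s \<in> {0..\<tau>} \<longrightarrow> \<psi> s \<le> \<phi> s"
  shows "frac_int \<beta> \<psi> \<tau> \<le> frac_int \<beta> \<phi> \<tau>"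
proof -
  have "AE s in lebesgue. abel_kernel \<beta> \<tau> s *\<^sub>R \<psi> s \<le> abel_kernel \<beta> \<tau> s *\<^sub>R \<phi> s"
    using assms(5) by eventually_elim (auto simp: abel_kernel_def intro!: divide_right_mono)
  then have "(\<integral>s. abel_kernel \<beta> \<tau> s *\<^sub>R \<psi> s \<partial>lebesgue) \<le> (\<integral>s. abel_kernel \<beta> \<tau> s *\<^sub>R \<phi> s \<partial>lebesgue)"
    by (intro integral_mono_AE abel_kernel_integrable[OF assms(1,3,4)] abel_kernel_integrable[OF assms(2,3,4)])
  then show ?thesis using assms(3) Gamma_real_pos[of \<beta>]
    by (auto simp: frac_int_eq intro!: divide_right_mono)
qed

lemma norm_frac_int_le:
  assumes "0 < \<beta>"
  shows "norm (frac_int \<beta> \<psi> \<tau>) \<le> frac_int \<beta> (\<lambda>s. norm (\<psi> s)) \<tau>"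
proof -
  have "norm (\<integral>s. abel_kernel \<beta> \<tau> s *\<^sub>R \<psi> s \<partial>lebesgue) \<le> (\<integral>s. norm (abel_kernel \<beta> \<tau> s *\<^sub>R \<psi> s) \<partial>lebesgue)"
    by (rule integral_norm_bound)
  then show ?thesis using assms Gamma_real_pos[of \<beta>]
    by (auto simp: frac_int_eq intro!: divide_right_mono)
qed

lemma frac_int_0 [simp]: "frac_int \<beta> \<psi> 0 = 0"
proof -
  have "(\<lambda>s. abel_kernel \<beta> 0 s *\<^sub>R \<psi> s) = (\<lambda>s. 0)" by (auto simp: abel_kernel_def)
  then show ?thesis by (simp add: frac_int_eq)
qed

text \<open>For \<open>s < a\<close> the kernel decreases as its upper time moves from
  \<open>a\<close> to \<open>b\<close>, and beyond \<open>a\<close> only the kernel of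
  \<open>b\<close> remains. All integrals are explicit, and
  \<open>a powr \<beta> - b powr \<beta>\<close> has a favourable sign, which leaves a multiple of
  \<open>(b - a) powr \<beta>\<close>.\<close>

lemma frac_int_holder:
  assumes \<psi>: "bounded_measurable t \<psi>" "\<And>s. s \<in> {0..t} \<Longrightarrow> norm (\<psi> s) \<le> C" and \<beta>: "0 < \<beta>" "\<beta> < 1"
    and "0 \<le> a" "a \<le> b" "b \<le> t"
  shows "norm (frac_int \<beta> \<psi> b - frac_int \<beta> \<psi> a) \<le> C * (2 / (\<beta> * Gamma \<beta>)) * (b - a) powr \<beta>"
proof -
  let ?k = "abel_kernel \<beta>" and ?I = "\<lambda>s. indicator {a..b} s *\<^sub>R (1 / (b - s) powr (1 - \<beta>))"
  have C: "C \<ge> 0" using order_trans[OF norm_ge_zero \<psi>(2)[of a]] assms by auto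
  have G: "Gamma \<beta> > 0" using \<beta> by (simp add: Gamma_real_pos)
  have ik: "integrable lebesgue (?k a)" "integrable lebesgue (?k b)" "integrable lebesgue ?I"
    using abel_kernel_integral(1)[of \<beta>] set_integrable_abel(1)[of \<beta> a b] assms
    unfolding set_integrable_def by auto
  \<comment> \<open>One majorant for both regions: before \<open>a\<close> the term
    \<open>?I\<close> vanishes; between \<open>a\<close> and \<open>b\<close> the bound reads
    \<open>- ?I + 2 * ?I\<close>, which is the origin of the factor 2.\<close>
  have le: "AE s in lebesgue. norm ((?k b s - ?k a s) *\<^sub>R \<psi> s) \<le> C * (?k a s - ?k b s + 2 * ?I s)"
  proof -
    have "AE s in lebesgue. s \<noteq> a"
      using AE_completion[OF AE_lborel_singleton[of a]] by simp
    then show ?thesis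
    proof eventually_elim
      case (elim s)
      have "\<bar>?k b s - ?k a s\<bar> \<le> ?k a s - ?k b s + 2 * ?I s \<and> (?k b s - ?k a s = 0 \<or> s \<in> {0..t})"
      proof (cases "0 \<le> s \<and> s < a")
        case True
        then have "1 / (b - s) powr (1 - \<beta>) \<le> 1 / (a - s) powr (1 - \<beta>)"
          using assms by (intro divide_left_mono powr_mono2) auto
        moreover have "?k a s = 1 / (a - s) powr (1 - \<beta>)" "?k b s = 1 / (b - s) powr (1 - \<beta>)" "?I s = 0"
          using True assms by (simp_all add: abel_kernel_def)
        ultimately show ?thesis using True assms by simp
      next
        case False
        then have "s < 0 \<or> s > b \<or> a < s \<and> s \<le> b" using elim by linarith
        then show ?thesis using assms
          by (elim disjE) (simp_all add: abel_kernel_def indicator_def)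
      qed
      then have "\<bar>?k b s - ?k a s\<bar> * norm (\<psi> s) \<le> (?k a s - ?k b s + 2 * ?I s) * C"
        using \<psi>(2)[of s] C by (cases "?k b s - ?k a s = 0") (auto intro!: mult_mono)
      then show ?case by (simp add: mult.commute)
    qed
  qed
  have "frac_int \<beta> \<psi> b - frac_int \<beta> \<psi> a = (1 / Gamma \<beta>) *\<^sub>R (\<integral>s. (?k b s - ?k a s) *\<^sub>R \<psi> s \<partial>lebesgue)"
    using abel_kernel_integrable[OF \<psi>(1) \<beta>(1), of a] abel_kernel_integrable[OF \<psi>(1) \<beta>(1), of b] assms
    by (simp add: frac_int_eq scaleR_diff_left scaleR_diff_right)
  also have "norm \<dots> \<le> (1 / Gamma \<beta>) * (\<integral>s. norm ((?k b s - ?k a s) *\<^sub>R \<psi> s) \<partial>lebesgue)"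
    using G integral_norm_bound[of lebesgue "\<lambda>s. (?k b s - ?k a s) *\<^sub>R \<psi> s"] by (auto intro!: divide_right_mono)
  also have "\<dots> \<le> (1 / Gamma \<beta>) * (\<integral>s. C * (?k a s - ?k b s + 2 * ?I s) \<partial>lebesgue)"
  proof -
    have i1: "integrable lebesgue (\<lambda>s. (?k b s - ?k a s) *\<^sub>R \<psi> s)"
      using abel_kernel_integrable[OF \<psi>(1) \<beta>(1), of a] abel_kernel_integrable[OF \<psi>(1) \<beta>(1), of b] assms
      by (simp add: scaleR_diff_left)
    have i2: "integrable lebesgue (\<lambda>s. C * (?k a s - ?k b s + 2 * ?I s))"
      using ik by (intro integrable_mult_right Bochner_Integration.integrable_add Bochner_Integration.integrable_diff)
    show ?thesis
      by (intro mult_left_mono integral_mono_AE integrable_norm i1 i2 le) (use G in auto)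
  qed
  also have "(\<integral>s. C * (?k a s - ?k b s + 2 * ?I s) \<partial>lebesgue)
      = C * ((\<integral>s. ?k a s \<partial>lebesgue) - (\<integral>s. ?k b s \<partial>lebesgue) + 2 * (\<integral>s. ?I s \<partial>lebesgue))"
  proof -
    have "(\<integral>s. C * (p s - q s + 2 * r s) \<partial>lebesgue)
        = C * (integral\<^sup>L lebesgue p - integral\<^sup>L lebesgue q + 2 * integral\<^sup>L lebesgue r)"
      if "integrable lebesgue p" "integrable lebesgue q" "integrable lebesgue r" for p q r :: "real \<Rightarrow> real"
      using that by simp
    from this[OF ik] show ?thesis .
  qed
  also have "\<dots> = C * (a powr \<beta> / \<beta> - b powr \<beta> / \<beta> + 2 * ((b - a) powr \<beta> / \<beta>))"
    using abel_kernel_integral(2)[of \<beta>] set_integrable_abel(2)[of \<beta> a b] assms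
    unfolding set_lebesgue_integral_def by simp
  also have "\<dots> \<le> C * (2 * ((b - a) powr \<beta> / \<beta>))"
    using C assms powr_mono2[of \<beta> a b] by (intro mult_left_mono) (auto intro!: divide_right_mono)
  finally show ?thesis using G by (simp add: field_simps mult_left_mono)
qed

lemma frac_int_continuous:
  assumes "bounded_measurable t \<psi>" "0 < \<beta>" "\<beta> < 1"
  shows "continuous_on {0..t} (frac_int \<beta> \<psi>)"
proof -
  obtain C where C: "\<And>s. s \<in> {0..t} \<Longrightarrow> norm (\<psi> s) \<le> C" using bounded_measurable_bound[OF assms(1)] by blast
  let ?K = "C * (2 / (\<beta> * Gamma \<beta>))"
  have "norm (frac_int \<beta> \<psi> y - frac_int \<beta> \<psi> x) \<le> ?K * \<bar>y - x\<bar> powr \<beta>"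
    if "x \<in> {0..t}" "y \<in> {0..t}" for x y
  proof (cases "x \<le> y")
    case True
    then show ?thesis using frac_int_holder[OF assms(1) C assms(2,3), of x y] that by simp
  next
    case False
    then show ?thesis using frac_int_holder[OF assms(1) C assms(2,3), of y x] that
      by (simp add: norm_minus_commute[of "frac_int \<beta> \<psi> y"])
  qed
  note H = this
  show ?thesis unfolding continuous_on_def
  proof
    fix x assume x: "x \<in> {0..t}"
    have "((\<lambda>y. \<bar>y - x\<bar>) \<longlongrightarrow> 0) (at x within {0..t})"
      by (rule tendsto_rabs_zero[OF LIM_zero[OF tendsto_ident_at]])
    from tendsto_powr'[OF this tendsto_const[of \<beta>]]
    have "((\<lambda>y. \<bar>y - x\<bar> powr \<beta>) \<longlongrightarrow> 0) (at x within {0..t})"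
      using assms by simp
    then have lim: "((\<lambda>y. ?K * \<bar>y - x\<bar> powr \<beta>) \<longlongrightarrow> 0) (at x within {0..t})"
      by (rule tendsto_mult_right_zero)
    have "\<forall>\<^sub>F y in at x within {0..t}. norm (frac_int \<beta> \<psi> y - frac_int \<beta> \<psi> x) \<le> ?K * \<bar>y - x\<bar> powr \<beta>"
      using H[OF x] unfolding eventually_at_filter by (intro always_eventually) blast
    then have "((\<lambda>y. frac_int \<beta> \<psi> y - frac_int \<beta> \<psi> x) \<longlongrightarrow> 0) (at x within {0..t})"
      by (rule Lim_null_comparison[OF _ lim])
    then show "(frac_int \<beta> \<psi> \<longlongrightarrow> frac_int \<beta> \<psi> x) (at x within {0..t})"
      by (rule LIM_zero_cancel)
  qed
qed

text \<open>The estimate \<open>exp (- y) \<le> y powr (- \<alpha> / 2)\<close> with \<open>y = l * (\<tau> - s)\<close> bounds the product of the kernel and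
  \<open>exp (l * s)\<close> by \<open>l powr (- \<alpha> / 2) * exp (l * \<tau>)\<close> times the kernel of order \<open>\<alpha> / 2\<close>.\<close>

lemma frac_int_exp_small:
  fixes \<alpha> T e :: real
  assumes "0 < \<alpha>" "\<alpha> < 1" "0 \<le> T" "0 < e"
  shows "\<exists>l>0. \<forall>\<tau>\<in>{0..T}. frac_int \<alpha> (\<lambda>s. exp (l * s)) \<tau> \<le> e * exp (l * \<tau>)"
proof -
  have G: "Gamma \<alpha> > 0" using assms by (simp add: Gamma_real_pos)
  \<comment> \<open>\<open>K\<close> is the mass up to time \<open>T\<close> of the kernel of order
    \<open>\<alpha> / 2\<close>, divided by \<open>Gamma \<alpha>\<close>; \<open>l\<close> is
    solved from \<open>l powr (- (\<alpha>/2)) = e / (K + 1)\<close>. The summand 1 covers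
    \<open>T = 0\<close>, where \<open>K\<close> vanishes.\<close>
  define K where "K = T powr (\<alpha>/2) * (2 / (\<alpha> * Gamma \<alpha>))"
  have K: "K \<ge> 0" using assms G by (simp add: K_def)
  define l where "l = (e / (K + 1)) powr (- 2 / \<alpha>)"
  have l: "l > 0" using assms K by (simp add: l_def)
  have le: "l powr (- (\<alpha>/2)) = e / (K + 1)"
    using assms K by (simp add: l_def powr_powr)
  have kernel: "abel_kernel \<alpha> \<tau> s * exp (l * s) \<le> exp (l * \<tau>) * (e / (K + 1)) * abel_kernel (\<alpha>/2) \<tau> s" for \<tau> s
  proof (cases "0 \<le> s \<and> s < \<tau>")
    case True
    define y where "y = l * (\<tau> - s)"
    have y: "y > 0" using True l by (simp add: y_def)
    have "(\<alpha>/2) * ln y \<le> y"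
    proof (cases "ln y \<le> 0")
      case True
      then have "(\<alpha>/2) * ln y \<le> 0" using assms by (simp add: mult_nonneg_nonpos)
      then show ?thesis using y by simp
    next
      case False
      then have "(\<alpha>/2) * ln y \<le> 1 * ln y" using assms by (intro mult_right_mono) auto
      then show ?thesis using ln_le_minus_one[OF y] by simp
    qed
    then have "exp (- y) \<le> y powr (- (\<alpha>/2))"
      using y by (simp add: powr_def)
    also have "y powr (- (\<alpha>/2)) = (e / (K + 1)) * (\<tau> - s) powr (- (\<alpha>/2))"
      using True l le by (simp add: y_def powr_mult)
    finally have ye: "exp (- y) \<le> (e / (K + 1)) * (\<tau> - s) powr (- (\<alpha>/2))" .
    have "exp (l * s) = exp (l * \<tau>) * exp (- y)"
      by (simp add: y_def algebra_simps flip: exp_add)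
    then have "(\<tau> - s) powr (\<alpha> - 1) * exp (l * s) = exp (l * \<tau>) * exp (- y) * (\<tau> - s) powr (\<alpha> - 1)"
      by (simp add: mult_ac)
    also have "\<dots> \<le> exp (l * \<tau>) * ((e / (K + 1)) * (\<tau> - s) powr (- (\<alpha>/2))) * (\<tau> - s) powr (\<alpha> - 1)"
      by (intro mult_right_mono mult_left_mono ye) auto
    also have "\<dots> = exp (l * \<tau>) * (e / (K + 1)) * ((\<tau> - s) powr (- (\<alpha>/2)) * (\<tau> - s) powr (\<alpha> - 1))"
      by simp
    also have "(\<tau> - s) powr (- (\<alpha>/2)) * (\<tau> - s) powr (\<alpha> - 1) = (\<tau> - s) powr (\<alpha>/2 - 1)"
      by (simp add: field_simps flip: powr_add)
    finally have "(\<tau> - s) powr (\<alpha> - 1) * exp (l * s) \<le> exp (l * \<tau>) * (e / (K + 1)) * (\<tau> - s) powr (\<alpha>/2 - 1)" .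
    moreover have "abel_kernel \<beta> \<tau> s = (\<tau> - s) powr (\<beta> - 1)" for \<beta>
      using True powr_minus_divide[of "\<tau> - s" "1 - \<beta>"] by (simp add: abel_kernel_def)
    ultimately show ?thesis by simp
  next
    case False
    then have "s < 0 \<or> s = \<tau> \<or> s > \<tau>" by linarith
    then show ?thesis by (auto simp: abel_kernel_def)
  qed
  have "frac_int \<alpha> (\<lambda>s. exp (l * s)) \<tau> \<le> e * exp (l * \<tau>)" if \<tau>: "\<tau> \<in> {0..T}" for \<tau>
  proof -
    have a2: "0 < \<alpha>/2" "0 \<le> \<tau>" using assms \<tau> by auto
    have "bounded_measurable \<tau> (\<lambda>s. exp (l * s))"
      by (intro bounded_measurable_continuous continuous_intros)
    from abel_kernel_integrable[OF this assms(1) order_refl]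
    have "integrable lebesgue (\<lambda>s. abel_kernel \<alpha> \<tau> s * exp (l * s))" by simp
    moreover have "integrable lebesgue (\<lambda>s. exp (l * \<tau>) * (e / (K + 1)) * abel_kernel (\<alpha>/2) \<tau> s)"
      using abel_kernel_integral(1)[OF a2] by (intro integrable_mult_right)
    ultimately have "(\<integral>s. abel_kernel \<alpha> \<tau> s * exp (l * s) \<partial>lebesgue)
        \<le> (\<integral>s. exp (l * \<tau>) * (e / (K + 1)) * abel_kernel (\<alpha>/2) \<tau> s \<partial>lebesgue)"
      using kernel by (rule integral_mono)
    also have "\<dots> = exp (l * \<tau>) * (e / (K + 1)) * (\<tau> powr (\<alpha>/2) / (\<alpha>/2))"
      using abel_kernel_integral(2)[OF a2] by simp
    also have "\<dots> \<le> exp (l * \<tau>) * (e / (K + 1)) * (T powr (\<alpha>/2) / (\<alpha>/2))"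
      using assms \<tau> K by (intro mult_left_mono divide_right_mono powr_mono2) auto
    finally have "(1 / Gamma \<alpha>) * (\<integral>s. abel_kernel \<alpha> \<tau> s * exp (l * s) \<partial>lebesgue)
        \<le> (1 / Gamma \<alpha>) * (exp (l * \<tau>) * (e / (K + 1)) * (T powr (\<alpha>/2) / (\<alpha>/2)))"
      using G by (intro mult_left_mono) auto
    also have "\<dots> = exp (l * \<tau>) * e * (K / (K + 1))"
      using assms G by (simp add: K_def field_simps)
    also have "\<dots> \<le> exp (l * \<tau>) * e * 1"
      using K assms by (intro mult_left_mono) auto
    finally show ?thesis by (simp add: frac_int_eq mult.commute)
  qed
  then show ?thesis using l by blast
qed

text \<open>Substituting \<open>\<xi> = s + d * t\<close> with \<open>d = \<tau> - s\<close> gives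
  the Beta integral with parameters \<open>\<alpha>\<close> and \<open>1 - \<alpha>\<close>, and all
  powers of \<open>d\<close> cancel. For \<open>s = \<tau>\<close> the product of kernels vanishes
  identically, hence the strict bound on \<open>s\<close>.\<close>

lemma abel_kernel_convolution:
  fixes \<alpha> s \<tau> :: real
  assumes "0 < \<alpha>" "\<alpha> < 1"
  shows "integrable lebesgue (\<lambda>\<xi>. abel_kernel (1 - \<alpha>) \<tau> \<xi> * abel_kernel \<alpha> \<xi> s)" (is ?int)
    and "(\<integral>\<xi>. abel_kernel (1 - \<alpha>) \<tau> \<xi> * abel_kernel \<alpha> \<xi> s \<partial>lebesgue)
    = (if 0 \<le> s \<and> s < \<tau> then Gamma \<alpha> * Gamma (1 - \<alpha>) else 0)" (is ?eq)
proof -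
  have "?int \<and> ?eq"
  proof (cases "0 \<le> s \<and> s < \<tau>")
    case True
    define d where "d = \<tau> - s"
    let ?B = "\<lambda>t::real. t powr (\<alpha> - 1) * (1 - t) powr ((1 - \<alpha>) - 1)"
    have d: "d > 0" and \<tau>d: "\<tau> = s + d" using True by (simp_all add: d_def)
    have B: "(?B has_integral Beta \<alpha> (1 - \<alpha>)) (cbox 0 1)"
      using has_integral_Beta_real[of \<alpha> "1 - \<alpha>"] assms by simp
    have "(0 - - s/d) /\<^sub>R (1/d) = s" "(1 - - s/d) /\<^sub>R (1/d) = \<tau>"
      using d by (simp_all add: \<tau>d field_simps)
    then have "((\<lambda>\<xi>. ?B ((1/d) *\<^sub>R \<xi> + - s/d)) has_integral (d * Beta \<alpha> (1 - \<alpha>))) {s..\<tau>}"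
      using has_integral_affinity'[OF B, of "1/d" "- s/d"] d by simp
    then have "((\<lambda>\<xi>. (1/d) * ?B ((1/d) *\<^sub>R \<xi> + - s/d)) has_integral ((1/d) * (d * Beta \<alpha> (1 - \<alpha>)))) {s..\<tau>}"
      by (rule has_integral_mult_right)
    moreover have "(1/d) * ?B ((1/d) *\<^sub>R \<xi> + - s/d) = abel_kernel (1 - \<alpha>) \<tau> \<xi> * abel_kernel \<alpha> \<xi> s"
      if "\<xi> \<in> {s..\<tau>}" for \<xi>
    proof -
      have 1: "(1/d) *\<^sub>R \<xi> + - s/d = (\<xi> - s) / d" "1 - (\<xi> - s) / d = (\<tau> - \<xi>) / d"
        using d by (simp_all add: \<tau>d field_simps)
      have "?B ((1/d) *\<^sub>R \<xi> + - s/d) = ((\<xi> - s) / d) powr (\<alpha> - 1) * ((\<tau> - \<xi>) / d) powr (- \<alpha>)"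
        unfolding 1 by simp
      also have "\<dots> = ((\<xi> - s) powr (\<alpha> - 1) * (\<tau> - \<xi>) powr (- \<alpha>)) / (d powr (\<alpha> - 1) * d powr (- \<alpha>))"
        using that d by (simp add: powr_divide)
      also have "d powr (\<alpha> - 1) * d powr (- \<alpha>) = d powr (- 1)"
        by (simp flip: powr_add)
      also have "d powr (- 1) = 1 / d"
        using d by (simp add: powr_minus_divide)
      finally have "(1/d) * ?B ((1/d) *\<^sub>R \<xi> + - s/d) = (\<xi> - s) powr (\<alpha> - 1) * (\<tau> - \<xi>) powr (- \<alpha>)"
        using d by simp
      also have "\<dots> = abel_kernel (1 - \<alpha>) \<tau> \<xi> * abel_kernel \<alpha> \<xi> s"
        using that True powr_minus_divide[of "\<xi> - s" "1 - \<alpha>"] powr_minus_divide[of "\<tau> - \<xi>" \<alpha>]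
        by (simp add: abel_kernel_def)
      finally show ?thesis .
    qed
    ultimately have "((\<lambda>\<xi>. abel_kernel (1 - \<alpha>) \<tau> \<xi> * abel_kernel \<alpha> \<xi> s) has_integral ((1/d) * (d * Beta \<alpha> (1 - \<alpha>)))) {s..\<tau>}"
      by (rule has_integral_eq[rotated])
    then have hi: "((\<lambda>\<xi>. abel_kernel (1 - \<alpha>) \<tau> \<xi> * abel_kernel \<alpha> \<xi> s) has_integral Beta \<alpha> (1 - \<alpha>)) {s..\<tau>}"
      using d by simp
    then have si: "set_integrable lebesgue {s..\<tau>} (\<lambda>\<xi>. abel_kernel (1 - \<alpha>) \<tau> \<xi> * abel_kernel \<alpha> \<xi> s)"
      by (intro nonnegative_absolutely_integrable_1) (auto simp: integrable_on_def)
    from set_lebesgue_integral_eq_integral(2)[OF si]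
    have "(LINT \<xi>:{s..\<tau>}|lebesgue. abel_kernel (1 - \<alpha>) \<tau> \<xi> * abel_kernel \<alpha> \<xi> s) = Beta \<alpha> (1 - \<alpha>)"
      using hi by (simp add: integral_unique)
    moreover have "(\<lambda>\<xi>. indicator {s..\<tau>} \<xi> *\<^sub>R (abel_kernel (1 - \<alpha>) \<tau> \<xi> * abel_kernel \<alpha> \<xi> s))
        = (\<lambda>\<xi>. abel_kernel (1 - \<alpha>) \<tau> \<xi> * abel_kernel \<alpha> \<xi> s)"
      by (auto simp: abel_kernel_def indicator_def)
    ultimately show ?thesis using True si
      by (simp add: set_lebesgue_integral_def set_integrable_def Beta_def)
  next
    case False
    then have "(\<lambda>\<xi>. abel_kernel (1 - \<alpha>) \<tau> \<xi> * abel_kernel \<alpha> \<xi> s) = (\<lambda>_. 0)"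
      by (auto simp: abel_kernel_def)
    then show ?thesis using False by auto
  qed
  then show ?int ?eq by auto
qed

lemma frac_int_semigroup:
  assumes \<psi>: "bounded_measurable t \<psi>" and \<alpha>: "0 < \<alpha>" "\<alpha> < 1" and \<tau>: "0 \<le> \<tau>" "\<tau> \<le> t"
  shows "frac_int (1 - \<alpha>) (frac_int \<alpha> \<psi>) \<tau> = integral {0..\<tau>} \<psi>"
proof -
  obtain \<phi> C where [measurable]: "\<phi> \<in> borel_measurable borel" and C: "\<And>s. norm (\<phi> s) \<le> C"
    and ae: "AE s in lebesgue. s \<in> {0..t} \<longrightarrow> \<phi> s = \<psi> s"
    using bounded_measurable_borel_version[OF \<psi>] by metis
  have C0: "C \<ge> 0" using order_trans[OF norm_ge_zero C] .
  have \<phi>m: "\<phi> \<in> borel_measurable (lebesgue_on {0..s})" for s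
    by (intro measurable_restrict_space1 measurable_completion) simp
  then have meas\<phi>: "bounded_measurable s \<phi>" for s using C by (intro bounded_measurableI)
  have G: "Gamma \<alpha> > 0" "Gamma (1 - \<alpha>) > 0" using \<alpha> by (simp_all add: Gamma_real_pos)
  define k where "k = (\<lambda>\<xi> s. abel_kernel (1 - \<alpha>) \<tau> \<xi> * abel_kernel \<alpha> \<xi> s)"
  define F where "F = (\<lambda>\<xi> s. k \<xi> s *\<^sub>R \<phi> s)"
  have [measurable]: "(\<lambda>(x, y). abel_kernel \<alpha> x y) \<in> borel_measurable (lborel \<Otimes>\<^sub>M lborel)"
    unfolding abel_kernel_def by measurable
  have [measurable]: "case_prod F \<in> borel_measurable (lborel \<Otimes>\<^sub>M lborel)"
    unfolding F_def k_def by measurable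
  \<comment> \<open>Changing the density on a null set leaves the inner fractional integral
    unchanged at every single \<open>\<xi>\<close>, not merely at almost all of them.\<close>
  have "frac_int (1 - \<alpha>) (frac_int \<alpha> \<psi>) \<tau> = frac_int (1 - \<alpha>) (frac_int \<alpha> \<phi>) \<tau>"
  proof (rule frac_int_cong)
    fix \<xi> assume \<xi>: "\<xi> \<in> {0..<\<tau>}"
    show "frac_int \<alpha> \<psi> \<xi> = frac_int \<alpha> \<phi> \<xi>"
      using ae \<xi> \<tau> by (intro frac_int_cong_AE[OF bounded_measurable_measurable[OF \<psi>] \<phi>m]) auto
  qed
  also have "\<dots> = (1 / (Gamma (1 - \<alpha>) * Gamma \<alpha>)) *\<^sub>R (\<integral>\<xi>. (\<integral>s. F \<xi> s \<partial>lborel) \<partial>lborel)"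
  proof -
    have "(\<integral>s. abel_kernel \<alpha> \<xi> s *\<^sub>R \<phi> s \<partial>lebesgue) = (\<integral>s. abel_kernel \<alpha> \<xi> s *\<^sub>R \<phi> s \<partial>lborel)" for \<xi>
      by (rule integral_completion) simp
    then have "(\<lambda>\<xi>. abel_kernel (1 - \<alpha>) \<tau> \<xi> *\<^sub>R frac_int \<alpha> \<phi> \<xi>)
        = (\<lambda>\<xi>. (1 / Gamma \<alpha>) *\<^sub>R (abel_kernel (1 - \<alpha>) \<tau> \<xi> *\<^sub>R (\<integral>s. abel_kernel \<alpha> \<xi> s *\<^sub>R \<phi> s \<partial>lborel)))"
      by (simp add: frac_int_eq fun_eq_iff)
    then have "frac_int (1 - \<alpha>) (frac_int \<alpha> \<phi>) \<tau> = (1 / (Gamma (1 - \<alpha>) * Gamma \<alpha>)) *\<^sub>R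
       (\<integral>\<xi>. abel_kernel (1 - \<alpha>) \<tau> \<xi> *\<^sub>R (\<integral>s. abel_kernel \<alpha> \<xi> s *\<^sub>R \<phi> s \<partial>lborel) \<partial>lebesgue)"
      unfolding frac_int_eq[of "1 - \<alpha>"] by (simp only: integral_scaleR_right) simp
    also have "(\<integral>\<xi>. abel_kernel (1 - \<alpha>) \<tau> \<xi> *\<^sub>R (\<integral>s. abel_kernel \<alpha> \<xi> s *\<^sub>R \<phi> s \<partial>lborel) \<partial>lebesgue)
       = (\<integral>\<xi>. abel_kernel (1 - \<alpha>) \<tau> \<xi> *\<^sub>R (\<integral>s. abel_kernel \<alpha> \<xi> s *\<^sub>R \<phi> s \<partial>lborel) \<partial>lborel)"
      by (rule integral_completion) measurable
    also have "\<dots> = (\<integral>\<xi>. (\<integral>s. F \<xi> s \<partial>lborel) \<partial>lborel)"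
      by (simp add: F_def k_def flip: scaleR_scaleR)
    finally show ?thesis .
  qed
  also have "(\<integral>\<xi>. (\<integral>s. F \<xi> s \<partial>lborel) \<partial>lborel) = (\<integral>s. (\<integral>\<xi>. F \<xi> s \<partial>lborel) \<partial>lborel)"
  proof (rule lborel_pair.Fubini_integral[symmetric], rule lborel_pair.Fubini_integrable)
    have ik: "integrable lborel (\<lambda>s. abel_kernel \<alpha> \<xi> s *\<^sub>R \<phi> s)" for \<xi>
      using abel_kernel_integrable[OF meas\<phi> \<alpha>(1) order_refl, of \<xi>] by (subst (asm) integrable_completion) auto
    then show "AE \<xi> in lborel. integrable lborel (\<lambda>s. (case (\<xi>, s) of (\<xi>, s) \<Rightarrow> F \<xi> s))"
      by (auto simp: F_def k_def simp flip: scaleR_scaleR)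
    \<comment> \<open>Domination for Fubini: the inner kernel has mass at most
      \<open>\<tau> powr \<alpha> / \<alpha>\<close>, so the inner integral is at most a constant
      times the integrable outer kernel.\<close>
    have bound: "(\<integral>s. norm (F \<xi> s) \<partial>lborel) \<le> abel_kernel (1 - \<alpha>) \<tau> \<xi> * (C * (\<tau> powr \<alpha> / \<alpha>))" for \<xi>
    proof (cases "0 \<le> \<xi> \<and> \<xi> \<le> \<tau>")
      case True
      have i1: "integrable lborel (abel_kernel \<alpha> \<xi>)" "integral\<^sup>L lborel (abel_kernel \<alpha> \<xi>) = \<xi> powr \<alpha> / \<alpha>"
        using abel_kernel_integral[OF \<alpha>(1), of \<xi>] True
          integrable_completion[of "abel_kernel \<alpha> \<xi>" lborel] integral_completion[of "abel_kernel \<alpha> \<xi>" lborel] by auto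
      have eq: "(\<integral>s. norm (F \<xi> s) \<partial>lborel) = abel_kernel (1 - \<alpha>) \<tau> \<xi> * (\<integral>s. norm (abel_kernel \<alpha> \<xi> s *\<^sub>R \<phi> s) \<partial>lborel)"
        by (simp add: F_def k_def mult.assoc abs_mult)
      have "(\<integral>s. norm (abel_kernel \<alpha> \<xi> s *\<^sub>R \<phi> s) \<partial>lborel) \<le> (\<integral>s. abel_kernel \<alpha> \<xi> s * C \<partial>lborel)"
        using C by (intro integral_mono integrable_norm ik integrable_mult_left i1) (auto intro!: mult_left_mono)
      also have "\<dots> = C * (\<xi> powr \<alpha> / \<alpha>)" using i1 by simp
      also have "\<dots> \<le> C * (\<tau> powr \<alpha> / \<alpha>)"
        using C0 True \<alpha> by (intro mult_left_mono divide_right_mono powr_mono2) auto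
      finally show ?thesis unfolding eq by (rule mult_left_mono) simp
    next
      case False
      then show ?thesis by (auto simp: F_def k_def abel_kernel_def)
    qed
    have "integrable lborel (\<lambda>\<xi>. abel_kernel (1 - \<alpha>) \<tau> \<xi> * (C * (\<tau> powr \<alpha> / \<alpha>)))"
      using abel_kernel_integral(1)[of "1 - \<alpha>" \<tau>] \<alpha> \<tau>
        integrable_completion[of "abel_kernel (1 - \<alpha>) \<tau>" lborel] by (intro integrable_mult_left) auto
    then show "integrable lborel (\<lambda>\<xi>. \<integral>s. norm (case (\<xi>, s) of (\<xi>, s) \<Rightarrow> F \<xi> s) \<partial>lborel)"
    proof (rule Bochner_Integration.integrable_bound)
      show "(\<lambda>\<xi>. \<integral>s. norm (case (\<xi>, s) of (\<xi>, s) \<Rightarrow> F \<xi> s) \<partial>lborel) \<in> borel_measurable lborel"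
        by measurable
      show "AE \<xi> in lborel. norm (\<integral>s. norm (case (\<xi>, s) of (\<xi>, s) \<Rightarrow> F \<xi> s) \<partial>lborel)
          \<le> norm (abel_kernel (1 - \<alpha>) \<tau> \<xi> * (C * (\<tau> powr \<alpha> / \<alpha>)))"
        using bound C0 \<alpha> by (auto intro!: AE_I2 simp: abs_mult integral_nonneg)
    qed
  qed measurable
  also have "(\<integral>s. (\<integral>\<xi>. F \<xi> s \<partial>lborel) \<partial>lborel)
      = (\<integral>s. (Gamma (1 - \<alpha>) * Gamma \<alpha>) *\<^sub>R (indicator {0..<\<tau>} s *\<^sub>R \<phi> s) \<partial>lborel)"
  proof (rule Bochner_Integration.integral_cong[OF refl])
    fix s
    \<comment> \<open>In this order \<open>\<phi> s\<close> is a constant factor, and the remaining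
      kernel integral is the same for all \<open>s\<close> in \<open>{0..<\<tau>}\<close>.\<close>
    have "(\<integral>\<xi>. F \<xi> s \<partial>lborel) = (\<integral>\<xi>. k \<xi> s \<partial>lborel) *\<^sub>R \<phi> s"
    proof -
      have "integrable lborel (\<lambda>\<xi>. k \<xi> s)"
        using abel_kernel_convolution(1)[OF \<alpha>, of \<tau> s] unfolding k_def
        by (subst (asm) integrable_completion) auto
      then show ?thesis unfolding F_def by simp
    qed
    also have "(\<integral>\<xi>. k \<xi> s \<partial>lborel) = (\<integral>\<xi>. k \<xi> s \<partial>lebesgue)"
      unfolding k_def by (rule integral_completion[symmetric]) measurable
    also have "\<dots> = (if 0 \<le> s \<and> s < \<tau> then Gamma \<alpha> * Gamma (1 - \<alpha>) else 0)"
      unfolding k_def by (rule abel_kernel_convolution(2)[OF \<alpha>])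
    finally show "(\<integral>\<xi>. F \<xi> s \<partial>lborel) = (Gamma (1 - \<alpha>) * Gamma \<alpha>) *\<^sub>R (indicator {0..<\<tau>} s *\<^sub>R \<phi> s)"
      by (auto simp: indicator_def)
  qed
  also have "\<dots> = (Gamma (1 - \<alpha>) * Gamma \<alpha>) *\<^sub>R (\<integral>s. indicator {0..<\<tau>} s *\<^sub>R \<phi> s \<partial>lborel)"
    by (rule integral_scaleR_right)
  also have "(\<integral>s. indicator {0..<\<tau>} s *\<^sub>R \<phi> s \<partial>lborel) = (\<integral>s. indicator {0..<\<tau>} s *\<^sub>R \<phi> s \<partial>lebesgue)"
    by (rule integral_completion[symmetric]) measurable
  also have "\<dots> = (\<integral>s. indicator {0..\<tau>} s *\<^sub>R \<psi> s \<partial>lebesgue)"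
  proof (rule integral_cong_AE)
    show "(\<lambda>s. indicator {0..<\<tau>} s *\<^sub>R \<phi> s) \<in> borel_measurable lebesgue"
      by (rule measurable_completion) measurable
    show "(\<lambda>s. indicator {0..\<tau>} s *\<^sub>R \<psi> s) \<in> borel_measurable lebesgue"
      using bounded_measurable_measurable[OF bounded_measurable_subset[OF \<psi> \<tau>(2)]]
      by (subst borel_measurable_restrict_space_iff[symmetric]) auto
    show "AE s in lebesgue. indicator {0..<\<tau>} s *\<^sub>R \<phi> s = indicator {0..\<tau>} s *\<^sub>R \<psi> s"
      using ae AE_completion[OF AE_lborel_singleton[of \<tau>]]
      by eventually_elim (use \<tau> in \<open>auto simp: indicator_def\<close>)
  qed
  also have "\<dots> = integral {0..\<tau>} \<psi>"
    using set_lebesgue_integral_eq_integral(2)[OF bounded_measurable_integrable[OF \<psi> order_refl \<tau>(2)]]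
    by (simp add: set_lebesgue_integral_def)
  finally show ?thesis using G by simp
qed

section \<open>Almost everywhere differentiation of indefinite integrals\<close>

text \<open>The point \<open>y\<close> may lie on either side of the tag \<open>x\<close>, while
  Henstock's lemma speaks of intervals; both terms change sign together, so the norms agree.\<close>

lemma integral_increment_Henstock:
  fixes f :: "real \<Rightarrow> 'a::euclidean_space"
  assumes f: "f integrable_on {a..b}" and xy: "x \<in> {a..b}" "y \<in> {a..b}"
  shows "norm (measure lborel {min x y..max x y} *\<^sub>R f x - integral {min x y..max x y} f)
    = norm (integral {a..y} f - integral {a..x} f - (y - x) *\<^sub>R f x)"
proof (cases "x \<le> y")
  case True
  have "integral {a..x} f + integral {x..y} f = integral {a..y} f"
    using xy True by (intro Henstock_Kurzweil_Integration.integral_combine integrable_on_subinterval[OF f]) auto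
  then have "integral {x..y} f = integral {a..y} f - integral {a..x} f" by (simp add: algebra_simps)
  then show ?thesis using True by (simp add: norm_minus_commute[of "(y - x) *\<^sub>R f x"])
next
  case False
  have "integral {a..y} f + integral {y..x} f = integral {a..x} f"
    using xy False by (intro Henstock_Kurzweil_Integration.integral_combine integrable_on_subinterval[OF f]) auto
  then have "integral {y..x} f = integral {a..x} f - integral {a..y} f" by (simp add: algebra_simps)
  then have "measure lborel {min x y..max x y} *\<^sub>R f x - integral {min x y..max x y} f =
    integral {a..y} f - integral {a..x} f - (y - x) *\<^sub>R f x"
    using False by (simp add: algebra_simps)
  then show ?thesis by simp
qed

text \<open>The intervals on which the difference quotient of the indefinite integral misses \<open>f x\<close> by more
  than \<open>e\<close> form a Vitali cover of the exceptional set, and Henstock's lemma makes the total length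
  of any disjoint finite family of them arbitrarily small.\<close>

lemma negligible_integral_not_deriv:
  fixes f :: "real \<Rightarrow> 'a::euclidean_space"
  assumes f: "f integrable_on {a..b}" and e: "e > 0"
  defines "F \<equiv> \<lambda>u. integral {a..u} f"
  shows "negligible {x \<in> {a<..<b}. \<forall>d>0. \<exists>y\<in>{a..b}. \<bar>y - x\<bar> < d \<and>
            norm (F y - F x - (y - x) *\<^sub>R f x) > e * \<bar>y - x\<bar>}" (is "negligible ?B")
  unfolding negligible_outer_le
proof (intro allI impI)
  fix \<eta> :: real assume \<eta>: "\<eta> > 0"
  obtain \<gamma> where \<gamma>: "gauge \<gamma>" and hen: "\<And>p. \<lbrakk>p tagged_partial_division_of (cbox a b); \<gamma> fine p\<rbrakk> \<Longrightarrow>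
      (\<Sum>(x,k)\<in>p. norm (measure lborel k *\<^sub>R f x - integral k f)) < e * \<eta>"
    using Henstock_lemma[of f a b "e * \<eta>"] f e \<eta> by auto
  define I where "I = (\<lambda>(x::real, y). {min x y..max x y})"
  \<comment> \<open>Each index keeps the tag \<open>x\<close> next to a witness \<open>y\<close> of
    failure, so the intervals selected by Vitali's theorem form a tagged family that is fine for
    \<open>\<gamma>\<close>. Midpoint and half-length present them as balls.\<close>
  define K where "K = {(x, y). x \<in> ?B \<and> y \<in> {a..b} \<and> I (x, y) \<subseteq> \<gamma> x \<and>
            norm (F y - F x - (y - x) *\<^sub>R f x) > e * \<bar>y - x\<bar>}"
  define c where "c = (\<lambda>(x, y). (x + y) / 2 :: real)"
  define r where "r = (\<lambda>(x, y). \<bar>y - x\<bar> / 2 :: real)"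
  have cb: "cball (c i) (r i) = I i" for i
    by (cases i) (auto simp: c_def r_def I_def cball_eq_atLeastAtMost min_def max_def field_simps)
  have ne: "x \<noteq> y" if "(x, y) \<in> K" for x y
    using that by (auto simp: K_def)
  have "\<exists>C. countable C \<and> C \<subseteq> K \<and> pairwise (\<lambda>i j. disjnt (cball (c i) (r i)) (cball (c j) (r j))) C \<and>
      negligible (?B - (\<Union>i\<in>C. cball (c i) (r i)))"
  proof (rule Vitali_covering_theorem_cballs[of K r ?B c])
    show "0 < r i" if "i \<in> K" for i using that ne by (cases i) (auto simp: r_def)
    fix x d :: real assume x: "x \<in> ?B" and d: "d > 0"
    obtain \<delta> where \<delta>: "\<delta> > 0" "ball x \<delta> \<subseteq> \<gamma> x"
      using \<gamma> by (meson gauge_def openE)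
    obtain y where y: "y \<in> {a..b}" "\<bar>y - x\<bar> < min d \<delta>" "norm (F y - F x - (y - x) *\<^sub>R f x) > e * \<bar>y - x\<bar>"
    proof -
      have "\<forall>d>0. \<exists>y\<in>{a..b}. \<bar>y - x\<bar> < d \<and> norm (F y - F x - (y - x) *\<^sub>R f x) > e * \<bar>y - x\<bar>"
        using x by simp
      from this[rule_format, of "min d \<delta>"] d \<delta>(1) show thesis using that by auto
    qed
    have "I (x, y) \<subseteq> ball x \<delta>" using y(2) by (auto simp: I_def dist_real_def min_def max_def split: if_splits)
    then have "(x, y) \<in> K" using x y \<delta> by (auto simp: K_def)
    moreover have "x \<in> cball (c (x, y)) (r (x, y))" unfolding cb by (simp add: I_def)
    moreover have "r (x, y) < d" using y by (auto simp: r_def)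
    ultimately show "\<exists>i. i \<in> K \<and> x \<in> cball (c i) (r i) \<and> r i < d" by blast
  qed blast
  then obtain C where C: "countable C" "C \<subseteq> K" "pairwise (\<lambda>i j. disjnt (I i) (I j)) C"
    "negligible (?B - (\<Union>i\<in>C. I i))" unfolding cb by blast
  have fin: "measure lebesgue (\<Union>i\<in>D. I i) \<le> \<eta>" if D: "D \<subseteq> C" "finite D" for D
  proof -
    define p where "p = (\<lambda>i. (fst i, I i)) ` D"
    have tag: "fst i \<in> I i" for i by (cases i) (auto simp: I_def)
    have dis: "I i \<inter> I j = {}" if "i \<in> D" "j \<in> D" "i \<noteq> j" for i j
      using C(3) D that unfolding pairwise_def disjnt_def by blast
    have inj: "inj_on (\<lambda>i. (fst i, I i)) D"
    proof (rule inj_onI, rule ccontr)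
      fix i j assume "i \<in> D" "j \<in> D" "(fst i, I i) = (fst j, I j)" "i \<noteq> j"
      then show False using dis[of i j] tag[of i] by auto
    qed
    have Kab: "x \<in> {a..b} \<and> y \<in> {a..b}" if "(x, y) \<in> D" for x y
      using that D C(2) by (force simp: K_def)
    have "p tagged_partial_division_of cbox a b"
      unfolding tagged_partial_division_of_def
    proof (intro conjI allI impI)
      show "finite p" using D by (simp add: p_def)
      show "x \<in> k" if "(x, k) \<in> p" for x k using that tag by (auto simp: p_def)
      show "k \<subseteq> cbox a b" if k: "(x, k) \<in> p" for x k
      proof -
        obtain u v where uv: "(u, v) \<in> D" "k = {min u v..max u v}"
          using k by (auto simp: p_def I_def)
        show ?thesis using Kab[OF uv(1)] by (simp add: uv(2))
      qed
      show "\<exists>u v. k = cbox u v" if k: "(x, k) \<in> p" for x k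
      proof -
        obtain u v where "(u, v) \<in> D" "k = {min u v..max u v}"
          using k by (auto simp: p_def I_def)
        then show ?thesis by (metis cbox_interval)
      qed
      show "interior k1 \<inter> interior k2 = {}"
        if "(x1, k1) \<in> p \<and> (x2, k2) \<in> p \<and> (x1, k1) \<noteq> (x2, k2)" for x1 k1 x2 k2
      proof -
        obtain i j where "i \<in> D" "j \<in> D" "k1 = I i" "k2 = I j" "i \<noteq> j"
          using \<open>(x1, k1) \<in> p \<and> (x2, k2) \<in> p \<and> (x1, k1) \<noteq> (x2, k2)\<close> by (auto simp: p_def)
        then have "k1 \<inter> k2 = {}" using dis by simp
        then show ?thesis using interior_subset by blast
      qed
    qed
    moreover have "\<gamma> fine p"
      using D C(2) by (force simp: fine_def p_def K_def)
    ultimately have "(\<Sum>(x,k)\<in>p. norm (measure lborel k *\<^sub>R f x - integral k f)) < e * \<eta>"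
      by (rule hen)
    moreover have "(\<Sum>(x,k)\<in>p. norm (measure lborel k *\<^sub>R f x - integral k f))
        = (\<Sum>i\<in>D. norm (measure lborel (I i) *\<^sub>R f (fst i) - integral (I i) f))"
      unfolding p_def by (subst sum.reindex[OF inj]) (simp add: o_def)
    \<comment> \<open>Every selected interval contributes at least \<open>e\<close> times its length
      to a sum that stays below \<open>e * \<eta>\<close>.\<close>
    moreover have "e * measure lebesgue (I i) \<le> norm (measure lborel (I i) *\<^sub>R f (fst i) - integral (I i) f)"
      if i: "i \<in> D" for i
    proof (cases i)
      case (Pair x y)
      then have "(x, y) \<in> K" using D C(2) i by auto
      then have "e * \<bar>y - x\<bar> \<le> norm (F y - F x - (y - x) *\<^sub>R f x)" by (auto simp: K_def)
      moreover have "measure lebesgue (I i) = \<bar>y - x\<bar>" by (auto simp: Pair I_def min_def max_def)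
      ultimately show ?thesis
        using integral_increment_Henstock[OF f, of x y] Kab[of x y] i by (auto simp: Pair I_def F_def)
    qed
    ultimately have "(\<Sum>i\<in>D. e * measure lebesgue (I i)) \<le> e * \<eta>"
      by (smt (verit) sum_mono)
    then have "(\<Sum>i\<in>D. measure lebesgue (I i)) \<le> \<eta>"
      using e by (simp flip: sum_distrib_left)
    moreover have "measure lebesgue (\<Union>i\<in>D. I i) \<le> (\<Sum>i\<in>D. measure lebesgue (I i))"
      using D by (intro measure_UNION_le) (auto simp: I_def split: prod.splits)
    ultimately show ?thesis by linarith
  qed
  have lm: "I i \<in> lmeasurable" for i by (cases i) (auto simp: I_def)
  have U: "(\<Union>i\<in>C. I i) \<in> lmeasurable" "measure lebesgue (\<Union>i\<in>C. I i) \<le> \<eta>"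
    using fmeasurable_UN_bound[OF C(1) lm fin] measure_UN_bound[OF C(1) lm fin] by blast+
  show "\<exists>T. ?B \<subseteq> T \<and> T \<in> lmeasurable \<and> measure lebesgue T \<le> \<eta>"
  proof (intro exI conjI)
    show "?B \<subseteq> (\<Union>i\<in>C. I i) \<union> (?B - (\<Union>i\<in>C. I i))" by blast
    have N: "?B - (\<Union>i\<in>C. I i) \<in> lmeasurable" "measure lebesgue (?B - (\<Union>i\<in>C. I i)) = 0"
      using C(4) by (simp_all add: negligible_iff_measure)
    show "(\<Union>i\<in>C. I i) \<union> (?B - (\<Union>i\<in>C. I i)) \<in> lmeasurable"
      using U(1) N(1) by (rule fmeasurable.Un)
    show "measure lebesgue ((\<Union>i\<in>C. I i) \<union> (?B - (\<Union>i\<in>C. I i))) \<le> \<eta>"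
      using measure_Un_le[of "\<Union>i\<in>C. I i" lebesgue "?B - (\<Union>i\<in>C. I i)"] U N by (auto dest: fmeasurableD)
  qed
qed

text \<open>The exceptional sets grow as \<open>e\<close> decreases, so the countably many values
  \<open>1 / Suc n\<close> capture all points at which the derivative fails.\<close>

lemma negligible_integral_not_vector_derivative:
  fixes f :: "real \<Rightarrow> 'a::euclidean_space"
  assumes f: "f integrable_on {a..b}"
  shows "negligible {x \<in> {a<..<b}. \<not> ((\<lambda>u. integral {a..u} f) has_vector_derivative f x) (at x)}"
proof -
  let ?F = "\<lambda>u. integral {a..u} f"
  define B where "B = (\<lambda>e. {x \<in> {a<..<b}. \<forall>d>0. \<exists>y\<in>{a..b}. \<bar>y - x\<bar> < d \<and>
            norm (?F y - ?F x - (y - x) *\<^sub>R f x) > e * \<bar>y - x\<bar>})"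
  have "(?F has_vector_derivative f x) (at x)" if x: "x \<in> {a<..<b}" "\<And>n. x \<notin> B (1 / real (Suc n))" for x
    unfolding has_vector_derivative_def has_derivative_at_alt
  proof (intro conjI allI impI)
    show "bounded_linear (\<lambda>h. h *\<^sub>R f x)" by (rule bounded_linear_scaleR_left)
    fix e :: real assume "e > 0"
    then obtain n where n: "1 / real (Suc n) < e" using nat_approx_posE by blast
    obtain d where d: "d > 0" "\<And>y. y \<in> {a..b} \<Longrightarrow> \<bar>y - x\<bar> < d \<Longrightarrow>
        norm (?F y - ?F x - (y - x) *\<^sub>R f x) \<le> 1 / real (Suc n) * \<bar>y - x\<bar>"
    proof -
      have "\<not> (\<forall>d>0. \<exists>y\<in>{a..b}. \<bar>y - x\<bar> < d \<and>
            norm (?F y - ?F x - (y - x) *\<^sub>R f x) > 1 / real (Suc n) * \<bar>y - x\<bar>)"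
        using x(1) x(2)[of n] by (simp add: B_def)
      then show thesis using that unfolding not_less[symmetric] by blast
    qed
    \<comment> \<open>The distances to the end points enter so that every nearby \<open>y\<close>,
      on both sides of \<open>x\<close>, lies in \<open>{a..b}\<close>, where the estimate
      holds.\<close>
    define d' where "d' = min d (min (x - a) (b - x))"
    have "d' > 0" using d x by (auto simp: d'_def)
    moreover have "norm (?F y - ?F x - (y - x) *\<^sub>R f x) \<le> e * norm (y - x)" if "norm (y - x) < d'" for y
    proof -
      have "norm (?F y - ?F x - (y - x) *\<^sub>R f x) \<le> 1 / real (Suc n) * \<bar>y - x\<bar>"
        using that by (intro d) (auto simp: d'_def)
      also have "\<dots> \<le> e * \<bar>y - x\<bar>" using n by (intro mult_right_mono) auto
      finally show ?thesis by simp
    qed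
    ultimately show "\<exists>d>0. \<forall>y. norm (y - x) < d \<longrightarrow> norm (?F y - ?F x - (y - x) *\<^sub>R f x) \<le> e * norm (y - x)"
      by blast
  qed
  then have "{x \<in> {a<..<b}. \<not> (?F has_vector_derivative f x) (at x)} \<subseteq> (\<Union>n. B (1 / real (Suc n)))"
    by blast
  moreover have "negligible (B e)" if "e > 0" for e
    unfolding B_def by (rule negligible_integral_not_deriv[OF f that])
  then have "negligible (\<Union>n. B (1 / real (Suc n)))"
    by (intro negligible_Union_nat) simp
  ultimately show ?thesis by (rule negligible_subset[rotated])
qed

section \<open>Fractional differential equations\<close>

lemma AE_lebesgue_on_iff:
  "S \<in> sets lebesgue \<Longrightarrow> (AE x in lebesgue_on S. Q x) \<longleftrightarrow> (AE x in lebesgue. x \<in> S \<longrightarrow> Q x)"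
  by (rule AE_restrict_space_iff) simp

lemma AE_notin_negligible: "negligible N \<Longrightarrow> AE x in lebesgue. x \<notin> N"
  by (rule AE_not_in) (simp add: negligible_iff_null_sets)

text \<open>Membership in \<open>Linf\<close> gives only an essential bound. Setting the density to
  zero where it exceeds that bound is a change on a null set, invisible to \<open>frac_int\<close>;
  later estimates can therefore be pointwise.\<close>

lemma AC_density:
  assumes "x \<in> AC \<alpha> t"
  obtains \<psi> where "bounded_measurable t \<psi>" "\<And>\<tau>. \<tau> \<in> {0..t} \<Longrightarrow> x \<tau> = x 0 + frac_int \<alpha> \<psi> \<tau>"
proof -
  obtain \<phi> C where \<phi>: "\<phi> \<in> borel_measurable (lebesgue_on {0..t})" "AE s in lebesgue_on {0..t}. norm (\<phi> s) \<le> C"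
    and x: "\<And>\<tau>. \<tau> \<in> {0..t} \<Longrightarrow> x \<tau> = x 0 + frac_int \<alpha> \<phi> \<tau>"
    using assms unfolding AC_def Linf_def by blast
  define \<psi> where "\<psi> = (\<lambda>s. if norm (\<phi> s) \<le> \<bar>C\<bar> then \<phi> s else 0)"
  have m: "\<psi> \<in> borel_measurable (lebesgue_on {0..t})"
    unfolding \<psi>_def using \<phi>(1) by measurable
  then have "bounded_measurable t \<psi>"
    by (rule bounded_measurableI[of _ _ "\<bar>C\<bar>"]) (simp add: \<psi>_def)
  moreover have "AE s in lebesgue. s \<in> {0..t} \<longrightarrow> \<phi> s = \<psi> s"
    using \<phi>(2) unfolding AE_lebesgue_on_iff[OF lmeasurable_interval(1)[of 0 t, THEN fmeasurableD]]
    by (rule eventually_mono) (auto simp: \<psi>_def)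
  then have "frac_int \<alpha> \<phi> \<tau> = frac_int \<alpha> \<psi> \<tau>" if "\<tau> \<in> {0..t}" for \<tau>
    using that by (intro frac_int_cong_AE[OF \<phi>(1) m]) (auto elim!: eventually_mono)
  ultimately show thesis using that x by metis
qed

lemma AC_I:
  assumes "bounded_measurable t \<psi>" "\<And>\<tau>. \<tau> \<in> {0..t} \<Longrightarrow> x \<tau> = x 0 + frac_int \<alpha> \<psi> \<tau>" "x \<in> extensional {0..t}"
  shows "x \<in> AC \<alpha> t"
proof -
  obtain C where C: "\<forall>s\<in>{0..t}. norm (\<psi> s) \<le> C" using bounded_measurable_bound[OF assms(1)] by blast
  have "bounded_measurable t (restrict \<psi> {0..t})" by (rule bounded_measurable_cong[OF assms(1)]) simp
  moreover have "AE s in lebesgue_on {0..t}. norm (restrict \<psi> {0..t} s) \<le> C"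
    using C by (simp add: AE_lebesgue_on_iff)
  ultimately have "restrict \<psi> {0..t} \<in> Linf t"
    using restrict_extensional[of \<psi> "{0..t}"] unfolding Linf_def bounded_measurable_def by blast
  moreover have "x \<tau> = x 0 + frac_int \<alpha> (restrict \<psi> {0..t}) \<tau>" if "\<tau> \<in> {0..t}" for \<tau>
    using assms(2)[OF that] frac_int_cong[of \<tau> "restrict \<psi> {0..t}" \<psi> \<alpha>] that by auto
  ultimately show ?thesis using assms(3) unfolding AC_def by blast
qed

lemma caputo_integral:
  assumes "bounded_measurable t \<psi>" "\<And>\<tau>. \<tau> \<in> {0..t} \<Longrightarrow> x \<tau> = x 0 + frac_int \<alpha> \<psi> \<tau>" "0 < \<alpha>" "\<alpha> < 1" "\<tau> \<in> {0..t}"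
  shows "frac_int (1 - \<alpha>) (\<lambda>\<xi>. x \<xi> - x 0) \<tau> = integral {0..\<tau>} \<psi>"
proof -
  have "frac_int (1 - \<alpha>) (\<lambda>\<xi>. x \<xi> - x 0) \<tau> = frac_int (1 - \<alpha>) (frac_int \<alpha> \<psi>) \<tau>"
  proof (rule frac_int_cong)
    fix s assume "s \<in> {0..<\<tau>}"
    then show "x s - x 0 = frac_int \<alpha> \<psi> s" using assms(2)[of s] assms(5) by simp
  qed
  then show ?thesis using frac_int_semigroup[OF assms(1,3,4), of \<tau>] assms(5) by simp
qed

text \<open>By \<open>caputo_integral\<close> the function to be differentiated is an indefinite
  integral on \<open>{0..t}\<close>. The end points are left out because the derivative is two-sided
  and nothing is known of \<open>x\<close> beyond \<open>t\<close>.\<close>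

lemma AE_has_caputo_derivative:
  assumes "bounded_measurable t \<psi>" "\<And>\<tau>. \<tau> \<in> {0..t} \<Longrightarrow> x \<tau> = x 0 + frac_int \<alpha> \<psi> \<tau>" "0 < \<alpha>" "\<alpha> < 1"
  shows "AE \<tau> in lebesgue. \<tau> \<in> {0<..<t} \<longrightarrow> has_caputo_derivative \<alpha> x (\<psi> \<tau>) \<tau>"
proof -
  have int: "\<psi> integrable_on {0..t}"
    using set_lebesgue_integral_eq_integral(1)[OF bounded_measurable_integrable[OF assms(1) order_refl order_refl]] .
  have "has_caputo_derivative \<alpha> x (\<psi> \<tau>) \<tau>"
    if "\<tau> \<in> {0<..<t}" "((\<lambda>u. integral {0..u} \<psi>) has_vector_derivative \<psi> \<tau>) (at \<tau>)" for \<tau>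
    unfolding has_caputo_derivative_def
    by (rule has_vector_derivative_transform_within_open[OF that(2), of "{0<..<t}"])
       (use that caputo_integral[OF assms] in auto)
  then show ?thesis
    using AE_notin_negligible[OF negligible_integral_not_vector_derivative[OF int]]
    by (auto elim!: eventually_mono)
qed

lemma has_caputo_derivative_unique:
  "has_caputo_derivative \<alpha> x d \<tau> \<Longrightarrow> has_caputo_derivative \<alpha> x e \<tau> \<Longrightarrow> d = e"
  unfolding has_caputo_derivative_def by (rule vector_derivative_unique_at)

text \<open>The Caputo derivative at \<open>\<tau>\<close> depends on the whole past and, being
  two-sided, on a little of the future. Agreement is therefore assumed from 0 to some
  \<open>t > \<tau>\<close>; agreement near \<open>\<tau>\<close> alone would not do.\<close>

lemma has_caputo_derivative_transform:
  assumes "has_caputo_derivative \<alpha> x d \<tau>" "0 < \<tau>" "\<tau> < t" "\<And>s. s \<in> {0..t} \<Longrightarrow> x s = y s"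
  shows "has_caputo_derivative \<alpha> y d \<tau>"
  unfolding has_caputo_derivative_def
proof (rule has_vector_derivative_transform_within_open)
  show "(frac_int (1 - \<alpha>) (\<lambda>\<xi>. x \<xi> - x 0) has_vector_derivative d) (at \<tau>)"
    using assms(1) by (simp add: has_caputo_derivative_def)
  show "frac_int (1 - \<alpha>) (\<lambda>\<xi>. x \<xi> - x 0) s = frac_int (1 - \<alpha>) (\<lambda>\<xi>. y \<xi> - y 0) s" if "s \<in> {0<..<t}" for s
    using that by (intro frac_int_cong) (simp add: assms(4))
qed (use assms in auto)

lemma AC_continuous:
  assumes "x \<in> AC \<alpha> t" "0 < \<alpha>" "\<alpha> < 1"
  shows "continuous_on {0..t} x"
proof -
  obtain \<psi> where \<psi>: "bounded_measurable t \<psi>" "\<And>\<tau>. \<tau> \<in> {0..t} \<Longrightarrow> x \<tau> = x 0 + frac_int \<alpha> \<psi> \<tau>"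
    using AC_density[OF assms(1)] by metis
  have "continuous_on {0..t} (\<lambda>\<tau>. x 0 + frac_int \<alpha> \<psi> \<tau>)"
    by (intro continuous_intros frac_int_continuous \<psi> assms)
  then show ?thesis by (rule continuous_on_eq) (simp add: \<psi>(2)[symmetric])
qed

lemma AC_restrict:
  assumes "x \<in> AC \<alpha> t" "0 \<le> \<tau>" "\<tau> \<le> t"
  shows "restrict x {0..\<tau>} \<in> AC \<alpha> \<tau>"
proof -
  obtain \<psi> where \<psi>: "bounded_measurable t \<psi>" "\<And>s. s \<in> {0..t} \<Longrightarrow> x s = x 0 + frac_int \<alpha> \<psi> s"
    using AC_density[OF assms(1)] by metis
  show ?thesis
  proof (rule AC_I[OF bounded_measurable_subset[OF \<psi>(1) assms(3)]])
    fix s assume "s \<in> {0..\<tau>}"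
    then show "restrict x {0..\<tau>} s = restrict x {0..\<tau>} 0 + frac_int \<alpha> \<psi> s"
      using \<psi>(2)[of s] assms by simp
  qed simp
qed

text \<open>For \<open>S\<close>, the supremum of \<open>m s * exp (- (l * s))\<close>, a large
  \<open>l\<close> turns the hypothesis into \<open>S \<le> A + S / 2\<close>; \<open>S\<close> is
  finite because \<open>m\<close> is bounded, so it can be absorbed. \<open>K\<close> precedes
  \<open>t\<close>, \<open>m\<close> and \<open>A\<close>, as bounds uniform in the control
  require.\<close>

lemma frac_gronwall:
  fixes \<alpha> T L :: real
  assumes "0 < \<alpha>" "\<alpha> < 1" "0 \<le> T" "0 \<le> L"
  shows "\<exists>K\<ge>0. \<forall>t m A. 0 \<le> t \<longrightarrow> t \<le> T \<longrightarrow> bounded_measurable t m \<longrightarrow> 0 \<le> A \<longrightarrow>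
    (\<forall>\<tau>\<in>{0..t}. 0 \<le> m \<tau> \<and> m \<tau> \<le> A + L * frac_int \<alpha> m \<tau>) \<longrightarrow> (\<forall>\<tau>\<in>{0..t}. m \<tau> \<le> K * A)"
proof -
  \<comment> \<open>With this factor, \<open>L\<close> times the fractional integral of the
    exponential is at most half of the exponential; adding 1 to \<open>L\<close> covers
    \<open>L = 0\<close>.\<close>
  obtain l where l: "l > 0" "\<forall>\<tau>\<in>{0..T}. frac_int \<alpha> (\<lambda>s. exp (l * s)) \<tau> \<le> 1 / (2 * (L + 1)) * exp (l * \<tau>)"
    using frac_int_exp_small[of \<alpha> T "1 / (2 * (L + 1))"] assms by auto
  have "m \<tau> \<le> 2 * exp (l * T) * A"
    if t: "0 \<le> t" "t \<le> T" and m: "bounded_measurable t m" and A: "0 \<le> A"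
      and le: "\<forall>\<tau>\<in>{0..t}. 0 \<le> m \<tau> \<and> m \<tau> \<le> A + L * frac_int \<alpha> m \<tau>" and \<tau>: "\<tau> \<in> {0..t}" for t m A \<tau>
  proof -
    define g where "g = (\<lambda>s. m s * exp (- (l * s)))"
    define S where "S = (SUP s\<in>{0..t}. g s)"
    obtain C where C: "C > 0" "\<forall>s\<in>{0..t}. norm (m s) \<le> C" using bounded_measurable_bound[OF m] by blast
    have "g s \<le> C" if "s \<in> {0..t}" for s
    proof -
      have "m s * exp (- (l * s)) \<le> C * 1"
        using C that l le by (intro mult_mono) auto
      then show ?thesis by (simp add: g_def)
    qed
    then have bdd: "bdd_above (g ` {0..t})" by (rule bdd_aboveI2)
    have gS: "g s \<le> S" if "s \<in> {0..t}" for s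
      unfolding S_def by (rule cSUP_upper[OF that bdd])
    have "0 \<le> g 0" using le t by (simp add: g_def)
    then have S0: "0 \<le> S" using gS[of 0] t by simp
    have mS: "m s \<le> S * exp (l * s)" if "s \<in> {0..t}" for s
      using gS[OF that] by (simp add: g_def exp_minus field_simps)
    have "g s \<le> A + S / 2" if s: "s \<in> {0..t}" for s
    proof -
      have "frac_int \<alpha> m s \<le> frac_int \<alpha> (\<lambda>s. S * exp (l * s)) s"
      proof (rule frac_int_mono[OF m _ assms(1)])
        show "bounded_measurable t (\<lambda>s. S * exp (l * s))" by (intro bounded_measurable_continuous continuous_intros)
      qed (use mS s in auto)
      also have "\<dots> = S * frac_int \<alpha> (\<lambda>s. exp (l * s)) s" by (rule frac_int_mult)
      also have "\<dots> \<le> S * (1 / (2 * (L + 1)) * exp (l * s))"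
        using l(2) s t S0 by (intro mult_left_mono) auto
      finally have "L * frac_int \<alpha> m s \<le> L * (S * (1 / (2 * (L + 1)) * exp (l * s)))"
        using assms by (intro mult_left_mono)
      also have "\<dots> = (L / (L + 1)) * (S / 2 * exp (l * s))" using assms by (simp add: field_simps)
      also have "\<dots> \<le> 1 * (S / 2 * exp (l * s))" using assms S0 by (intro mult_right_mono) auto
      finally have "m s \<le> A + S / 2 * exp (l * s)" using le s by force
      then have "g s \<le> (A + S / 2 * exp (l * s)) * exp (- (l * s))"
        unfolding g_def by (intro mult_right_mono) auto
      also have "\<dots> = A * exp (- (l * s)) + S / 2" by (simp add: distrib_right exp_minus)
      also have "A * exp (- (l * s)) \<le> A * 1" using A l s by (intro mult_left_mono) auto
      finally show ?thesis by simp
    qed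
    then have "S \<le> A + S / 2" unfolding S_def using t by (intro cSUP_least) auto
    then have "S \<le> 2 * A" by simp
    then have "m \<tau> \<le> (2 * A) * exp (l * \<tau>)"
      using mS[OF \<tau>] by (smt (verit) exp_ge_zero mult_right_mono)
    also have "\<dots> \<le> (2 * A) * exp (l * T)" using A \<tau> t l by (intro mult_left_mono) auto
    finally show ?thesis by (simp add: mult_ac)
  qed
  then show ?thesis by (intro exI[of _ "2 * exp (l * T)"]) auto
qed

section \<open>Motions of a field into which the control has been absorbed\<close>

definition is_motion :: "real \<Rightarrow> (real \<Rightarrow> 'a::euclidean_space \<Rightarrow> 'a) \<Rightarrow> real \<Rightarrow> (real \<Rightarrow> 'a) \<Rightarrow> real \<Rightarrow> (real \<Rightarrow> 'a) \<Rightarrow> bool" where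
  "is_motion \<alpha> F t w \<theta> x \<longleftrightarrow> x \<in> AC \<alpha> \<theta> \<and> (\<forall>\<tau>\<in>{0..t}. x \<tau> = w \<tau>) \<and>
     (AE \<tau> in lebesgue_on {t..\<theta>}. has_caputo_derivative \<alpha> x (F \<tau> (x \<tau>)) \<tau>)"

text \<open>Measurability and boundedness are demanded only along continuous curves, which is what
  the integral equation needs. Controlled fields, their truncations and constant fields all
  qualify.\<close>

definition admissible :: "(real \<Rightarrow> 'a::euclidean_space \<Rightarrow> 'a) \<Rightarrow> real \<Rightarrow> real \<Rightarrow> bool" where
  "admissible F t \<theta> \<longleftrightarrow> (\<forall>x. continuous_on {0..\<theta>} x \<longrightarrow>
     (\<lambda>s. F s (x s)) \<in> borel_measurable (lebesgue_on {t..\<theta>}) \<and> bounded ((\<lambda>s. F s (x s)) ` {t..\<theta>}))"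

lemma bounded_measurable_motion_density:
  assumes "admissible F t \<theta>" "bounded_measurable t \<psi>" "continuous_on {0..\<theta>} x"
  shows "bounded_measurable \<theta> (\<lambda>s. if s < t then \<psi> s else F s (x s))"
  using assms by (intro bounded_measurable_glue) (auto simp: admissible_def)

text \<open>Any density of \<open>x\<close> is its Caputo derivative almost everywhere, so by
  uniqueness of derivatives it equals \<open>\<psi>\<close> before \<open>t\<close> and the field
  after \<open>t\<close>. The past must be identified too, since the fractional integral beyond
  \<open>t\<close> still feels it.\<close>

lemma is_motion_integral:
  assumes m: "is_motion \<alpha> F t w \<theta> x" and adm: "admissible F t \<theta>" and \<alpha>: "0 < \<alpha>" "\<alpha> < 1" and t: "0 \<le> t" "t \<le> \<theta>"
    and \<psi>: "bounded_measurable t \<psi>" "\<And>\<tau>. \<tau> \<in> {0..t} \<Longrightarrow> w \<tau> = w 0 + frac_int \<alpha> \<psi> \<tau>" and \<tau>: "\<tau> \<in> {0..\<theta>}"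
  shows "x \<tau> = w 0 + frac_int \<alpha> (\<lambda>s. if s < t then \<psi> s else F s (x s)) \<tau>"
proof -
  have x: "x \<in> AC \<alpha> \<theta>" "\<And>s. s \<in> {0..t} \<Longrightarrow> x s = w s"
    and ae1: "AE s in lebesgue. s \<in> {t..\<theta>} \<longrightarrow> has_caputo_derivative \<alpha> x (F s (x s)) s"
    using m unfolding is_motion_def by (auto simp: AE_lebesgue_on_iff)
  obtain \<phi> where \<phi>: "bounded_measurable \<theta> \<phi>" "\<And>s. s \<in> {0..\<theta>} \<Longrightarrow> x s = x 0 + frac_int \<alpha> \<phi> s"
    using AC_density[OF x(1)] by metis
  note meas = bounded_measurable_motion_density[OF adm \<psi>(1) AC_continuous[OF x(1) \<alpha>]]
  have ae2: "AE s in lebesgue. s \<in> {0<..<\<theta>} \<longrightarrow> has_caputo_derivative \<alpha> x (\<phi> s) s"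
    by (rule AE_has_caputo_derivative[OF \<phi>(1) _ \<alpha>]) (rule \<phi>(2))
  have ae3: "AE s in lebesgue. s \<in> {0<..<t} \<longrightarrow> has_caputo_derivative \<alpha> w (\<psi> s) s"
    by (rule AE_has_caputo_derivative[OF \<psi>(1) _ \<alpha>]) (rule \<psi>(2))
  have "AE s in lebesgue. s \<noteq> 0" "AE s in lebesgue. s \<noteq> t" "AE s in lebesgue. s \<noteq> \<theta>"
    using AE_completion[OF AE_lborel_singleton[of 0]] AE_completion[OF AE_lborel_singleton[of t]]
      AE_completion[OF AE_lborel_singleton[of \<theta>]] by auto
  then have "AE s in lebesgue. s \<in> {0..\<tau>} \<longrightarrow> \<phi> s = (if s < t then \<psi> s else F s (x s))"
    using ae1 ae2 ae3
  proof eventually_elim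
    case (elim s)
    show ?case
    proof
      assume s: "s \<in> {0..\<tau>}"
      then have x\<phi>: "has_caputo_derivative \<alpha> x (\<phi> s) s" using elim \<tau> by auto
      show "\<phi> s = (if s < t then \<psi> s else F s (x s))"
      proof (cases "s < t")
        case True
        then have "has_caputo_derivative \<alpha> w (\<psi> s) s" using elim s by auto
        then have "has_caputo_derivative \<alpha> x (\<psi> s) s"
          by (rule has_caputo_derivative_transform[of _ _ _ _ t]) (use elim s True x in auto)
        then show ?thesis using has_caputo_derivative_unique[OF x\<phi>] True by simp
      next
        case False
        then show ?thesis using has_caputo_derivative_unique[OF x\<phi>] elim s \<tau> by auto
      qed
    qed
  qed
  then have "frac_int \<alpha> \<phi> \<tau> = frac_int \<alpha> (\<lambda>s. if s < t then \<psi> s else F s (x s)) \<tau>"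
    using \<tau> by (intro frac_int_cong_AE[OF bounded_measurable_measurable[OF \<phi>(1)] bounded_measurable_measurable[OF meas]]) auto
  then show ?thesis using \<phi>(2)[OF \<tau>] x(2)[of 0] t by simp
qed

text \<open>At a time up to and including \<open>t\<close> the fractional integral involves the
  density only at strictly earlier times, where it is \<open>\<psi>\<close>; this yields agreement
  with \<open>w\<close>. After \<open>t\<close> the density is the field, and it is the Caputo
  derivative almost everywhere.\<close>

lemma is_motionI:
  assumes x: "x \<in> extensional {0..\<theta>}" "continuous_on {0..\<theta>} x"
    "\<And>\<tau>. \<tau> \<in> {0..\<theta>} \<Longrightarrow> x \<tau> = w 0 + frac_int \<alpha> (\<lambda>s. if s < t then \<psi> s else F s (x s)) \<tau>"
    and adm: "admissible F t \<theta>" and \<alpha>: "0 < \<alpha>" "\<alpha> < 1" and t: "0 \<le> t" "t \<le> \<theta>"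
    and \<psi>: "bounded_measurable t \<psi>" "\<And>\<tau>. \<tau> \<in> {0..t} \<Longrightarrow> w \<tau> = w 0 + frac_int \<alpha> \<psi> \<tau>"
  shows "is_motion \<alpha> F t w \<theta> x"
proof -
  let ?\<phi> = "\<lambda>s. if s < t then \<psi> s else F s (x s)"
  note meas = bounded_measurable_motion_density[OF adm \<psi>(1) x(2)]
  have x0: "x 0 = w 0" using x(3)[of 0] t by simp
  have x3: "x \<tau> = x 0 + frac_int \<alpha> ?\<phi> \<tau>" if "\<tau> \<in> {0..\<theta>}" for \<tau>
    using x(3)[OF that] x0 by simp
  have "x \<in> AC \<alpha> \<theta>" by (rule AC_I[OF meas x3 x(1)])
  moreover have "x \<tau> = w \<tau>" if "\<tau> \<in> {0..t}" for \<tau>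
    using x(3)[of \<tau>] \<psi>(2)[OF that] that t frac_int_cong[of \<tau> ?\<phi> \<psi> \<alpha>] by auto
  moreover have "AE s in lebesgue_on {t..\<theta>}. has_caputo_derivative \<alpha> x (F s (x s)) s"
  proof -
    have ae: "AE s in lebesgue. s \<in> {0<..<\<theta>} \<longrightarrow> has_caputo_derivative \<alpha> x (?\<phi> s) s"
      by (rule AE_has_caputo_derivative[OF meas _ \<alpha>]) (rule x3)
    have "AE s in lebesgue. s \<noteq> 0" "AE s in lebesgue. s \<noteq> \<theta>"
      using AE_completion[OF AE_lborel_singleton[of 0]] AE_completion[OF AE_lborel_singleton[of \<theta>]] by auto
    then have "AE s in lebesgue. s \<in> {t..\<theta>} \<longrightarrow> has_caputo_derivative \<alpha> x (F s (x s)) s"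
      using ae
      by eventually_elim (use t in \<open>auto split: if_splits\<close>)
    then show ?thesis by (simp add: AE_lebesgue_on_iff)
  qed
  ultimately show ?thesis unfolding is_motion_def by blast
qed

text \<open>Banach's fixed point theorem for the integral equation, in the supremum norm weighted by
  \<open>exp (- l \<tau>)\<close> with \<open>l\<close> large.\<close>

lemma is_motion_exists_Lipschitz:
  fixes F :: "real \<Rightarrow> 'a::euclidean_space \<Rightarrow> 'a"
  assumes adm: "admissible F t \<theta>" and \<alpha>: "0 < \<alpha>" "\<alpha> < 1" and t: "0 \<le> t" "t \<le> \<theta>"
    and w: "w \<in> AC \<alpha> t"
    and L: "L \<ge> 0" "\<And>s y y'. s \<in> {t..\<theta>} \<Longrightarrow> norm (F s y - F s y') \<le> L * norm (y - y')"
  shows "\<exists>x. is_motion \<alpha> F t w \<theta> x"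
proof -
  obtain \<psi> where \<psi>: "bounded_measurable t \<psi>" "\<And>\<tau>. \<tau> \<in> {0..t} \<Longrightarrow> w \<tau> = w 0 + frac_int \<alpha> \<psi> \<tau>"
    using AC_density[OF w] by metis
  obtain l where l: "l > 0" "\<forall>\<tau>\<in>{0..\<theta>}. frac_int \<alpha> (\<lambda>s. exp (l * s)) \<tau> \<le> 1 / (2 * (L + 1)) * exp (l * \<tau>)"
    using frac_int_exp_small[of \<alpha> \<theta> "1 / (2 * (L + 1))"] \<alpha> t L(1) by auto
  \<comment> \<open>\<open>z\<close> is the weighted function and \<open>X z\<close> the curve
    itself, so the supremum distance between the \<open>z\<close> is the weighted distance between
    the curves.\<close>
  define X where "X = (\<lambda>(z :: real \<Rightarrow>\<^sub>C 'a) s. exp (l * s) *\<^sub>R apply_bcontfun z s)"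
  define D where "D = (\<lambda>z s. if s < t then \<psi> s else F s (X z s))"
  \<comment> \<open>Bounded continuous functions live on the whole line; clamping time to
    \<open>{0..\<theta>}\<close> extends the values of the integral operator there.\<close>
  define cl where "cl = (\<lambda>\<tau>. max 0 (min \<theta> \<tau>))"
  define G where "G = (\<lambda>z \<tau>. exp (- (l * cl \<tau>)) *\<^sub>R (w 0 + frac_int \<alpha> (D z) (cl \<tau>)))"
  have cl: "cl \<tau> \<in> {0..\<theta>}" for \<tau> using t by (auto simp: cl_def)
  have measD: "bounded_measurable \<theta> (D z)" for z
    unfolding D_def by (intro bounded_measurable_motion_density[OF adm \<psi>(1)]) (simp add: X_def continuous_intros)
  have G: "G z \<in> bcontfun" for z
  proof -
    have c: "continuous_on {0..\<theta>} (\<lambda>\<tau>. exp (- (l * \<tau>)) *\<^sub>R (w 0 + frac_int \<alpha> (D z) \<tau>))"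
      by (intro continuous_intros frac_int_continuous[OF measD \<alpha>])
    have "continuous_on UNIV cl" unfolding cl_def by (intro continuous_intros)
    then have "continuous_on UNIV (G z)"
      unfolding G_def using continuous_on_compose2[OF c, of UNIV cl] cl by blast
    moreover have "bounded ((\<lambda>\<tau>. exp (- (l * \<tau>)) *\<^sub>R (w 0 + frac_int \<alpha> (D z) \<tau>)) ` {0..\<theta>})"
      by (intro compact_imp_bounded compact_continuous_image c) simp
    then have "bounded (range (G z))"
      by (rule bounded_subset) (use cl in \<open>auto simp: G_def\<close>)
    ultimately show ?thesis by (auto simp: bcontfun_def)
  qed
  define \<Phi> where "\<Phi> = (\<lambda>z. Bcontfun (G z))"
  have \<Phi>: "apply_bcontfun (\<Phi> z) = G z" for z
    unfolding \<Phi>_def using G by (rule Bcontfun_inverse)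
  have "dist (\<Phi> z) (\<Phi> z') \<le> 1/2 * dist z z'" for z z'
  proof (rule dist_bound)
    fix \<tau>' :: real
    define \<tau> where "\<tau> = cl \<tau>'"
    have \<tau>: "\<tau> \<in> {0..\<theta>}" using cl by (simp add: \<tau>_def)
    define d where "d = dist z z'"
    have d: "0 \<le> d" by (simp add: d_def)
    have pt: "norm (D z s - D z' s) \<le> L * d * exp (l * s)" if "s \<in> {0..\<tau>}" for s
    proof (cases "s < t")
      case True
      then show ?thesis using L(1) d by (simp add: D_def)
    next
      case False
      then have "norm (D z s - D z' s) \<le> L * norm (X z s - X z' s)"
        using L(2)[of s "X z s" "X z' s"] that \<tau> by (auto simp: D_def)
      also have "norm (X z s - X z' s) = exp (l * s) * dist (apply_bcontfun z s) (apply_bcontfun z' s)"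
        by (simp add: X_def dist_norm flip: scaleR_diff_right)
      also have "L * (exp (l * s) * dist (apply_bcontfun z s) (apply_bcontfun z' s)) \<le> L * (exp (l * s) * d)"
        using L(1) dist_bounded[of z s z'] by (intro mult_left_mono) (auto simp: d_def)
      finally show ?thesis by (simp add: mult_ac)
    qed
    have measdiff: "bounded_measurable \<tau> (\<lambda>s. D z s - D z' s)"
      using bounded_measurable_subset[OF bounded_measurable_diff[OF measD measD]] \<tau> by auto
    have "norm (frac_int \<alpha> (D z) \<tau> - frac_int \<alpha> (D z') \<tau>) = norm (frac_int \<alpha> (\<lambda>s. D z s - D z' s) \<tau>)"
      using frac_int_diff[OF measD measD \<alpha>(1)] \<tau> by simp
    also have "\<dots> \<le> frac_int \<alpha> (\<lambda>s. norm (D z s - D z' s)) \<tau>"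
      by (rule norm_frac_int_le[OF \<alpha>(1)])
    also have "\<dots> \<le> frac_int \<alpha> (\<lambda>s. L * d * exp (l * s)) \<tau>"
    proof (rule frac_int_mono[OF bounded_measurable_norm[OF measdiff] _ \<alpha>(1) order_refl])
      show "bounded_measurable \<tau> (\<lambda>s. L * d * exp (l * s))" by (intro bounded_measurable_continuous continuous_intros)
    qed (use pt in auto)
    also have "\<dots> = L * d * frac_int \<alpha> (\<lambda>s. exp (l * s)) \<tau>" by (rule frac_int_mult)
    also have "\<dots> \<le> L * d * (1 / (2 * (L + 1)) * exp (l * \<tau>))"
      using l(2) \<tau> L(1) d by (intro mult_left_mono) auto
    also have "\<dots> = (L / (L + 1)) * (d / 2 * exp (l * \<tau>))" using L(1) by (simp add: field_simps)
    also have "\<dots> \<le> 1 * (d / 2 * exp (l * \<tau>))" using L(1) d by (intro mult_right_mono) auto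
    finally have "exp (- (l * \<tau>)) * norm (frac_int \<alpha> (D z) \<tau> - frac_int \<alpha> (D z') \<tau>) \<le> exp (- (l * \<tau>)) * (d / 2 * exp (l * \<tau>))"
      by (intro mult_left_mono) auto
    then have "exp (- (l * \<tau>)) * norm (frac_int \<alpha> (D z) \<tau> - frac_int \<alpha> (D z') \<tau>) \<le> d / 2"
      by (simp add: exp_minus field_simps)
    then show "dist (apply_bcontfun (\<Phi> z) \<tau>') (apply_bcontfun (\<Phi> z') \<tau>') \<le> 1/2 * dist z z'"
      by (simp add: \<Phi> G_def dist_norm d_def flip: \<tau>_def scaleR_diff_right)
  qed
  then obtain z where z: "\<Phi> z = z"
    using banach_fix_type[of "1/2" \<Phi>] by auto
  define x where "x = restrict (X z) {0..\<theta>}"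
  have xX: "x s = X z s" if "s \<in> {0..\<theta>}" for s using that by (simp add: x_def)
  have "is_motion \<alpha> F t w \<theta> x"
  proof (rule is_motionI[OF _ _ _ adm \<alpha> t \<psi>(1)])
    show "x \<in> extensional {0..\<theta>}" by (simp add: x_def)
    have "continuous_on {0..\<theta>} (X z)" by (simp add: X_def continuous_intros)
    then show "continuous_on {0..\<theta>} x" by (rule continuous_on_eq) (simp add: xX)
    fix \<tau> assume \<tau>: "\<tau> \<in> {0..\<theta>}"
    then have c\<tau>: "cl \<tau> = \<tau>" by (auto simp: cl_def)
    have "x \<tau> = exp (l * \<tau>) *\<^sub>R apply_bcontfun (\<Phi> z) \<tau>" using xX[OF \<tau>] z by (simp add: X_def)
    also have "\<dots> = (exp (l * \<tau>) * exp (- (l * \<tau>))) *\<^sub>R (w 0 + frac_int \<alpha> (D z) \<tau>)"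
      by (simp add: \<Phi> G_def c\<tau>)
    also have "\<dots> = w 0 + frac_int \<alpha> (D z) \<tau>" by (simp flip: exp_add)
    also have "frac_int \<alpha> (D z) \<tau> = frac_int \<alpha> (\<lambda>s. if s < t then \<psi> s else F s (x s)) \<tau>"
      using \<tau> by (intro frac_int_cong) (auto simp: D_def xX)
    finally show "x \<tau> = w 0 + frac_int \<alpha> (\<lambda>s. if s < t then \<psi> s else F s (x s)) \<tau>" .
  qed (rule \<psi>(2))
  then show ?thesis by blast
qed

text \<open>Both motions are continuous and hence stay in one ball; the Lipschitz constant of that
  ball puts their distance under the Gronwall inequality with \<open>A = 0\<close>.\<close>

lemma is_motion_unique:
  fixes F :: "real \<Rightarrow> 'a::euclidean_space \<Rightarrow> 'a"
  assumes adm: "admissible F t \<theta>" and \<alpha>: "0 < \<alpha>" "\<alpha> < 1" and t: "0 \<le> t" "t \<le> \<theta>"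
    and w: "w \<in> AC \<alpha> t"
    and L: "\<And>R. R > 0 \<Longrightarrow> \<exists>L\<ge>0. \<forall>s\<in>{t..\<theta>}. \<forall>y y'. norm y \<le> R \<longrightarrow> norm y' \<le> R \<longrightarrow>
      norm (F s y - F s y') \<le> L * norm (y - y')"
    and x: "is_motion \<alpha> F t w \<theta> x" and y: "is_motion \<alpha> F t w \<theta> y"
  shows "x = y"
proof -
  obtain \<psi> where \<psi>: "bounded_measurable t \<psi>" "\<And>\<tau>. \<tau> \<in> {0..t} \<Longrightarrow> w \<tau> = w 0 + frac_int \<alpha> \<psi> \<tau>"
    using AC_density[OF w] by metis
  have AC: "x \<in> AC \<alpha> \<theta>" "y \<in> AC \<alpha> \<theta>" using x y by (auto simp: is_motion_def)
  note cont = AC[THEN AC_continuous[OF _ \<alpha>]]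
  note measx = cont[THEN bounded_measurable_continuous]
  obtain R1 R2 where R: "R1 > 0" "\<forall>s\<in>{0..\<theta>}. norm (x s) \<le> R1" "R2 > 0" "\<forall>s\<in>{0..\<theta>}. norm (y s) \<le> R2"
    using bounded_measurable_bound[OF measx(1)] bounded_measurable_bound[OF measx(2)] by blast
  have "max R1 R2 > 0" using R by simp
  from L[OF this] obtain L where L0: "L \<ge> 0" and L: "\<forall>s\<in>{t..\<theta>}. \<forall>y y'. norm y \<le> max R1 R2 \<longrightarrow> norm y' \<le> max R1 R2 \<longrightarrow>
      norm (F s y - F s y') \<le> L * norm (y - y')"
    by blast
  let ?D = "\<lambda>x s. if s < t then \<psi> s else F s (x s)"
  note meas = cont[THEN bounded_measurable_motion_density[OF adm \<psi>(1)]]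
  note measd = bounded_measurable_norm[OF bounded_measurable_diff[OF measx]]
  have "norm (x \<tau> - y \<tau>) \<le> 0 + L * frac_int \<alpha> (\<lambda>s. norm (x s - y s)) \<tau>" if \<tau>: "\<tau> \<in> {0..\<theta>}" for \<tau>
  proof -
    have "x \<tau> = w 0 + frac_int \<alpha> (?D x) \<tau>"
      by (rule is_motion_integral[OF x adm \<alpha> t \<psi>(1) _ \<tau>]) (rule \<psi>(2))
    moreover have "y \<tau> = w 0 + frac_int \<alpha> (?D y) \<tau>"
      by (rule is_motion_integral[OF y adm \<alpha> t \<psi>(1) _ \<tau>]) (rule \<psi>(2))
    ultimately have "norm (x \<tau> - y \<tau>) = norm (frac_int \<alpha> (\<lambda>s. ?D x s - ?D y s) \<tau>)"
      using frac_int_diff[OF meas \<alpha>(1)] \<tau> by simp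
    also have "\<dots> \<le> frac_int \<alpha> (\<lambda>s. norm (?D x s - ?D y s)) \<tau>"
      by (rule norm_frac_int_le[OF \<alpha>(1)])
    also have "\<dots> \<le> frac_int \<alpha> (\<lambda>s. L * norm (x s - y s)) \<tau>"
    proof (rule frac_int_mono[OF bounded_measurable_norm[OF bounded_measurable_diff[OF meas]] bounded_measurable_mult[OF measd] \<alpha>(1)])
      have "norm (?D x s - ?D y s) \<le> L * norm (x s - y s)" if "s \<in> {0..\<tau>}" for s
      proof (cases "s < t")
        case True
        then show ?thesis using L0 by simp
      next
        case False
        moreover have "norm (x s) \<le> max R1 R2" "norm (y s) \<le> max R1 R2"
          using R that \<tau> by (auto simp: le_max_iff_disj)
        ultimately show ?thesis using L that \<tau> by auto
      qed
      then show "AE s in lebesgue. s \<in> {0..\<tau>} \<longrightarrow> norm (?D x s - ?D y s) \<le> L * norm (x s - y s)"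
        by auto
    qed (use \<tau> in auto)
    finally show ?thesis by (simp add: frac_int_mult)
  qed
  note le = this
  obtain K where K: "\<forall>t m A. 0 \<le> t \<longrightarrow> t \<le> \<theta> \<longrightarrow> bounded_measurable t m \<longrightarrow> 0 \<le> A \<longrightarrow>
    (\<forall>\<tau>\<in>{0..t}. 0 \<le> m \<tau> \<and> m \<tau> \<le> A + L * frac_int \<alpha> m \<tau>) \<longrightarrow> (\<forall>\<tau>\<in>{0..t}. m \<tau> \<le> K * A)"
    using frac_gronwall[of \<alpha> \<theta> L] \<alpha> t L0 by auto
  have "norm (x \<tau> - y \<tau>) \<le> K * 0" if "\<tau> \<in> {0..\<theta>}" for \<tau>
    by (rule K[rule_format, of \<theta> "\<lambda>s. norm (x s - y s)"]) (use measd le t that in auto)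
  then have "x \<tau> = y \<tau>" if "\<tau> \<in> {0..\<theta>}" for \<tau> using that by simp
  moreover have "x \<in> extensional {0..\<theta>}" "y \<in> extensional {0..\<theta>}" using AC by (auto simp: AC_def)
  ultimately show ?thesis by (metis extensionalityI)
qed

text \<open>The constants depend on the field only through its growth rate, hence not on the control.\<close>

lemma is_motion_bounds:
  assumes \<alpha>: "0 < \<alpha>" "\<alpha> < 1" and t: "0 \<le> t" "t \<le> T" and w: "w \<in> AC \<alpha> t" and c: "c \<ge> 0"
  shows "\<exists>R M. R > 0 \<and> M \<ge> 0 \<and> (\<forall>F \<theta> x. t \<le> \<theta> \<longrightarrow> \<theta> \<le> T \<longrightarrow> admissible F t \<theta> \<longrightarrow>
    (\<forall>s\<in>{t..\<theta>}. \<forall>y. norm (F s y) \<le> (1 + norm y) * c) \<longrightarrow> is_motion \<alpha> F t w \<theta> x \<longrightarrow>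
    (\<forall>\<tau>\<in>{0..\<theta>}. norm (x \<tau>) \<le> R) \<and>
    (\<forall>a b. 0 \<le> a \<longrightarrow> a \<le> b \<longrightarrow> b \<le> \<theta> \<longrightarrow> norm (x b - x a) \<le> M * (b - a) powr \<alpha>))"
proof -
  obtain \<psi> where \<psi>: "bounded_measurable t \<psi>" "\<And>\<tau>. \<tau> \<in> {0..t} \<Longrightarrow> w \<tau> = w 0 + frac_int \<alpha> \<psi> \<tau>"
    using AC_density[OF w] by metis
  obtain C where C: "C > 0" "\<forall>s\<in>{0..t}. norm (\<psi> s) \<le> C" using bounded_measurable_bound[OF \<psi>(1)] by blast
  have G: "Gamma \<alpha> > 0" using \<alpha> by (simp add: Gamma_real_pos)
  obtain K where K: "K \<ge> 0" "\<forall>t m A. 0 \<le> t \<longrightarrow> t \<le> T \<longrightarrow> bounded_measurable t m \<longrightarrow> 0 \<le> A \<longrightarrow>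
    (\<forall>\<tau>\<in>{0..t}. 0 \<le> m \<tau> \<and> m \<tau> \<le> A + c * frac_int \<alpha> m \<tau>) \<longrightarrow> (\<forall>\<tau>\<in>{0..t}. m \<tau> \<le> K * A)"
    using frac_gronwall[of \<alpha> T c] \<alpha> t c by auto
  \<comment> \<open>\<open>C\<close> bounds the density of the past and
    \<open>(1 + norm y) * c\<close> the field, so \<open>(C + c) + c * norm (x s)\<close> bounds the
    density on both sides of \<open>t\<close>. \<open>A\<close> collects \<open>norm (w 0)\<close>
    and the fractional integral of the constant \<open>C + c\<close> up to \<open>T\<close>.\<close>
  define A where "A = norm (w 0) + (C + c) * (T powr \<alpha> / (\<alpha> * Gamma \<alpha>))"
  have A: "A \<ge> 0" using C c G \<alpha> by (simp add: A_def)
  define R where "R = K * A + 1"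
  have R: "R > 0" using K A by (simp add: R_def add_nonneg_pos)
  \<comment> \<open>The constant of \<open>frac_int_holder\<close> for a density bounded by
    \<open>C + (1 + R) * c\<close>. One density covers the whole interval, so increments across
    \<open>t\<close> need no separate case.\<close>
  define M where "M = (C + (1 + R) * c) * (2 / (\<alpha> * Gamma \<alpha>))"
  have M: "M \<ge> 0" using C R c G \<alpha> by (simp add: M_def)
  have "(\<forall>\<tau>\<in>{0..\<theta>}. norm (x \<tau>) \<le> R) \<and>
    (\<forall>a b. 0 \<le> a \<longrightarrow> a \<le> b \<longrightarrow> b \<le> \<theta> \<longrightarrow> norm (x b - x a) \<le> M * (b - a) powr \<alpha>)"
    if \<theta>: "t \<le> \<theta>" "\<theta> \<le> T" and adm: "admissible F t \<theta>"
      and gr: "\<forall>s\<in>{t..\<theta>}. \<forall>y. norm (F s y) \<le> (1 + norm y) * c" and x: "is_motion \<alpha> F t w \<theta> x" for F \<theta> x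
  proof -
    let ?D = "\<lambda>s. if s < t then \<psi> s else F s (x s)"
    have "x \<in> AC \<alpha> \<theta>" using x by (auto simp: is_motion_def)
    note cont = AC_continuous[OF this \<alpha>]
    note meas = bounded_measurable_motion_density[OF adm \<psi>(1) cont]
    note measn = bounded_measurable_norm[OF bounded_measurable_continuous[OF cont]]
    have xD: "x \<tau> = w 0 + frac_int \<alpha> ?D \<tau>" if \<tau>: "\<tau> \<in> {0..\<theta>}" for \<tau>
      by (rule is_motion_integral[OF x adm \<alpha> t(1) \<theta>(1) \<psi>(1) _ \<tau>]) (rule \<psi>(2))
    have D: "norm (?D s) \<le> (C + c) + c * norm (x s)" if "s \<in> {0..\<theta>}" for s
    proof (cases "s < t")
      case True
      then show ?thesis using C that c by (auto intro!: add_increasing2)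
    next
      case False
      then have "norm (?D s) \<le> (1 + norm (x s)) * c" using gr that by auto
      then show ?thesis using C by (simp add: algebra_simps)
    qed
    have "norm (x \<tau>) \<le> A + c * frac_int \<alpha> (\<lambda>s. norm (x s)) \<tau>" if \<tau>: "\<tau> \<in> {0..\<theta>}" for \<tau>
    proof -
      have "norm (x \<tau>) \<le> norm (w 0) + norm (frac_int \<alpha> ?D \<tau>)"
        using xD[OF \<tau>] norm_triangle_ineq by simp
      also have "norm (frac_int \<alpha> ?D \<tau>) \<le> frac_int \<alpha> (\<lambda>s. norm (?D s)) \<tau>"
        by (rule norm_frac_int_le[OF \<alpha>(1)])
      also have "\<dots> \<le> frac_int \<alpha> (\<lambda>s. (C + c) + c * norm (x s)) \<tau>"
        using \<tau> D by (intro frac_int_mono[OF bounded_measurable_norm[OF meas] bounded_measurable_add[OF bounded_measurable_const bounded_measurable_mult[OF measn]] \<alpha>(1)]) auto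
      also have "\<dots> = frac_int \<alpha> (\<lambda>s. C + c) \<tau> + c * frac_int \<alpha> (\<lambda>s. norm (x s)) \<tau>"
        using frac_int_add[OF bounded_measurable_const bounded_measurable_mult[OF measn] \<alpha>(1), of \<tau> "C + c" c] \<tau> by (simp add: frac_int_mult)
      also have "frac_int \<alpha> (\<lambda>s. C + c) \<tau> = (C + c) * (\<tau> powr \<alpha> / (\<alpha> * Gamma \<alpha>))"
        using \<tau> by (intro frac_int_const[OF \<alpha>(1)]) auto
      also have "\<dots> \<le> (C + c) * (T powr \<alpha> / (\<alpha> * Gamma \<alpha>))"
        using \<tau> \<theta> \<alpha> G C c by (intro mult_left_mono divide_right_mono powr_mono2) auto
      finally show ?thesis by (simp add: A_def)
    qed
    note le = this
    have "norm (x \<tau>) \<le> K * A" if "\<tau> \<in> {0..\<theta>}" for \<tau>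
      by (rule K(2)[rule_format, of \<theta> "\<lambda>s. norm (x s)"]) (use measn le t \<theta> A that in auto)
    then have xR: "norm (x \<tau>) \<le> R" if "\<tau> \<in> {0..\<theta>}" for \<tau>
      using that by (force simp: R_def)
    have DM: "norm (?D s) \<le> C + (1 + R) * c" if "s \<in> {0..\<theta>}" for s
      using D[OF that] mult_left_mono[OF xR[OF that] c] by (simp add: algebra_simps)
    have "norm (x b - x a) \<le> M * (b - a) powr \<alpha>" if ab: "0 \<le> a" "a \<le> b" "b \<le> \<theta>" for a b
      using frac_int_holder[OF meas DM \<alpha> ab] xD[of a] xD[of b] ab by (simp add: M_def)
    then show ?thesis using xR by blast
  qed
  then show ?thesis using R M by blast
qed

section \<open>The control system\<close>

locale control_system =
  fixes \<alpha> T :: real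
    and P :: "'c::euclidean_space set"
    and f :: "real \<Rightarrow> 'a::euclidean_space \<Rightarrow> 'c \<Rightarrow> 'a"
    and \<sigma> :: "'a \<Rightarrow> real"
    and chi :: "real \<Rightarrow> 'a \<Rightarrow> 'c \<Rightarrow> real"
  assumes T: "T > 0" and \<alpha>: "0 < \<alpha>" "\<alpha> < 1"
    and P: "compact P" "P \<noteq> {}"
    and f_cont: "continuous_on ({0..T} \<times> UNIV \<times> P) (\<lambda>(\<tau>, x, u). f \<tau> x u)"
    and f_Lipschitz: "\<forall>R>0. \<exists>L>0. \<forall>\<tau>\<in>{0..T}. \<forall>x x'. \<forall>u\<in>P. norm x \<le> R \<longrightarrow> norm x' \<le> R \<longrightarrow>
           norm (f \<tau> x u - f \<tau> x' u) \<le> L * norm (x - x')"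
    and f_growth: "\<exists>c>0. \<forall>\<tau>\<in>{0..T}. \<forall>x. \<forall>u\<in>P. norm (f \<tau> x u) \<le> (1 + norm x) * c"
    and \<sigma>_cont: "continuous_on UNIV \<sigma>"
    and chi_cont: "continuous_on ({0..T} \<times> UNIV \<times> P) (\<lambda>(\<tau>, x, u). chi \<tau> x u)"
begin

lemma controls_mem: "u \<in> controls P t \<theta> \<Longrightarrow> s \<in> {t..\<theta>} \<Longrightarrow> u s \<in> P"
  by (auto simp: controls_def)

text \<open>Serves the dynamics and the running cost at once. As \<open>g\<close> is continuous only
  on a product set, the curve of triples is made measurable into the restricted space; its values
  stay in the product of \<open>{0..T}\<close>, the compact range of \<open>x\<close>, and
  \<open>P\<close>.\<close>

lemma along_control:
  fixes g :: "real \<Rightarrow> 'a \<Rightarrow> 'c \<Rightarrow> 'b::euclidean_space"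
  assumes g: "continuous_on ({0..T} \<times> UNIV \<times> P) (\<lambda>(\<tau>, x, u). g \<tau> x u)"
    and x: "continuous_on {0..\<theta>} x" and u: "u \<in> controls P t \<theta>" and t: "0 \<le> t" "\<theta> \<le> T"
  shows along_control_measurable: "(\<lambda>s. g s (x s) (u s)) \<in> borel_measurable (lebesgue_on {t..\<theta>})" (is ?m)
    and along_control_bounded: "bounded ((\<lambda>s. g s (x s) (u s)) ` {t..\<theta>})" (is ?b)
proof -
  let ?A = "{0..T} \<times> (UNIV :: 'a set) \<times> P"
  let ?G = "\<lambda>(\<tau>, x, u). g \<tau> x u"
  have xm: "x \<in> borel_measurable (lebesgue_on {t..\<theta>})"
    using t by (intro continuous_imp_measurable_on_sets_lebesgue continuous_on_subset[OF x]) auto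
  have um: "u \<in> borel_measurable (lebesgue_on {t..\<theta>})" using u by (simp add: controls_def)
  have im: "(\<lambda>s. s) \<in> borel_measurable (lebesgue_on {t..\<theta>})"
    by (intro continuous_imp_measurable_on_sets_lebesgue continuous_intros) auto
  have "(\<lambda>s. (s, x s, u s)) \<in> borel_measurable (lebesgue_on {t..\<theta>})"
    by (intro borel_measurable_Pair im xm um)
  then have "(\<lambda>s. (s, x s, u s)) \<in> measurable (lebesgue_on {t..\<theta>}) (restrict_space borel ?A)"
    by (rule measurable_restrict_space2[rotated]) (use controls_mem[OF u] t in auto)
  from measurable_comp[OF this borel_measurable_continuous_on_restrict[OF g]] show ?m
    by (simp add: o_def)
  have "compact (?G ` ({0..T} \<times> x ` {0..\<theta>} \<times> P))"
    by (intro compact_continuous_image continuous_on_subset[OF g] compact_Times P x) auto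
  then have "bounded (?G ` ({0..T} \<times> x ` {0..\<theta>} \<times> P))" by (rule compact_imp_bounded)
  then show ?b
  proof (rule bounded_subset, intro image_subsetI)
    fix s assume "s \<in> {t..\<theta>}"
    then have "(s, x s, u s) \<in> {0..T} \<times> x ` {0..\<theta>} \<times> P"
      using controls_mem[OF u] t by auto
    then show "g s (x s) (u s) \<in> ?G ` ({0..T} \<times> x ` {0..\<theta>} \<times> P)"
      by (rule rev_image_eqI) simp
  qed
qed

lemma along_control_integrable:
  fixes g :: "real \<Rightarrow> 'a \<Rightarrow> 'c \<Rightarrow> 'b::euclidean_space"
  assumes g: "continuous_on ({0..T} \<times> UNIV \<times> P) (\<lambda>(\<tau>, x, u). g \<tau> x u)"
    and x: "continuous_on {0..\<theta>} x" and u: "u \<in> controls P t \<theta>" and t: "0 \<le> t" "\<theta> \<le> T"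
  shows "set_integrable lebesgue {t..\<theta>} (\<lambda>s. g s (x s) (u s))"
proof -
  have "bounded_measurable \<theta> (\<lambda>s. if s < t then 0 else g s (x s) (u s))"
    by (intro bounded_measurable_glue bounded_measurable_const along_control_measurable[OF assms] along_control_bounded[OF assms])
  from bounded_measurable_integrable[OF this t(1) order_refl]
  have "set_integrable lebesgue {t..\<theta>} (\<lambda>s. if s < t then 0 else g s (x s) (u s))" .
  then show ?thesis
    by (rule set_integrable_cong[THEN iffD1, rotated -1]) auto
qed

lemma admissible_control:
  assumes "u \<in> controls P t \<theta>" "0 \<le> t" "\<theta> \<le> T"
  shows "admissible (\<lambda>s y. f s y (u s)) t \<theta>"
  unfolding admissible_def
  using along_control_measurable[OF f_cont _ assms] along_control_bounded[OF f_cont _ assms] by blast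

section \<open>Existence, uniqueness and uniform bounds for controlled motions\<close>

abbreviation motions :: "real \<Rightarrow> (real \<Rightarrow> 'a) \<Rightarrow> real \<Rightarrow> (real \<Rightarrow> 'c) \<Rightarrow> (real \<Rightarrow> 'a) \<Rightarrow> bool" where
  "motions t w \<theta> u \<equiv> is_motion \<alpha> (\<lambda>s y. f s y (u s)) t w \<theta>"

lemma motions_unique:
  assumes "u \<in> controls P t \<theta>" "0 \<le> t" "t \<le> \<theta>" "\<theta> \<le> T" "w \<in> AC \<alpha> t" "motions t w \<theta> u x" "motions t w \<theta> u y"
  shows "x = y"
proof (rule is_motion_unique[OF admissible_control[OF assms(1,2,4)] \<alpha> assms(2,3,5) _ assms(6,7)])
  fix R :: real assume "R > 0"
  then obtain L where "L > 0" "\<forall>\<tau>\<in>{0..T}. \<forall>x x'. \<forall>u\<in>P. norm x \<le> R \<longrightarrow> norm x' \<le> R \<longrightarrow>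
           norm (f \<tau> x u - f \<tau> x' u) \<le> L * norm (x - x')" using f_Lipschitz by blast
  then show "\<exists>L\<ge>0. \<forall>s\<in>{t..\<theta>}. \<forall>y y'. norm y \<le> R \<longrightarrow> norm y' \<le> R \<longrightarrow>
      norm (f s y (u s) - f s y' (u s)) \<le> L * norm (y - y')"
    using controls_mem[OF assms(1)] assms by (intro exI[of _ L]) auto
qed

text \<open>The field is only locally Lipschitz, so its argument is projected to the ball of radius
  \<open>R\<close>, which makes it globally Lipschitz. The projection does not increase norms, so
  the growth constant \<open>c\<close> survives. The a priori bound \<open>R\<close>, fixed
  beforehand for all fields with that growth, then keeps the motion in the ball, where the
  projection is the identity.\<close>

lemma motions_exist:
  assumes u: "u \<in> controls P t \<theta>" and t: "0 \<le> t" "t \<le> \<theta>" "\<theta> \<le> T" and w: "w \<in> AC \<alpha> t"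
  shows "\<exists>x. motions t w \<theta> u x"
proof -
  obtain c where c: "c > 0" "\<forall>\<tau>\<in>{0..T}. \<forall>x. \<forall>u\<in>P. norm (f \<tau> x u) \<le> (1 + norm x) * c"
    using f_growth by blast
  obtain R M where R: "R > 0" and bound: "\<forall>F \<theta> x. t \<le> \<theta> \<longrightarrow> \<theta> \<le> T \<longrightarrow> admissible F t \<theta> \<longrightarrow>
    (\<forall>s\<in>{t..\<theta>}. \<forall>y. norm (F s y) \<le> (1 + norm y) * c) \<longrightarrow> is_motion \<alpha> F t w \<theta> x \<longrightarrow>
    (\<forall>\<tau>\<in>{0..\<theta>}. norm (x \<tau>) \<le> R) \<and>
    (\<forall>a b. 0 \<le> a \<longrightarrow> a \<le> b \<longrightarrow> b \<le> \<theta> \<longrightarrow> norm (x b - x a) \<le> M * (b - a) powr \<alpha>)"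
    using is_motion_bounds[OF \<alpha> t(1) order_trans[OF t(2,3)] w less_imp_le[OF c(1)]] by blast
  define p where "p = closest_point (cball (0::'a) R)"
  have pL: "norm (p y - p y') \<le> norm (y - y')" for y y'
    using closest_point_lipschitz[of "cball (0::'a) R" y y'] R by (auto simp: p_def dist_norm)
  have pR: "norm (p y) \<le> R" for y
    using closest_point_in_set[of "cball (0::'a) R" y] R by (simp add: p_def)
  have pid: "p y = y" if "norm y \<le> R" for y
    using closest_point_self[of y "cball 0 R"] that by (simp add: p_def)
  have pn: "norm (p y) \<le> norm y" for y
    using pL[of y 0] pid[of 0] R by simp
  have pc: "continuous_on S p" for S
    unfolding p_def using R by (intro continuous_on_closest_point) auto
  define F where "F = (\<lambda>s y. f s (p y) (u s))"
  have adm: "admissible F t \<theta>" unfolding admissible_def F_def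
  proof (intro allI impI)
    fix x :: "real \<Rightarrow> 'a" assume "continuous_on {0..\<theta>} x"
    then have "continuous_on {0..\<theta>} (\<lambda>s. p (x s))"
      using continuous_on_compose2[OF pc[of UNIV]] by blast
    from along_control[OF f_cont this u t(1,3)]
    show "(\<lambda>s. f s (p (x s)) (u s)) \<in> borel_measurable (lebesgue_on {t..\<theta>}) \<and>
      bounded ((\<lambda>s. f s (p (x s)) (u s)) ` {t..\<theta>})" by simp
  qed
  obtain L where L: "L > 0" "\<forall>\<tau>\<in>{0..T}. \<forall>x x'. \<forall>u\<in>P. norm x \<le> R \<longrightarrow> norm x' \<le> R \<longrightarrow>
           norm (f \<tau> x u - f \<tau> x' u) \<le> L * norm (x - x')" using f_Lipschitz R by blast
  have "\<exists>x. is_motion \<alpha> F t w \<theta> x"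
  proof (rule is_motion_exists_Lipschitz[OF adm \<alpha> t(1,2) w])
    show "0 \<le> L" using L by simp
    fix s y y' assume s: "s \<in> {t..\<theta>}"
    then have "norm (F s y - F s y') \<le> L * norm (p y - p y')"
      unfolding F_def using L(2) controls_mem[OF u] pR t by auto
    also have "\<dots> \<le> L * norm (y - y')" using L(1) pL by (intro mult_left_mono) auto
    finally show "norm (F s y - F s y') \<le> L * norm (y - y')" .
  qed
  then obtain x where x: "is_motion \<alpha> F t w \<theta> x" by blast
  have "norm (F s y) \<le> (1 + norm y) * c" if "s \<in> {t..\<theta>}" for s y
  proof -
    have "norm (F s y) \<le> (1 + norm (p y)) * c"
      unfolding F_def using c(2) controls_mem[OF u] that t by auto
    also have "\<dots> \<le> (1 + norm y) * c" using pn c(1) by (intro mult_right_mono) auto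
    finally show ?thesis .
  qed
  then have "\<forall>\<tau>\<in>{0..\<theta>}. norm (x \<tau>) \<le> R" using bound adm x t by blast
  then have "F s (x s) = f s (x s) (u s)" if "s \<in> {t..\<theta>}" for s
    using that t pid by (auto simp: F_def)
  then have "motions t w \<theta> u x"
    using x unfolding is_motion_def
    by (auto simp: AE_lebesgue_on_iff elim!: eventually_mono)
  then show ?thesis by blast
qed

lemma motion_eqI:
  assumes "u \<in> controls P t \<theta>" "0 \<le> t" "t \<le> \<theta>" "\<theta> \<le> T" "w \<in> AC \<alpha> t" "motions t w \<theta> u x"
  shows "motion \<alpha> f t w \<theta> u = x"
  unfolding motion_def
proof (rule the_equality)
  show "x \<in> AC \<alpha> \<theta> \<and> (\<forall>\<tau>\<in>{0..t}. x \<tau> = w \<tau>) \<and>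
     (AE \<tau> in lebesgue_on {t..\<theta>}. has_caputo_derivative \<alpha> x (f \<tau> (x \<tau>) (u \<tau>)) \<tau>)"
    using assms(6) by (simp add: is_motion_def)
  show "y = x" if "y \<in> AC \<alpha> \<theta> \<and> (\<forall>\<tau>\<in>{0..t}. y \<tau> = w \<tau>) \<and>
     (AE \<tau> in lebesgue_on {t..\<theta>}. has_caputo_derivative \<alpha> y (f \<tau> (y \<tau>) (u \<tau>)) \<tau>)" for y
    using motions_unique[OF assms(1-5) _ assms(6), of y] that by (simp add: is_motion_def)
qed

lemma motion_is_motion:
  assumes "u \<in> controls P t \<theta>" "0 \<le> t" "t \<le> \<theta>" "\<theta> \<le> T" "w \<in> AC \<alpha> t"
  shows "motions t w \<theta> u (motion \<alpha> f t w \<theta> u)"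
  using motions_exist[OF assms] motion_eqI[OF assms] by metis

lemma motion_bounds:
  assumes "0 \<le> t" "t \<le> T" "w \<in> AC \<alpha> t"
  shows "\<exists>R M. R > 0 \<and> M \<ge> 0 \<and> (\<forall>u\<in>controls P t T.
    (\<forall>\<tau>\<in>{0..T}. norm (motion \<alpha> f t w T u \<tau>) \<le> R) \<and>
    (\<forall>a b. 0 \<le> a \<longrightarrow> a \<le> b \<longrightarrow> b \<le> T \<longrightarrow>
       norm (motion \<alpha> f t w T u b - motion \<alpha> f t w T u a) \<le> M * (b - a) powr \<alpha>))"
proof -
  obtain c where c: "c > 0" "\<forall>\<tau>\<in>{0..T}. \<forall>x. \<forall>u\<in>P. norm (f \<tau> x u) \<le> (1 + norm x) * c"
    using f_growth by blast
  obtain R M where RM: "R > 0" "M \<ge> 0" and bound: "\<forall>F \<theta> x. t \<le> \<theta> \<longrightarrow> \<theta> \<le> T \<longrightarrow> admissible F t \<theta> \<longrightarrow>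
    (\<forall>s\<in>{t..\<theta>}. \<forall>y. norm (F s y) \<le> (1 + norm y) * c) \<longrightarrow> is_motion \<alpha> F t w \<theta> x \<longrightarrow>
    (\<forall>\<tau>\<in>{0..\<theta>}. norm (x \<tau>) \<le> R) \<and>
    (\<forall>a b. 0 \<le> a \<longrightarrow> a \<le> b \<longrightarrow> b \<le> \<theta> \<longrightarrow> norm (x b - x a) \<le> M * (b - a) powr \<alpha>)"
    using is_motion_bounds[OF \<alpha> assms less_imp_le[OF c(1)]] by blast
  have "(\<forall>\<tau>\<in>{0..T}. norm (motion \<alpha> f t w T u \<tau>) \<le> R) \<and>
    (\<forall>a b. 0 \<le> a \<longrightarrow> a \<le> b \<longrightarrow> b \<le> T \<longrightarrow>
       norm (motion \<alpha> f t w T u b - motion \<alpha> f t w T u a) \<le> M * (b - a) powr \<alpha>)"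
    if u: "u \<in> controls P t T" for u
  proof (rule bound[rule_format, of T "\<lambda>s y. f s y (u s)"])
    show "admissible (\<lambda>s y. f s y (u s)) t T" by (rule admissible_control[OF u assms(1) order_refl])
    show "motions t w T u (motion \<alpha> f t w T u)"
      by (rule motion_is_motion[OF u assms(1,2) order_refl assms(3)])
    show "norm (f s y (u s)) \<le> (1 + norm y) * c" if "s \<in> {t..T}" for s y
      using c(2) controls_mem[OF u that] that assms by auto
  qed (use assms in auto)
  then show ?thesis using RM by blast
qed

text \<open>The position at time \<open>s\<close> carries the entire past, so the motion restarted
  from it has the right memory. Before \<open>s\<close> its equation is inherited from
  \<open>x\<close> by \<open>has_caputo_derivative_transform\<close>; from \<open>s\<close> on it is
  the equation of the restarted motion.\<close>

lemma motion_concat: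
  assumes u: "u \<in> controls P t T" and v: "v \<in> controls P s T" and t: "0 \<le> t" "t \<le> s" "s \<le> T" and w: "w \<in> AC \<alpha> t"
  defines "x \<equiv> motion \<alpha> f t w T u"
  defines "uv \<equiv> \<lambda>r\<in>{t..T}. if r < s then u r else v r"
  shows "uv \<in> controls P t T" "restrict x {0..s} \<in> AC \<alpha> s"
    "motion \<alpha> f t w T uv = motion \<alpha> f s (restrict x {0..s}) T v"
proof -
  have m: "motions t w T u x" unfolding x_def using t by (intro motion_is_motion[OF u _ _ _ w]) auto
  have um: "u \<in> borel_measurable (lebesgue_on {t..T})" and vm: "v \<in> borel_measurable (lebesgue_on {s..T})"
    using u v by (simp_all add: controls_def)
  show uv: "uv \<in> controls P t T"
    unfolding controls_def
  proof safe
    show "uv r \<in> P" if "r \<in> {t..T}" for r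
      using that controls_mem[OF u] controls_mem[OF v] by (auto simp: uv_def)
    have "u \<in> borel_measurable (lebesgue_on {t..<s})"
      by (rule measurable_restrict_mono[OF um]) (use t in auto)
    then have 1: "(\<lambda>r. if r \<in> {t..<s} then u r else 0) \<in> borel_measurable lebesgue"
      by (rule borel_measurable_if_I) simp
    have 2: "(\<lambda>r. if r \<in> {s..T} then v r else 0) \<in> borel_measurable lebesgue"
      using vm by (rule borel_measurable_if_I) simp
    have "(\<lambda>r. (if r \<in> {t..<s} then u r else 0) + (if r \<in> {s..T} then v r else 0)) \<in> borel_measurable (lebesgue_on {t..T})"
      by (rule measurable_restrict_space1[OF borel_measurable_add[OF 1 2]])
    then show "uv \<in> borel_measurable (lebesgue_on {t..T})"
      by (rule measurable_cong[THEN iffD1, rotated]) (use t in \<open>auto simp: uv_def\<close>)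
  qed (auto simp: uv_def)
  have xAC: "x \<in> AC \<alpha> T" using m by (simp add: is_motion_def)
  then show y: "restrict x {0..s} \<in> AC \<alpha> s" by (rule AC_restrict) (use t in auto)
  let ?z = "motion \<alpha> f s (restrict x {0..s}) T v"
  have z: "motions s (restrict x {0..s}) T v ?z"
    using t by (intro motion_is_motion[OF v _ _ _ y]) auto
  have zx: "?z r = x r" if "r \<in> {0..s}" for r
    using z that unfolding is_motion_def by auto
  have "motions t w T uv ?z"
    unfolding is_motion_def
  proof (intro conjI ballI)
    show "?z \<in> AC \<alpha> T" using z by (simp add: is_motion_def)
    show "?z r = w r" if "r \<in> {0..t}" for r
      using m zx[of r] that t unfolding is_motion_def by auto
    have "AE r in lebesgue. r \<in> {t..T} \<longrightarrow> has_caputo_derivative \<alpha> x (f r (x r) (u r)) r"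
      "AE r in lebesgue. r \<in> {s..T} \<longrightarrow> has_caputo_derivative \<alpha> ?z (f r (?z r) (v r)) r"
      using m z by (simp_all add: is_motion_def AE_lebesgue_on_iff)
    moreover have "AE r in lebesgue. r \<noteq> 0"
      using AE_completion[OF AE_lborel_singleton[of 0]] by simp
    ultimately have "AE r in lebesgue. r \<in> {t..T} \<longrightarrow> has_caputo_derivative \<alpha> ?z (f r (?z r) (uv r)) r"
    proof eventually_elim
      case (elim r)
      show ?case
      proof
        assume r: "r \<in> {t..T}"
        show "has_caputo_derivative \<alpha> ?z (f r (?z r) (uv r)) r"
        proof (cases "r < s")
          case True
          have "has_caputo_derivative \<alpha> ?z (f r (x r) (u r)) r"
            by (rule has_caputo_derivative_transform[of _ x _ _ s]) (use elim r t True zx in auto)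
          then show ?thesis using True r t zx[of r] by (auto simp: uv_def)
        next
          case False
          then show ?thesis using elim(2) r by (auto simp: uv_def)
        qed
      qed
    qed
    then show "AE r in lebesgue_on {t..T}. has_caputo_derivative \<alpha> ?z (f r (?z r) (uv r)) r"
      by (simp add: AE_lebesgue_on_iff)
  qed
  then show "motion \<alpha> f t w T uv = ?z"
    using t by (intro motion_eqI[OF uv _ _ _ w]) auto
qed

lemma controls_restrict:
  assumes "u \<in> controls P t T" "t \<le> s"
  shows "restrict u {s..T} \<in> controls P s T"
proof -
  have um: "u \<in> borel_measurable (lebesgue_on {t..T})" using assms by (simp add: controls_def)
  have "u \<in> borel_measurable (lebesgue_on {s..T})"
    by (rule measurable_restrict_mono[OF um]) (use assms in auto)
  then have "restrict u {s..T} \<in> borel_measurable (lebesgue_on {s..T})"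
    by (rule measurable_cong[THEN iffD1, rotated]) auto
  then show ?thesis using assms by (auto simp: controls_def)
qed

text \<open>Pasting \<open>u\<close> with its own tail returns \<open>u\<close>, so this is a
  special case of \<open>motion_concat\<close>.\<close>

lemma motion_restrict:
  assumes u: "u \<in> controls P t T" and t: "0 \<le> t" "t \<le> s" "s \<le> T" and w: "w \<in> AC \<alpha> t"
  defines "x \<equiv> motion \<alpha> f t w T u"
  shows "motion \<alpha> f s (restrict x {0..s}) T (restrict u {s..T}) = x"
proof -
  let ?uv = "\<lambda>r\<in>{t..T}. if r < s then u r else restrict u {s..T} r"
  have "?uv r = u r" for r
    using u t by (cases "r \<in> {t..T}") (auto simp: controls_def PiE_def extensional_def)
  then have "?uv = u" by blast
  then show ?thesis
    using motion_concat(3)[OF u controls_restrict[OF u t(2)] t w] by (simp add: x_def)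
qed

end

section \<open>Coinvariant derivatives\<close>

text \<open>By continuity of \<open>g\<close> there is a last time \<open>m\<close> with
  \<open>g a + k * (m - a) \<le> g m\<close>, and a local increment from \<open>m < b\<close> would
  lead past it. The steps may be arbitrarily short, which suits expansions whose remainder is not
  uniform in \<open>\<tau>\<close>.\<close>

lemma increment_ge_of_local_increments:
  fixes g :: "real \<Rightarrow> real"
  assumes ab: "a \<le> b" and g: "continuous_on {a..b} g"
    and loc: "\<And>\<tau>. \<tau> \<in> {a..<b} \<Longrightarrow> \<exists>\<tau>'\<in>{\<tau><..b}. k * (\<tau>' - \<tau>) \<le> g \<tau>' - g \<tau>"
  shows "k * (b - a) \<le> g b - g a"
proof -
  let ?S = "{s \<in> {a..b}. g a + k * (s - a) \<le> g s}"
  have "closed ?S"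
    by (intro continuous_on_closed_Collect_le continuous_intros g)
  then have "compact ({a..b} \<inter> ?S)" by (intro compact_Int_closed) auto
  moreover have "{a..b} \<inter> ?S = ?S" by auto
  ultimately have "compact ?S" by simp
  moreover have "a \<in> ?S" using ab by simp
  ultimately obtain m where m: "m \<in> ?S" "\<forall>s\<in>?S. s \<le> m"
    using compact_attains_sup[of ?S] by blast
  have "m = b"
  proof (rule ccontr)
    assume "m \<noteq> b"
    then obtain \<tau>' where \<tau>': "\<tau>' \<in> {m<..b}" "k * (\<tau>' - m) \<le> g \<tau>' - g m"
      using loc[of m] m(1) by auto
    then have "\<tau>' \<in> ?S" using m(1) by (auto simp: algebra_simps)
    then show False using m(2) \<tau>' by auto
  qed
  then show ?thesis using m(1) by simp
qed

section \<open>Estimates for the Hausdorff distance between graphs\<close>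

lemma pos_dist_star_le:
  assumes t: "0 \<le> t" "0 \<le> t'"
    and B: "\<And>\<tau>. \<tau> \<in> {0..t} \<Longrightarrow> \<exists>\<tau>'\<in>{0..t'}. \<bar>\<tau> - \<tau>'\<bar> + norm (w \<tau> - w' \<tau>') \<le> B"
  shows "pos_dist_star (t, w) (t', w') \<le> B"
  unfolding pos_dist_star_def prod.case
proof (rule cSUP_least)
  show "{0..t} \<noteq> {}" using t by simp
  fix \<tau> assume "\<tau> \<in> {0..t}"
  then obtain \<tau>' where \<tau>': "\<tau>' \<in> {0..t'}" "\<bar>\<tau> - \<tau>'\<bar> + norm (w \<tau> - w' \<tau>') \<le> B" using B by blast
  have "(INF \<tau>'\<in>{0..t'}. sqrt (\<bar>\<tau> - \<tau>'\<bar>\<^sup>2 + (norm (w \<tau> - w' \<tau>'))\<^sup>2)) \<le> sqrt (\<bar>\<tau> - \<tau>'\<bar>\<^sup>2 + (norm (w \<tau> - w' \<tau>'))\<^sup>2)"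
    by (rule cINF_lower[OF _ \<tau>'(1)]) (auto intro!: bdd_belowI2[where m=0])
  also have "\<dots> \<le> \<bar>\<tau> - \<tau>'\<bar> + norm (w \<tau> - w' \<tau>')"
    by (rule sqrt_sum_squares_le_sum) auto
  finally show "(INF \<tau>'\<in>{0..t'}. sqrt (\<bar>\<tau> - \<tau>'\<bar>\<^sup>2 + (norm (w \<tau> - w' \<tau>'))\<^sup>2)) \<le> B"
    using \<tau>'(2) by linarith
qed

lemma pos_dist_commute: "pos_dist p q = pos_dist q p"
  by (simp add: pos_dist_def max.commute)

text \<open>Up to \<open>s\<close> the two graphs coincide, and every later point is matched with
  the end point at time \<open>s\<close>.\<close>

lemma pos_dist_restrict_le:
  assumes s: "0 \<le> s" "s \<le> \<tau>" and e: "\<And>r. r \<in> {s..\<tau>} \<Longrightarrow> norm (x r - x s) \<le> e"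
  shows "pos_dist (\<tau>, restrict x {0..\<tau>}) (s, restrict x {0..s}) \<le> (\<tau> - s) + e"
proof -
  have e0: "e \<ge> 0" using e[of s] s by simp
  have "pos_dist_star (\<tau>, restrict x {0..\<tau>}) (s, restrict x {0..s}) \<le> (\<tau> - s) + e"
  proof (rule pos_dist_star_le)
    fix r assume r: "r \<in> {0..\<tau>}"
    show "\<exists>r'\<in>{0..s}. \<bar>r - r'\<bar> + norm (restrict x {0..\<tau>} r - restrict x {0..s} r') \<le> (\<tau> - s) + e"
    proof (cases "r \<le> s")
      case True
      then show ?thesis using r s e0 by (intro bexI[of _ r]) auto
    next
      case False
      then show ?thesis using r s e[of r] by (intro bexI[of _ s]) auto
    qed
  qed (use s in auto)
  moreover have "pos_dist_star (s, restrict x {0..s}) (\<tau>, restrict x {0..\<tau>}) \<le> (\<tau> - s) + e"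
  proof (rule pos_dist_star_le)
    fix r assume "r \<in> {0..s}"
    then show "\<exists>r'\<in>{0..\<tau>}. \<bar>r - r'\<bar> + norm (restrict x {0..s} r - restrict x {0..\<tau>} r') \<le> (\<tau> - s) + e"
      using s e0 by (intro bexI[of _ r]) auto
  qed (use s in auto)
  ultimately show ?thesis by (simp add: pos_dist_def)
qed

text \<open>The difference of fractional integrals in \<open>has_ci_derivative\<close> is the
  integral of a density of \<open>x\<close>. That density is the Caputo derivative almost everywhere
  and may be replaced by any version \<open>h\<close>; in applications \<open>h\<close> is the field
  along a motion.\<close>

lemma caputo_integral_increment:
  assumes x: "x \<in> AC \<alpha> T" and \<alpha>: "0 < \<alpha>" "\<alpha> < 1" and t: "0 \<le> t" "t \<le> \<tau>" "\<tau> \<le> T"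
    and w: "\<And>s. s \<in> {0..t} \<Longrightarrow> x s = w s"
    and h: "AE s in lebesgue_on {t..T}. has_caputo_derivative \<alpha> x (h s) s"
  shows "frac_int (1 - \<alpha>) (\<lambda>\<xi>. x \<xi> - x 0) \<tau> - frac_int (1 - \<alpha>) (\<lambda>\<xi>. w \<xi> - w 0) t = integral {t..\<tau>} h"
proof -
  obtain \<phi> where \<phi>: "bounded_measurable T \<phi>" "\<And>s. s \<in> {0..T} \<Longrightarrow> x s = x 0 + frac_int \<alpha> \<phi> s"
    using AC_density[OF x] by metis
  have 1: "frac_int (1 - \<alpha>) (\<lambda>\<xi>. x \<xi> - x 0) s = integral {0..s} \<phi>" if "s \<in> {0..T}" for s
    by (rule caputo_integral[OF \<phi>(1) _ \<alpha> that]) (rule \<phi>(2))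
  have 2: "frac_int (1 - \<alpha>) (\<lambda>\<xi>. w \<xi> - w 0) t = frac_int (1 - \<alpha>) (\<lambda>\<xi>. x \<xi> - x 0) t"
    using w t by (intro frac_int_cong) auto
  have ae: "AE s in lebesgue. s \<in> {0<..<T} \<longrightarrow> has_caputo_derivative \<alpha> x (\<phi> s) s"
    by (rule AE_has_caputo_derivative[OF \<phi>(1) _ \<alpha>]) (rule \<phi>(2))
  have "AE s in lebesgue. s \<noteq> 0" "AE s in lebesgue. s \<noteq> T"
    using AE_completion[OF AE_lborel_singleton[of 0]] AE_completion[OF AE_lborel_singleton[of T]] by auto
  then have "AE s in lebesgue. s \<in> {t..T} \<longrightarrow> \<phi> s = h s"
    using ae h[unfolded AE_lebesgue_on_iff[OF lmeasurable_interval(1)[of t T, THEN fmeasurableD]]]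
  proof eventually_elim
    case (elim s)
    then show ?case using has_caputo_derivative_unique[of \<alpha> x "\<phi> s" s "h s"] t by auto
  qed
  then obtain N where N: "negligible N" "{s. \<not> (s \<in> {t..T} \<longrightarrow> \<phi> s = h s)} \<subseteq> N"
    unfolding eventually_ae_filter by (auto simp: negligible_iff_null_sets)
  have "integral {0..t} \<phi> + integral {t..\<tau>} \<phi> = integral {0..\<tau>} \<phi>"
    using t set_lebesgue_integral_eq_integral(1)[OF bounded_measurable_integrable[OF \<phi>(1) order_refl t(3)]]
    by (intro Henstock_Kurzweil_Integration.integral_combine) auto
  moreover have "integral {t..\<tau>} \<phi> = integral {t..\<tau>} h"
    by (rule integral_spike[OF N(1)]) (use N(2) t in auto)
  ultimately show ?thesis using 1[of t] 1[of \<tau>] 2 t by (simp add: algebra_simps)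
qed

lemma has_ci_derivative_expansion:
  assumes d: "has_ci_derivative \<alpha> T \<phi> a v (t, w)" and x: "x \<in> AC \<alpha> T" and \<alpha>: "0 < \<alpha>" "\<alpha> < 1"
    and t: "0 \<le> t" "t < T" and w: "\<forall>s\<in>{0..t}. x s = w s"
    and h: "AE s in lebesgue_on {t..T}. has_caputo_derivative \<alpha> x (h s) s" and e: "e > 0"
  shows "\<forall>\<^sub>F \<tau> in at_right t. \<tau> \<in> {t<..<T} \<and>
    \<bar>\<phi> (\<tau>, restrict x {0..\<tau>}) - \<phi> (t, w) - (a * (\<tau> - t) + v \<bullet> integral {t..\<tau>} h)\<bar> \<le> e * (\<tau> - t)"
proof -
  have "x \<in> extensions \<alpha> T (t, w)" using x w by (simp add: extensions_def)
  then have "((\<lambda>\<tau>. (\<phi> (\<tau>, restrict x {0..\<tau>}) - \<phi> (t, w) - a * (\<tau> - t)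
            - v \<bullet> (frac_int (1 - \<alpha>) (\<lambda>\<xi>. x \<xi> - x 0) \<tau> - frac_int (1 - \<alpha>) (\<lambda>\<xi>. w \<xi> - w 0) t))
           / (\<tau> - t)) \<longlongrightarrow> 0) (at_right t)"
    using d by (simp add: has_ci_derivative_def)
  from tendstoD[OF this e]
  have "\<forall>\<^sub>F \<tau> in at_right t. \<bar>(\<phi> (\<tau>, restrict x {0..\<tau>}) - \<phi> (t, w) - a * (\<tau> - t)
            - v \<bullet> (frac_int (1 - \<alpha>) (\<lambda>\<xi>. x \<xi> - x 0) \<tau> - frac_int (1 - \<alpha>) (\<lambda>\<xi>. w \<xi> - w 0) t))
           / (\<tau> - t)\<bar> < e" by simp
  moreover have "\<forall>\<^sub>F \<tau> in at_right t. \<tau> \<in> {t<..<T}"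
    using t(2) by (rule eventually_at_right_real)
  ultimately show ?thesis
  proof eventually_elim
    case (elim \<tau>)
    have "frac_int (1 - \<alpha>) (\<lambda>\<xi>. x \<xi> - x 0) \<tau> - frac_int (1 - \<alpha>) (\<lambda>\<xi>. w \<xi> - w 0) t = integral {t..\<tau>} h"
      using elim(2) t w by (intro caputo_integral_increment[OF x \<alpha> _ _ _ _ h]) auto
    then show ?case using elim by (auto simp: abs_divide divide_less_eq algebra_simps)
  qed
qed

text \<open>A motion with constant Caputo derivative \<open>y\<close> after \<open>t\<close> makes
  the first-order term \<open>a + v \<bullet> y\<close> times the elapsed time, so this number is
  determined for each \<open>y\<close>. The choices \<open>y = 0\<close> and
  \<open>y = v - v'\<close> then separate the two coefficients.\<close>

lemma has_ci_derivative_unique: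
  fixes \<phi> :: "'a::euclidean_space position \<Rightarrow> real"
  assumes d: "has_ci_derivative \<alpha> T \<phi> a v (t, w)" "has_ci_derivative \<alpha> T \<phi> a' v' (t, w)"
    and \<alpha>: "0 < \<alpha>" "\<alpha> < 1" and tw: "(t, w) \<in> positions0 \<alpha> T"
  shows "a = a'" "v = v'"
proof -
  have t: "0 \<le> t" "t < T" and w: "w \<in> AC \<alpha> t" using tw by (auto simp: positions0_def positions_def)
  have "a + v \<bullet> y = a' + v' \<bullet> y" for y
  proof (rule ccontr)
    assume ne: "a + v \<bullet> y \<noteq> a' + v' \<bullet> y"
    \<comment> \<open>A third of the gap: the two expansion errors add up to \<open>2 * e\<close>
      per unit of time, short of the gap \<open>3 * e\<close>.\<close>
    define e where "e = \<bar>(a + v \<bullet> y) - (a' + v' \<bullet> y)\<bar> / 3"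
    have e: "e > 0" using ne by (simp add: e_def)
    have "admissible (\<lambda>_ _. y) t T" by (auto simp: admissible_def intro!: boundedI[where B="norm y"])
    from is_motion_exists_Lipschitz[OF this \<alpha> t(1) less_imp_le[OF t(2)] w, of 0]
    obtain x where x: "is_motion \<alpha> (\<lambda>_ _. y) t w T x" by auto
    then have x1: "x \<in> AC \<alpha> T" and x2: "\<forall>s\<in>{0..t}. x s = w s"
      and x3: "AE s in lebesgue_on {t..T}. has_caputo_derivative \<alpha> x y s"
      by (auto simp: is_motion_def)
    have "\<forall>\<^sub>F \<tau> in at_right t. False"
      using has_ci_derivative_expansion[OF d(1) x1 \<alpha> t x2 x3 e] has_ci_derivative_expansion[OF d(2) x1 \<alpha> t x2 x3 e]
    proof eventually_elim
      case (elim \<tau>)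
      let ?D = "\<phi> (\<tau>, restrict x {0..\<tau>}) - \<phi> (t, w)"
      have I: "integral {t..\<tau>} (\<lambda>_. y) = (\<tau> - t) *\<^sub>R y" using elim by simp
      have "\<bar>?D - (a + v \<bullet> y) * (\<tau> - t)\<bar> \<le> e * (\<tau> - t)" "\<bar>?D - (a' + v' \<bullet> y) * (\<tau> - t)\<bar> \<le> e * (\<tau> - t)"
        using elim unfolding I by (simp_all add: algebra_simps)
      then have "\<bar>(a + v \<bullet> y) * (\<tau> - t) - (a' + v' \<bullet> y) * (\<tau> - t)\<bar> \<le> 2 * (e * (\<tau> - t))" by linarith
      also have "(a + v \<bullet> y) * (\<tau> - t) - (a' + v' \<bullet> y) * (\<tau> - t) = ((a + v \<bullet> y) - (a' + v' \<bullet> y)) * (\<tau> - t)"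
        by (simp add: algebra_simps)
      also have "\<bar>\<dots>\<bar> = 3 * e * (\<tau> - t)" using elim by (simp add: abs_mult e_def)
      finally show False using e elim by (simp add: mult_le_0_iff)
    qed
    then show False by simp
  qed
  note eq = this
  show "a = a'" using eq[of 0] by simp
  then have "(v - v') \<bullet> (v - v') = 0" using eq[of "v - v'"] by (simp add: inner_diff_left)
  then show "v = v'" by simp
qed

lemma has_ci_derivative_ci_dt_ci_grad:
  assumes "ci_differentiable \<alpha> T \<phi> (t, w)" "0 < \<alpha>" "\<alpha> < 1" "(t, w) \<in> positions0 \<alpha> T"
  shows "has_ci_derivative \<alpha> T \<phi> (ci_dt \<alpha> T \<phi> (t, w)) (ci_grad \<alpha> T \<phi> (t, w)) (t, w)"
proof -
  obtain a v where d: "has_ci_derivative \<alpha> T \<phi> a v (t, w)" using assms(1) unfolding ci_differentiable_def by blast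
  note u = has_ci_derivative_unique[OF _ d assms(2-4)]
  have "ci_dt \<alpha> T \<phi> (t, w) = a" unfolding ci_dt_def using d u(1) by blast
  moreover have "ci_grad \<alpha> T \<phi> (t, w) = v" unfolding ci_grad_def using d u(2) by blast
  ultimately show ?thesis using d by simp
qed

section \<open>Dynamic programming and the Hamilton-Jacobi-Bellman equation\<close>

context control_system
begin

section \<open>Costs and the two halves of the dynamic programming principle\<close>

abbreviation J :: "real \<Rightarrow> (real \<Rightarrow> 'a) \<Rightarrow> (real \<Rightarrow> 'c) \<Rightarrow> real" where
  "J \<equiv> cost \<alpha> T f \<sigma> chi"

abbreviation V :: "'a position \<Rightarrow> real" where
  "V \<equiv> value_functional \<alpha> T P f \<sigma> chi"

lemma const_control: "v \<in> P \<Longrightarrow> (\<lambda>_\<in>{t..\<theta>}. v) \<in> controls P t \<theta>"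
proof -
  assume v: "v \<in> P"
  have "(\<lambda>_. v) \<in> borel_measurable (lebesgue_on {t..\<theta>})" by simp
  then have "(\<lambda>_\<in>{t..\<theta>}. v) \<in> borel_measurable (lebesgue_on {t..\<theta>})"
    by (rule measurable_cong[THEN iffD1, rotated]) auto
  then show ?thesis using v by (auto simp: controls_def)
qed

lemma controls_nonempty: "controls P t \<theta> \<noteq> {}"
  using const_control P(2) by blast

lemma motion_in_AC:
  assumes "u \<in> controls P t T" "0 \<le> t" "t \<le> T" "w \<in> AC \<alpha> t"
  shows "motion \<alpha> f t w T u \<in> AC \<alpha> T" "\<And>s. s \<in> {0..t} \<Longrightarrow> motion \<alpha> f t w T u s = w s"
    "continuous_on {0..T} (motion \<alpha> f t w T u)"
    "restrict (motion \<alpha> f t w T u) {0..t} = w"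
proof -
  have m: "motions t w T u (motion \<alpha> f t w T u)"
    by (rule motion_is_motion[OF assms(1-3) order_refl assms(4)])
  then show A: "motion \<alpha> f t w T u \<in> AC \<alpha> T" and w: "\<And>s. s \<in> {0..t} \<Longrightarrow> motion \<alpha> f t w T u s = w s"
    by (auto simp: is_motion_def)
  show "continuous_on {0..T} (motion \<alpha> f t w T u)" by (rule AC_continuous[OF A \<alpha>])
  show "restrict (motion \<alpha> f t w T u) {0..t} = w"
  proof (rule extensionalityI[of _ "{0..t}"])
    show "w \<in> extensional {0..t}" using assms(4) by (simp add: AC_def)
  qed (use w in auto)
qed

lemma running_cost_integrable:
  assumes "u \<in> controls P t T" "0 \<le> t" "continuous_on {0..T} x"
  shows "(\<lambda>r. chi r (x r) (u r)) integrable_on {t..T}"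
    "(LINT r:{t..T}|lebesgue. chi r (x r) (u r)) = integral {t..T} (\<lambda>r. chi r (x r) (u r))"
  using set_lebesgue_integral_eq_integral[OF along_control_integrable[OF chi_cont assms(3,1,2) order_refl]] by auto

lemma cost_eq:
  assumes "u \<in> controls P t T" "0 \<le> t" "t \<le> T" "w \<in> AC \<alpha> t"
  defines "x \<equiv> motion \<alpha> f t w T u"
  shows "J t w u = \<sigma> (x T) + integral {t..T} (\<lambda>r. chi r (x r) (u r))"
  using running_cost_integrable(2)[OF assms(1,2) motion_in_AC(3)[OF assms(1-4)]]
  by (simp add: cost_def x_def Let_def)

text \<open>A real infimum is a lower bound only for a set that is bounded below. The radius
  \<open>R\<close> common to all controls confines the arguments of \<open>\<sigma>\<close> and
  \<open>chi\<close> to compact sets.\<close>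

lemma cost_bdd_below:
  assumes t: "0 \<le> t" "t \<le> T" and w: "w \<in> AC \<alpha> t"
  shows "bdd_below (J t w ` controls P t T)"
proof -
  obtain R where R: "R > 0" "\<And>u \<tau>. u \<in> controls P t T \<Longrightarrow> \<tau> \<in> {0..T} \<Longrightarrow> norm (motion \<alpha> f t w T u \<tau>) \<le> R"
    using motion_bounds[OF t w] by blast
  have "bounded (\<sigma> ` cball 0 R)"
    by (intro compact_imp_bounded compact_continuous_image continuous_on_subset[OF \<sigma>_cont]) auto
  then obtain B where B: "\<And>y. norm y \<le> R \<Longrightarrow> \<bar>\<sigma> y\<bar> \<le> B" unfolding bounded_iff by fastforce
  have "bounded ((\<lambda>(\<tau>, x, u). chi \<tau> x u) ` ({0..T} \<times> cball 0 R \<times> P))"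
    by (intro compact_imp_bounded compact_continuous_image compact_Times continuous_on_subset[OF chi_cont] P) auto
  then obtain C where C: "\<And>\<tau> y u. \<tau> \<in> {0..T} \<Longrightarrow> norm y \<le> R \<Longrightarrow> u \<in> P \<Longrightarrow> \<bar>chi \<tau> y u\<bar> \<le> C"
    unfolding bounded_iff by fastforce
  show ?thesis
  proof (rule bdd_belowI2)
    fix u assume u: "u \<in> controls P t T"
    let ?x = "motion \<alpha> f t w T u"
    have "norm (integral {t..T} (\<lambda>r. chi r (?x r) (u r))) \<le> integral {t..T} (\<lambda>r. C)"
    proof (rule integral_norm_bound_integral)
      show "(\<lambda>r. chi r (?x r) (u r)) integrable_on {t..T}"
        by (rule running_cost_integrable(1)[OF u t(1) motion_in_AC(3)[OF u t w]])
      show "norm (chi r (?x r) (u r)) \<le> C" if "r \<in> {t..T}" for r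
        using C[of r "?x r" "u r"] R(2)[OF u, of r] controls_mem[OF u that] that t by auto
    qed auto
    moreover have "\<bar>\<sigma> (?x T)\<bar> \<le> B" using B R(2)[OF u, of T] t by auto
    ultimately show "- B - integral {t..T} (\<lambda>r. C) \<le> J t w u"
      unfolding cost_eq[OF u t w] by (simp add: abs_le_iff)
  qed
qed

lemma value_le_cost:
  assumes "0 \<le> t" "t \<le> T" "w \<in> AC \<alpha> t" "u \<in> controls P t T"
  shows "V (t, w) \<le> J t w u"
  using cINF_lower[OF cost_bdd_below[OF assms(1-3)] assms(4)] by (simp add: value_functional_def)

text \<open>The tail of \<open>u\<close> competes from the position reached at time \<open>s\<close>
  and, by \<open>motion_restrict\<close>, generates the same motion; what remains is the cost
  accumulated before \<open>s\<close>.\<close>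

lemma cost_ge_value:
  assumes u: "u \<in> controls P t T" and t: "0 \<le> t" "t \<le> s" "s \<le> T" and w: "w \<in> AC \<alpha> t"
  defines "x \<equiv> motion \<alpha> f t w T u"
  shows "integral {t..s} (\<lambda>r. chi r (x r) (u r)) + V (s, restrict x {0..s}) \<le> J t w u"
proof -
  have tT: "t \<le> T" "0 \<le> s" using t by auto
  note x = motion_in_AC[OF u t(1) tT(1) w, folded x_def]
  let ?y = "restrict x {0..s}" and ?v = "restrict u {s..T}"
  have y: "?y \<in> AC \<alpha> s" by (rule AC_restrict[OF x(1) tT(2) t(3)])
  have v: "?v \<in> controls P s T" by (rule controls_restrict[OF u t(2)])
  have "V (s, ?y) \<le> J s ?y ?v" by (rule value_le_cost[OF tT(2) t(3) y v])
  also have "\<dots> = \<sigma> (x T) + integral {s..T} (\<lambda>r. chi r (x r) (?v r))"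
    using cost_eq[OF v tT(2) t(3) y] motion_restrict[OF u t w] by (simp add: x_def)
  also have "integral {s..T} (\<lambda>r. chi r (x r) (?v r)) = integral {s..T} (\<lambda>r. chi r (x r) (u r))"
    by (rule Henstock_Kurzweil_Integration.integral_cong) simp
  finally have "V (s, ?y) \<le> \<sigma> (x T) + integral {s..T} (\<lambda>r. chi r (x r) (u r))" .
  moreover have "integral {t..s} (\<lambda>r. chi r (x r) (u r)) + integral {s..T} (\<lambda>r. chi r (x r) (u r))
      = integral {t..T} (\<lambda>r. chi r (x r) (u r))"
    by (rule Henstock_Kurzweil_Integration.integral_combine[OF t(2,3) running_cost_integrable(1)[OF u t(1) x(3)]])
  ultimately show ?thesis using cost_eq[OF u t(1) tT(1) w] by (simp add: x_def)
qed

text \<open>Every control \<open>v\<close> from time \<open>s\<close> may follow \<open>u\<close>,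
  and the pasted control competes at \<open>(t, w)\<close>. Passing to the infimum over
  \<open>v\<close> avoids choosing nearly optimal tails.\<close>

lemma value_le:
  assumes u: "u \<in> controls P t T" and t: "0 \<le> t" "t \<le> s" "s \<le> T" and w: "w \<in> AC \<alpha> t"
  defines "x \<equiv> motion \<alpha> f t w T u"
  shows "V (t, w) \<le> integral {t..s} (\<lambda>r. chi r (x r) (u r)) + V (s, restrict x {0..s})"
proof -
  have tT: "t \<le> T" "0 \<le> s" using t by auto
  let ?y = "restrict x {0..s}" and ?I = "integral {t..s} (\<lambda>r. chi r (x r) (u r))"
  have "V (t, w) - ?I \<le> J s ?y v" if v: "v \<in> controls P s T" for v
  proof -
    define uv where "uv = (\<lambda>r\<in>{t..T}. if r < s then u r else v r)"
    note c = motion_concat[OF u v t w, folded x_def uv_def]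
    define z where "z = motion \<alpha> f s ?y T v"
    note z = motion_in_AC[OF v tT(2) t(3) c(2), folded z_def]
    have "V (t, w) \<le> J t w uv" by (rule value_le_cost[OF t(1) tT(1) w c(1)])
    also have "\<dots> = \<sigma> (z T) + integral {t..T} (\<lambda>r. chi r (z r) (uv r))"
      using cost_eq[OF c(1) t(1) tT(1) w] c(3) by (simp add: z_def)
    also have "integral {t..T} (\<lambda>r. chi r (z r) (uv r))
        = integral {t..s} (\<lambda>r. chi r (z r) (uv r)) + integral {s..T} (\<lambda>r. chi r (z r) (uv r))"
      by (rule Henstock_Kurzweil_Integration.integral_combine[OF t(2,3) running_cost_integrable(1)[OF c(1) t(1) z(3)], symmetric])
    \<comment> \<open>At \<open>r = s\<close> the pasted control already follows \<open>v\<close>;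
      this single point is negligible.\<close>
    also have "integral {t..s} (\<lambda>r. chi r (z r) (uv r)) = ?I"
      by (rule integral_spike[of "{s}"]) (use z(2) t in \<open>auto simp: uv_def\<close>)
    also have "integral {s..T} (\<lambda>r. chi r (z r) (uv r)) = integral {s..T} (\<lambda>r. chi r (z r) (v r))"
      by (rule Henstock_Kurzweil_Integration.integral_cong) (use t in \<open>auto simp: uv_def\<close>)
    finally show ?thesis using cost_eq[OF v tT(2) t(3) c(2)] by (simp add: z_def)
  qed
  then have "V (t, w) - ?I \<le> V (s, ?y)"
    unfolding value_functional_def prod.case by (intro cINF_greatest controls_nonempty)
  then show ?thesis by simp
qed

text \<open>Uniformity in \<open>u\<close> comes from uniform continuity on a compact set, the state
  ranging over the unit ball around \<open>y\<close>: hence the 1 in the witness. The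
  \<open>d/2\<close> is there because the distance of two triples is at most the sum of the
  distances in time and state.\<close>

lemma hamiltonian_integrand_near:
  assumes t: "t \<in> {0..T}" and e: "e > 0"
  shows "\<exists>\<delta>>0. \<forall>r\<in>{0..T}. \<forall>y'. \<forall>u\<in>P. \<bar>r - t\<bar> < \<delta> \<longrightarrow> norm (y' - y) < \<delta> \<longrightarrow>
    \<bar>(v \<bullet> f r y' u + chi r y' u) - (v \<bullet> f t y u + chi t y u)\<bar> < e"
proof -
  let ?S = "{0..T} \<times> cball y 1 \<times> P" and ?g = "\<lambda>(r, y, u). v \<bullet> f r y u + chi r y u"
  have "continuous_on ?S (\<lambda>p. v \<bullet> (case p of (r, y, u) \<Rightarrow> f r y u) + (case p of (r, y, u) \<Rightarrow> chi r y u))"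
    by (intro continuous_intros continuous_on_subset[OF f_cont] continuous_on_subset[OF chi_cont]) auto
  then have "continuous_on ?S ?g" by (simp add: case_prod_unfold)
  then have uc: "uniformly_continuous_on ?S ?g"
    by (rule compact_uniformly_continuous) (intro compact_Times P; simp)
  obtain d where d: "d > 0" "\<And>q p. q \<in> ?S \<Longrightarrow> p \<in> ?S \<Longrightarrow> dist p q < d \<Longrightarrow> dist (?g p) (?g q) < e"
    by (rule uniformly_continuous_onE[OF uc e]) (rule that)
  show ?thesis
  proof (intro exI[of _ "min 1 (d/2)"] conjI ballI allI impI)
    show "min 1 (d/2) > 0" using d by simp
    fix r y' u assume a: "r \<in> {0..T}" "u \<in> P" "\<bar>r - t\<bar> < min 1 (d/2)" "norm (y' - y) < min 1 (d/2)"
    have "dist (r, y', u) (t, y, u) = sqrt ((dist r t)\<^sup>2 + (dist y' y)\<^sup>2)"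
      by (simp add: dist_Pair_Pair)
    also have "\<dots> \<le> dist r t + dist y' y" by (rule sqrt_sum_squares_le_sum) auto
    also have "\<dots> = \<bar>r - t\<bar> + norm (y' - y)" by (simp add: dist_real_def dist_norm)
    also have "\<dots> < d" using a by simp
    finally have "dist (?g (r, y', u)) (?g (t, y, u)) < e"
      using a t by (intro d(2)) (auto simp: dist_norm norm_minus_commute)
    then show "\<bar>(v \<bullet> f r y' u + chi r y' u) - (v \<bullet> f t y u + chi t y u)\<bar> < e" by (simp add: dist_real_def)
  qed
qed

lemma hamiltonian_le:
  assumes "t \<in> {0..T}" "u \<in> P"
  shows "hamiltonian P f chi t y v \<le> v \<bullet> f t y u + chi t y u"
proof -
  have "continuous_on P (\<lambda>u. v \<bullet> (case (t, y, u) of (r, y, u) \<Rightarrow> f r y u) + (case (t, y, u) of (r, y, u) \<Rightarrow> chi r y u))"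
    by (intro continuous_intros continuous_on_compose2[OF f_cont] continuous_on_compose2[OF chi_cont]) (use assms in auto)
  then have "compact ((\<lambda>u. v \<bullet> f t y u + chi t y u) ` P)"
    using P by (intro compact_continuous_image) auto
  then have "bdd_below ((\<lambda>u. v \<bullet> f t y u + chi t y u) ` P)"
    by (intro bounded_imp_bdd_below compact_imp_bounded)
  then show ?thesis unfolding hamiltonian_def using assms(2) by (rule cINF_lower)
qed

lemma along_control_integrable_on:
  assumes u: "u \<in> controls P t T" and x: "continuous_on {0..T} x" and t: "0 \<le> t" "t \<le> \<tau>" "\<tau>' \<le> T"
  shows "(\<lambda>r. f r (x r) (u r)) integrable_on {\<tau>..\<tau>'}" "(\<lambda>r. chi r (x r) (u r)) integrable_on {\<tau>..\<tau>'}"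
proof -
  have "(\<lambda>r. f r (x r) (u r)) integrable_on {t..T}" "(\<lambda>r. chi r (x r) (u r)) integrable_on {t..T}"
    using set_lebesgue_integral_eq_integral(1)[OF along_control_integrable[OF f_cont x u t(1) order_refl]]
      set_lebesgue_integral_eq_integral(1)[OF along_control_integrable[OF chi_cont x u t(1) order_refl]] by auto
  then show "(\<lambda>r. f r (x r) (u r)) integrable_on {\<tau>..\<tau>'}" "(\<lambda>r. chi r (x r) (u r)) integrable_on {\<tau>..\<tau>'}"
    using t by (auto elim!: integrable_on_subinterval)
qed

text \<open>Merges the first-order term of a coinvariant expansion with the running cost, so that a
  pointwise bound on one integrand controls the change of value plus cost.\<close>

lemma integral_along_control:
  assumes u: "u \<in> controls P t T" and x: "continuous_on {0..T} x" and t: "0 \<le> t" "t \<le> \<tau>" "\<tau> \<le> \<tau>'" "\<tau>' \<le> T"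
  shows "(\<lambda>r. a + (v \<bullet> f r (x r) (u r) + chi r (x r) (u r))) integrable_on {\<tau>..\<tau>'}"
    "integral {\<tau>..\<tau>'} (\<lambda>r. a + (v \<bullet> f r (x r) (u r) + chi r (x r) (u r)))
     = a * (\<tau>' - \<tau>) + v \<bullet> integral {\<tau>..\<tau>'} (\<lambda>r. f r (x r) (u r)) + integral {\<tau>..\<tau>'} (\<lambda>r. chi r (x r) (u r))"
proof -
  note i = along_control_integrable_on[OF u x t(1,2,4)]
  have "((\<lambda>r. a + (v \<bullet> f r (x r) (u r) + chi r (x r) (u r))) has_integral
     (\<tau>' - \<tau>) * a + (v \<bullet> integral {\<tau>..\<tau>'} (\<lambda>r. f r (x r) (u r)) + integral {\<tau>..\<tau>'} (\<lambda>r. chi r (x r) (u r)))) {\<tau>..\<tau>'}"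
    using has_integral_const_real[of a \<tau> \<tau>'] t
      has_integral_linear[OF integrable_integral[OF i(1)] bounded_linear_inner_right[of v]]
    by (intro has_integral_add integrable_integral[OF i(2)]) (auto simp: o_def)
  then show "(\<lambda>r. a + (v \<bullet> f r (x r) (u r) + chi r (x r) (u r))) integrable_on {\<tau>..\<tau>'}"
    "integral {\<tau>..\<tau>'} (\<lambda>r. a + (v \<bullet> f r (x r) (u r) + chi r (x r) (u r)))
     = a * (\<tau>' - \<tau>) + v \<bullet> integral {\<tau>..\<tau>'} (\<lambda>r. f r (x r) (u r)) + integral {\<tau>..\<tau>'} (\<lambda>r. chi r (x r) (u r))"
    by (auto simp: integral_unique integrable_on_def)
qed

end

section \<open>The two inequalities of the Hamilton-Jacobi-Bellman equation\<close>

lemma small_step: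
  fixes \<alpha> M \<delta> :: real
  assumes "0 < \<alpha>" "0 < \<delta>"
  shows "\<exists>h>0. h + M * h powr \<alpha> < \<delta>"
proof -
  have "((\<lambda>h::real. h powr \<alpha>) \<longlongrightarrow> 0 powr \<alpha>) (at_right 0)"
    by (rule tendsto_powr'[OF tendsto_ident_at tendsto_const]) (use assms in \<open>auto simp: eventually_at_filter\<close>)
  then have "((\<lambda>h. h + M * h powr \<alpha>) \<longlongrightarrow> 0 + M * 0 powr \<alpha>) (at_right 0)"
    by (intro tendsto_add tendsto_mult_left tendsto_ident_at)
  then have "\<forall>\<^sub>F h in at_right 0. h + M * h powr \<alpha> < \<delta>"
    using assms by (intro order_tendstoD(2)) auto
  moreover have "\<forall>\<^sub>F h in at_right (0::real). 0 < h" by (rule eventually_at_right_less)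
  ultimately have "\<forall>\<^sub>F h in at_right 0. 0 < h \<and> h + M * h powr \<alpha> < \<delta>"
    by eventually_elim simp
  then show ?thesis using eventually_happens'[OF trivial_limit_at_right_real] by blast
qed

context control_system
begin

text \<open>The Hoelder bound makes nearby times give nearby positions. This supplies the continuity
  that \<open>increment_ge_of_local_increments\<close> asks for.\<close>

lemma path_continuous:
  assumes V: "pos_continuous_on (positions \<alpha> T) \<phi>"
    and x: "x \<in> AC \<alpha> T" and M: "\<And>a b. 0 \<le> a \<Longrightarrow> a \<le> b \<Longrightarrow> b \<le> T \<Longrightarrow> norm (x b - x a) \<le> M * (b - a) powr \<alpha>"
    and M0: "M \<ge> 0"
  shows "continuous_on {0..T} (\<lambda>\<tau>. \<phi> (\<tau>, restrict x {0..\<tau>}))"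
  unfolding continuous_on_iff
proof (intro ballI allI impI)
  fix \<tau> e :: real assume \<tau>: "\<tau> \<in> {0..T}" and e: "e > 0"
  have pos: "(s, restrict x {0..s}) \<in> positions \<alpha> T" if "s \<in> {0..T}" for s
    using AC_restrict[OF x, of s] that by (auto simp: positions_def)
  obtain \<delta> where \<delta>: "\<delta> > 0" "\<And>q. q \<in> positions \<alpha> T \<Longrightarrow> pos_dist q (\<tau>, restrict x {0..\<tau>}) < \<delta> \<Longrightarrow>
      dist (\<phi> q) (\<phi> (\<tau>, restrict x {0..\<tau>})) < e"
    using V pos[OF \<tau>] e unfolding pos_continuous_on_def by meson
  have pd: "pos_dist (b, restrict x {0..b}) (a, restrict x {0..a}) \<le> (b - a) + M * (b - a) powr \<alpha>"
    if "0 \<le> a" "a \<le> b" "b \<le> T" for a b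
  proof (rule pos_dist_restrict_le)
    fix r assume r: "r \<in> {a..b}"
    then have "norm (x r - x a) \<le> M * (r - a) powr \<alpha>" using M[of a r] that by auto
    also have "\<dots> \<le> M * (b - a) powr \<alpha>" using r M0 \<alpha> by (intro mult_left_mono powr_mono2) auto
    finally show "norm (x r - x a) \<le> M * (b - a) powr \<alpha>" .
  qed (use that in auto)
  obtain h where h: "h > 0" "h + M * h powr \<alpha> < \<delta>"
    using small_step[OF \<alpha>(1) \<delta>(1), of M] by blast
  have "dist (\<phi> (s, restrict x {0..s})) (\<phi> (\<tau>, restrict x {0..\<tau>})) < e"
    if s: "s \<in> {0..T}" "dist s \<tau> < h" for s
  proof -
    have "pos_dist (s, restrict x {0..s}) (\<tau>, restrict x {0..\<tau>}) \<le> \<bar>s - \<tau>\<bar> + M * \<bar>s - \<tau>\<bar> powr \<alpha>"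
    proof (cases "s \<le> \<tau>")
      case True
      then show ?thesis
        using pd[of s \<tau>] s \<tau> by (subst pos_dist_commute) auto
    next
      case False
      then show ?thesis using pd[of \<tau> s] s \<tau> by auto
    qed
    also have "\<dots> \<le> h + M * h powr \<alpha>"
      using s M0 \<alpha> by (intro add_mono mult_left_mono powr_mono2) (auto simp: dist_real_def)
    also have "\<dots> < \<delta>" by (rule h(2))
    finally show ?thesis by (rule \<delta>(2)[OF pos[OF s(1)]])
  qed
  then show "\<exists>d>0. \<forall>s\<in>{0..T}. dist s \<tau> < d \<longrightarrow>
      dist (\<phi> (s, restrict x {0..s})) (\<phi> (\<tau>, restrict x {0..\<tau>})) < e"
    using h(1) by blast
qed

text \<open>If some \<open>u\<close> made the sum negative, value plus accumulated cost would fall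
  along the motion of the constant control \<open>u\<close>, against \<open>value_le\<close>. The
  coinvariant derivatives are used at \<open>(t, w)\<close> alone.\<close>

lemma ci_dt_hamiltonian_nonneg:
  assumes smooth: "ci_smooth \<alpha> T V" and tw: "(t, w) \<in> positions0 \<alpha> T"
  defines "a \<equiv> ci_dt \<alpha> T V (t, w)" and "v \<equiv> ci_grad \<alpha> T V (t, w)"
  shows "0 \<le> a + hamiltonian P f chi t (w t) v"
proof -
  have t: "0 \<le> t" "t < T" and w: "w \<in> AC \<alpha> t" using tw by (auto simp: positions0_def positions_def)
  have d: "has_ci_derivative \<alpha> T V a v (t, w)"
    unfolding a_def v_def using smooth tw \<alpha> by (intro has_ci_derivative_ci_dt_ci_grad) (auto simp: ci_smooth_def)
  have "- a \<le> v \<bullet> f t (w t) u + chi t (w t) u" if uP: "u \<in> P" for u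
  proof (rule ccontr)
    \<comment> \<open>The assumed deficit is \<open>3 * e\<close>. Continuity of the integrand costs
      one \<open>e\<close>, leaving a rate of at most \<open>- 2 * e\<close>, while
      \<open>value_le\<close> and the expansion error force a rate of at least
      \<open>- e\<close>.\<close>
    define e where "e = - (a + (v \<bullet> f t (w t) u + chi t (w t) u)) / 3"
    assume "\<not> - a \<le> v \<bullet> f t (w t) u + chi t (w t) u"
    then have e: "e > 0" by (simp add: e_def)
    define c where "c = (\<lambda>_\<in>{t..T}. u)"
    have c: "c \<in> controls P t T" unfolding c_def by (rule const_control[OF uP])
    define x where "x = motion \<alpha> f t w T c"
    note x = motion_in_AC[OF c t(1) less_imp_le[OF t(2)] w, folded x_def]
    have m: "AE s in lebesgue_on {t..T}. has_caputo_derivative \<alpha> x (f s (x s) (c s)) s"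
      using motion_is_motion[OF c t(1) less_imp_le[OF t(2)] order_refl w] by (simp add: is_motion_def x_def)
    obtain \<delta> where \<delta>: "\<delta> > 0" "\<forall>r\<in>{0..T}. \<forall>y'. \<forall>u\<in>P. \<bar>r - t\<bar> < \<delta> \<longrightarrow> norm (y' - w t) < \<delta> \<longrightarrow>
        \<bar>(v \<bullet> f r y' u + chi r y' u) - (v \<bullet> f t (w t) u + chi t (w t) u)\<bar> < e"
      using hamiltonian_integrand_near[of t e "w t" v] t e by auto
    have xt: "x t = w t" using x(2) t by simp
    obtain \<delta>' where \<delta>': "\<delta>' > 0" "\<And>r. r \<in> {0..T} \<Longrightarrow> dist r t < \<delta>' \<Longrightarrow> dist (x r) (x t) < \<delta>"
      using x(3) t \<delta>(1) unfolding continuous_on_iff by (metis atLeastAtMost_iff less_imp_le)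
    have "\<forall>\<^sub>F \<tau> in at_right t. \<tau> \<in> {t<..<t + min \<delta> \<delta>'}"
      using \<delta>(1) \<delta>'(1) by (intro eventually_at_right_real) simp
    moreover have "\<forall>\<^sub>F \<tau> in at_right t. \<tau> \<in> {t<..<T} \<and> \<bar>V (\<tau>, restrict x {0..\<tau>}) - V (t, w) -
           (a * (\<tau> - t) + v \<bullet> integral {t..\<tau>} (\<lambda>s. f s (x s) (c s)))\<bar> \<le> e * (\<tau> - t)"
      by (rule has_ci_derivative_expansion[OF d x(1) \<alpha> t _ m e]) (use x(2) in blast)
    ultimately have "\<forall>\<^sub>F \<tau> in at_right t. False"
    proof eventually_elim
      case (elim \<tau>)
      note \<tau> = elim(1) and ex = elim(2)
      have t\<tau>: "t \<le> \<tau>" "\<tau> \<le> T" using ex by auto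
      note I = integral_along_control[OF c x(3) t(1) order_refl t\<tau>, of a v]
      have "V (t, w) \<le> integral {t..\<tau>} (\<lambda>r. chi r (x r) (c r)) + V (\<tau>, restrict x {0..\<tau>})"
        using value_le[OF c t(1) t\<tau> w] by (simp add: x_def)
      then have "- e * (\<tau> - t) \<le> integral {t..\<tau>} (\<lambda>r. a + (v \<bullet> f r (x r) (c r) + chi r (x r) (c r)))"
        using ex unfolding I(2) by linarith
      also have "\<dots> \<le> integral {t..\<tau>} (\<lambda>r. - 2 * e)"
      proof (rule integral_le[OF I(1)])
        fix r assume r: "r \<in> {t..\<tau>}"
        then have "dist (x r) (x t) < \<delta>" using \<tau> t t\<tau> by (intro \<delta>') (auto simp: dist_real_def)
        then have "\<bar>(v \<bullet> f r (x r) u + chi r (x r) u) - (v \<bullet> f t (w t) u + chi t (w t) u)\<bar> < e"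
          using \<delta>(2) r \<tau> t t\<tau> uP xt by (auto simp: dist_norm)
        moreover have "v \<bullet> f t (w t) u + chi t (w t) u = - a - 3 * e" by (simp add: e_def field_simps)
        moreover have cr: "c r = u" using r t\<tau> by (auto simp: c_def)
        ultimately show "a + (v \<bullet> f r (x r) (c r) + chi r (x r) (c r)) \<le> - 2 * e"
          unfolding cr abs_less_iff by linarith
      qed auto
      finally have "e * (\<tau> - t) \<le> 0" using t\<tau> by (simp add: algebra_simps)
      then show False using e \<tau> by (auto simp: mult_le_0_iff)
    qed
    then show False by simp
  qed
  then have "- a \<le> hamiltonian P f chi t (w t) v"
    unfolding hamiltonian_def using P by (intro cINF_greatest) auto
  then show ?thesis by simp
qed

text \<open>Only a gain bounded below over all controls can contradict an infimum. For a common
  \<open>h\<close>, value plus accumulated cost grows by at least \<open>e / 2 * h\<close> along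
  each motion, and \<open>cost_ge_value\<close> turns this into a lower bound for every
  cost.\<close>

lemma ci_dt_hamiltonian_nonpos:
  assumes smooth: "ci_smooth \<alpha> T V" and tw: "(t, w) \<in> positions0 \<alpha> T"
  defines "a \<equiv> ci_dt \<alpha> T V (t, w)" and "v \<equiv> ci_grad \<alpha> T V (t, w)"
  shows "a + hamiltonian P f chi t (w t) v \<le> 0"
proof (rule ccontr)
  \<comment> \<open>Of the assumed excess \<open>2 * e\<close>, one \<open>e\<close> pays for moving
    away from \<open>(t, w)\<close> and \<open>e / 2\<close> for the expansion remainder; a rate of
    \<open>e / 2\<close> survives.\<close>
  define e where "e = (a + hamiltonian P f chi t (w t) v) / 2"
  assume "\<not> a + hamiltonian P f chi t (w t) v \<le> 0"
  then have e: "e > 0" by (simp add: e_def)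
  have t: "0 \<le> t" "t < T" "t \<le> T" and w: "w \<in> AC \<alpha> t" using tw by (auto simp: positions0_def positions_def)
  obtain c where c: "c > 0" "\<forall>\<tau>\<in>{0..T}. \<forall>x. \<forall>u\<in>P. norm (f \<tau> x u) \<le> (1 + norm x) * c"
    using f_growth by blast
  \<comment> \<open>Bounds the field at states within distance 1 of \<open>w t\<close>, whose norm
    is at most \<open>norm (w t) + 1\<close>.\<close>
  define Mf where "Mf = (2 + norm (w t)) * c"
  have Mf: "Mf \<ge> 0" using c by (simp add: Mf_def)
  \<comment> \<open>Three errors must sum to at most \<open>e\<close>: one \<open>\<eta>\<close> for
    \<open>ci_dt\<close>, one for the integrand with \<open>v\<close> frozen, and
    \<open>\<eta> * Mf\<close> for the change of the gradient tested against the field.\<close>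
  define \<eta> where "\<eta> = e / (2 + Mf)"
  have \<eta>: "\<eta> > 0" using e Mf by (simp add: \<eta>_def)
  have \<eta>e: "2 * \<eta> + \<eta> * Mf = e" 
  proof -
    have "\<eta> * (2 + Mf) = e" using Mf by (simp add: \<eta>_def)
    then show ?thesis by (simp add: algebra_simps)
  qed
  obtain \<delta>1 where \<delta>1: "\<delta>1 > 0" "\<forall>r\<in>{0..T}. \<forall>y'. \<forall>u\<in>P. \<bar>r - t\<bar> < \<delta>1 \<longrightarrow> norm (y' - w t) < \<delta>1 \<longrightarrow>
      \<bar>(v \<bullet> f r y' u + chi r y' u) - (v \<bullet> f t (w t) u + chi t (w t) u)\<bar> < \<eta>"
    using hamiltonian_integrand_near[of t \<eta> "w t" v] t \<eta> by auto
  have cont: "pos_continuous_on (positions0 \<alpha> T) (ci_dt \<alpha> T V)" "pos_continuous_on (positions0 \<alpha> T) (ci_grad \<alpha> T V)"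
    using smooth by (auto simp: ci_smooth_def)
  obtain \<delta>2 where \<delta>2: "\<delta>2 > 0" "\<forall>q\<in>positions0 \<alpha> T. pos_dist q (t, w) < \<delta>2 \<longrightarrow> dist (ci_dt \<alpha> T V q) a < \<eta>"
    using cont(1)[unfolded pos_continuous_on_def, rule_format, OF tw \<eta>] unfolding a_def by blast
  obtain \<delta>3 where \<delta>3: "\<delta>3 > 0" "\<forall>q\<in>positions0 \<alpha> T. pos_dist q (t, w) < \<delta>3 \<longrightarrow> dist (ci_grad \<alpha> T V q) v < \<eta>"
    using cont(2)[unfolded pos_continuous_on_def, rule_format, OF tw \<eta>] unfolding v_def by blast
  obtain M where M: "M \<ge> 0" "\<And>u b a. u \<in> controls P t T \<Longrightarrow> 0 \<le> a \<Longrightarrow> a \<le> b \<Longrightarrow> b \<le> T \<Longrightarrow>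
       norm (motion \<alpha> f t w T u b - motion \<alpha> f t w T u a) \<le> M * (b - a) powr \<alpha>"
    using motion_bounds[OF t(1,3) w] by blast
  \<comment> \<open>The 1 keeps the motions where \<open>Mf\<close> is valid; \<open>T - t\<close>
    keeps \<open>t + h\<close> before \<open>T\<close>, so that the positions met stay in
    \<open>positions0\<close>.\<close>
  define \<delta> where "\<delta> = min (min (min \<delta>1 \<delta>2) (min \<delta>3 1)) (T - t)"
  have "\<delta> > 0" using \<delta>1 \<delta>2 \<delta>3 t by (simp add: \<delta>_def)
  then obtain h where h: "h > 0" "h + M * h powr \<alpha> < \<delta>" using small_step[OF \<alpha>(1), of \<delta> M] by auto
  have "0 \<le> M * h powr \<alpha>" using M(1) by simp
  then have h\<delta>: "h < \<delta>" "M * h powr \<alpha> < \<delta>" "t + h < T" using h by (auto simp: \<delta>_def)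
  have "V (t, w) + e / 2 * h \<le> J t w u" if u: "u \<in> controls P t T" for u
  proof -
    define x where "x = motion \<alpha> f t w T u"
    note x = motion_in_AC[OF u t(1,3) w, folded x_def]
    have xM: "norm (x b - x a) \<le> M * (b - a) powr \<alpha>" if "0 \<le> a" "a \<le> b" "b \<le> T" for a b
      unfolding x_def by (rule M(2)[OF u that])
    have m: "AE s in lebesgue_on {t..T}. has_caputo_derivative \<alpha> x (f s (x s) (u s)) s"
      using motion_is_motion[OF u t(1,3) order_refl w] by (simp add: is_motion_def x_def)
    have xt: "x t = w t" using x(2) t by simp
    have xh: "norm (x r - x t) \<le> M * h powr \<alpha>" if "r \<in> {t..t + h}" for r
    proof -
      have "norm (x r - x t) \<le> M * (r - t) powr \<alpha>" using xM[of t r] that t h\<delta> by auto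
      also have "\<dots> \<le> M * h powr \<alpha>" using that M(1) \<alpha> by (intro mult_left_mono powr_mono2) auto
      finally show ?thesis .
    qed
    define g where "g = (\<lambda>\<tau>. V (\<tau>, restrict x {0..\<tau>}) + integral {t..\<tau>} (\<lambda>r. chi r (x r) (u r)))"
    have "e / 2 * ((t + h) - t) \<le> g (t + h) - g t"
    proof (rule increment_ge_of_local_increments)
      show "t \<le> t + h" using h by simp
      have "continuous_on {0..T} (\<lambda>\<tau>. V (\<tau>, restrict x {0..\<tau>}))"
        using smooth by (intro path_continuous[OF _ x(1) xM M(1)]) (auto simp: ci_smooth_def)
      then show "continuous_on {t..t + h} g" unfolding g_def
        using along_control_integrable_on(2)[OF u x(3) t(1) order_refl, of "t + h"] h\<delta> t
        by (intro continuous_on_add indefinite_integral_continuous_1) (auto elim!: continuous_on_subset)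
      fix \<tau> assume \<tau>: "\<tau> \<in> {t..<t + h}"
      let ?q = "(\<tau>, restrict x {0..\<tau>})"
      have \<tau>T: "0 \<le> \<tau>" "\<tau> < T" "\<tau> \<le> T" using \<tau> t h\<delta> by auto
      have q: "?q \<in> positions0 \<alpha> T"
        using AC_restrict[OF x(1)] \<tau>T by (auto simp: positions0_def positions_def)
      have "pos_dist ?q (t, restrict x {0..t}) \<le> (\<tau> - t) + M * h powr \<alpha>"
        using \<tau> t xh by (intro pos_dist_restrict_le) auto
      then have "pos_dist ?q (t, w) < \<delta>" using \<tau> h(2) x(4) by simp
      then have aq: "dist (ci_dt \<alpha> T V ?q) a < \<eta>" and vq: "dist (ci_grad \<alpha> T V ?q) v < \<eta>"
        using \<delta>2(2) \<delta>3(2) q by (auto simp: \<delta>_def)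
      define aq where "aq = ci_dt \<alpha> T V ?q"
      define vq where "vq = ci_grad \<alpha> T V ?q"
      have dq: "has_ci_derivative \<alpha> T V aq vq ?q"
        unfolding aq_def vq_def using smooth q \<alpha> by (intro has_ci_derivative_ci_dt_ci_grad) (auto simp: ci_smooth_def)
      \<comment> \<open>\<open>x\<close> extends every position that it passes and still satisfies
        its equation on the later interval, so the expansion applies at \<open>\<tau>\<close> with
        the same field.\<close>
      have mq: "AE s in lebesgue_on {\<tau>..T}. has_caputo_derivative \<alpha> x (f s (x s) (u s)) s"
        using m \<tau> by (auto simp: AE_lebesgue_on_iff elim!: eventually_mono)
      have integrand: "e \<le> aq + (vq \<bullet> f r (x r) (u r) + chi r (x r) (u r))" if r: "r \<in> {t..t + h}" for r
      proof -
        have uP: "u r \<in> P" using controls_mem[OF u] r h\<delta> by auto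
        have rT: "r \<in> {0..T}" using r t h\<delta> by auto
        have xr: "norm (x r - w t) < \<delta>" using xh[OF r] h\<delta> xt by simp
        have "hamiltonian P f chi t (w t) v \<le> v \<bullet> f t (w t) (u r) + chi t (w t) (u r)"
          using t uP by (intro hamiltonian_le) auto
        moreover have "\<bar>(v \<bullet> f r (x r) (u r) + chi r (x r) (u r)) - (v \<bullet> f t (w t) (u r) + chi t (w t) (u r))\<bar> < \<eta>"
          using \<delta>1(2) rT uP xr r h\<delta> by (auto simp: \<delta>_def)
        moreover have "\<bar>(vq - v) \<bullet> f r (x r) (u r)\<bar> \<le> \<eta> * Mf"
        proof -
          have "norm (x r) \<le> norm (w t) + 1"
            using xr norm_triangle_sub[of "x r" "w t"] by (auto simp: \<delta>_def)
          then have "norm (f r (x r) (u r)) \<le> Mf"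
            using c(2)[rule_format, OF rT uP, of "x r"] c(1)
            by (smt (verit) Mf_def mult_right_mono)
          moreover have "norm (vq - v) \<le> \<eta>" using vq by (simp add: vq_def dist_norm)
          ultimately have "norm (vq - v) * norm (f r (x r) (u r)) \<le> \<eta> * Mf" using \<eta> by (intro mult_mono) auto
          then show ?thesis using Cauchy_Schwarz_ineq2[of "vq - v" "f r (x r) (u r)"] by linarith
        qed
        moreover have "\<bar>aq - a\<bar> < \<eta>" using aq by (simp add: aq_def dist_real_def)
        moreover have "vq \<bullet> f r (x r) (u r) = v \<bullet> f r (x r) (u r) + (vq - v) \<bullet> f r (x r) (u r)"
          by (simp add: inner_diff_left)
        moreover have "a + hamiltonian P f chi t (w t) v = 2 * e" by (simp add: e_def)
        ultimately show ?thesis using \<eta>e unfolding abs_less_iff abs_le_iff by linarith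
      qed
      have "\<forall>\<^sub>F \<tau>' in at_right \<tau>. \<tau>' \<in> {\<tau><..<t + h}"
        using \<tau> by (intro eventually_at_right_real) simp
      moreover have "\<forall>\<^sub>F \<tau>' in at_right \<tau>. \<tau>' \<in> {\<tau><..<T} \<and>
          \<bar>V (\<tau>', restrict x {0..\<tau>'}) - V ?q - (aq * (\<tau>' - \<tau>) + vq \<bullet> integral {\<tau>..\<tau>'} (\<lambda>s. f s (x s) (u s)))\<bar> \<le> e / 2 * (\<tau>' - \<tau>)"
        using e by (intro has_ci_derivative_expansion[OF dq x(1) \<alpha> \<tau>T(1,2) _ mq]) auto
      ultimately have "\<forall>\<^sub>F \<tau>' in at_right \<tau>. \<tau>' \<in> {\<tau><..t + h} \<and> e / 2 * (\<tau>' - \<tau>) \<le> g \<tau>' - g \<tau>"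
      proof eventually_elim
        case (elim \<tau>')
        then have \<tau>': "t \<le> \<tau>" "\<tau> \<le> \<tau>'" "\<tau>' \<le> T" using \<tau> by auto
        note I = integral_along_control[OF u x(3) t(1) \<tau>', of aq vq]
        have "integral {\<tau>..\<tau>'} (\<lambda>r. e) \<le> integral {\<tau>..\<tau>'} (\<lambda>r. aq + (vq \<bullet> f r (x r) (u r) + chi r (x r) (u r)))"
          using integrand elim \<tau> by (intro integral_le[OF _ I(1)]) auto
        then have "e * (\<tau>' - \<tau>) \<le> aq * (\<tau>' - \<tau>) + vq \<bullet> integral {\<tau>..\<tau>'} (\<lambda>r. f r (x r) (u r)) + integral {\<tau>..\<tau>'} (\<lambda>r. chi r (x r) (u r))"
          unfolding I(2) using \<tau>' by (simp add: mult.commute)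
        moreover have "integral {t..\<tau>} (\<lambda>r. chi r (x r) (u r)) + integral {\<tau>..\<tau>'} (\<lambda>r. chi r (x r) (u r))
            = integral {t..\<tau>'} (\<lambda>r. chi r (x r) (u r))"
          by (rule Henstock_Kurzweil_Integration.integral_combine[OF \<tau>'(1,2)])
             (rule along_control_integrable_on(2)[OF u x(3) t(1) order_refl \<tau>'(3)])
        moreover have "e / 2 * (\<tau>' - \<tau>) + e / 2 * (\<tau>' - \<tau>) = e * (\<tau>' - \<tau>)" by simp
        ultimately have "e / 2 * (\<tau>' - \<tau>) \<le> g \<tau>' - g \<tau>"
          using elim unfolding g_def by linarith
        then show ?case using elim by auto
      qed
      \<comment> \<open>A single point of the right neighbourhood suffices, so its dependence on
        \<open>\<tau>\<close> and on the control does no harm.\<close>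
      from eventually_happens'[OF trivial_limit_at_right_real this]
      show "\<exists>\<tau>'\<in>{\<tau><..t + h}. e / 2 * (\<tau>' - \<tau>) \<le> g \<tau>' - g \<tau>" by blast
    qed
    moreover have "g t = V (t, w)" using x(4) by (simp add: g_def)
    moreover have "g (t + h) \<le> J t w u"
      using cost_ge_value[OF u t(1) _ _ w, of "t + h"] h h\<delta> by (simp add: g_def x_def add.commute)
    ultimately show ?thesis by simp
  qed
  then have "V (t, w) + e / 2 * h \<le> V (t, w)"
    unfolding value_functional_def prod.case by (intro cINF_greatest controls_nonempty)
  then show False using e h by (simp add: mult_le_0_iff)
qed

end

theorem theorem10p1:
  fixes \<alpha> T :: real
    and P :: "(real ^ 'm) set"
    and f :: "real \<Rightarrow> real ^ 'n \<Rightarrow> real ^ 'm \<Rightarrow> real ^ 'n"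
    and \<sigma> :: "real ^ 'n \<Rightarrow> real"
    and chi :: "real \<Rightarrow> real ^ 'n \<Rightarrow> real ^ 'm \<Rightarrow> real"
  assumes "T > 0" and "0 < \<alpha>" and "\<alpha> < 1"
    and "compact P" and "P \<noteq> {}"
    and "continuous_on ({0..T} \<times> UNIV \<times> P) (\<lambda>(\<tau>, x, u). f \<tau> x u)"
    and "\<forall>R>0. \<exists>L>0. \<forall>\<tau>\<in>{0..T}. \<forall>x x'. \<forall>u\<in>P. norm x \<le> R \<longrightarrow> norm x' \<le> R \<longrightarrow>
           norm (f \<tau> x u - f \<tau> x' u) \<le> L * norm (x - x')"
    and "\<exists>c>0. \<forall>\<tau>\<in>{0..T}. \<forall>x. \<forall>u\<in>P. norm (f \<tau> x u) \<le> (1 + norm x) * c"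
    and "continuous_on UNIV \<sigma>"
    and "continuous_on ({0..T} \<times> UNIV \<times> P) (\<lambda>(\<tau>, x, u). chi \<tau> x u)"
    and "ci_smooth \<alpha> T (value_functional \<alpha> T P f \<sigma> chi)"
  shows "\<forall>(t, w) \<in> positions0 \<alpha> T.
           ci_dt \<alpha> T (value_functional \<alpha> T P f \<sigma> chi) (t, w)
           + hamiltonian P f chi t (w t) (ci_grad \<alpha> T (value_functional \<alpha> T P f \<sigma> chi) (t, w)) = 0"
proof -
  interpret control_system \<alpha> T P f \<sigma> chi
    by unfold_locales (fact assms)+
  show ?thesis
    using ci_dt_hamiltonian_nonneg[OF assms(11)] ci_dt_hamiltonian_nonpos[OF assms(11)]
    by (auto intro!: antisym)
qed

end
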